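(* Let $K$ be a field of characteristic zero, let $m \geq 3$ be an integer, and let $e$ be a positive integer. Let $V = K[x_1,\ldots,x_m]_{em}$ be the space of homogeneous polynomials of degree $em$ in $m$ variables, and let $\rho:\mathfrak{sl}_m(K) \to \operatorname{End}(V)$ be the natural representation. Then $\rho(\mathfrak{sl}_m(K))$ is a maximal singular subspace of $\operatorname{End}(V)$.
   Context: Here $\operatorname{End}(V)$ is the space of $K$-linear maps $V\to V$. A linear subspace $\mathcal{A} \subseteq \operatorname{End}(V)$ is called singular if it contains only non-invertible maps, and maximal singular if it is singular and no linear subspace of $\operatorname{End}(V)$ properly containing it is singular. The natural representation of $\mathfrak{sl}_m(K)$ on $V$ is the one on homogeneous polynomial functions on $K^m$; its image $\rho(\mathfrak{sl}_m(K))$ is the $K$-span of the restrictions to $V$ of the differential operators $x_i \frac{\partial}{\partial x_j}$ for $i \neq j$ and $x_i \frac{\partial}{\partial x_i} - x_j \frac{\partial}{\partial x_j}$, $1 \le i,j \le m$. *)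

theory Defs
  imports
    "HOL-Analysis.Determinants"
    "HOL-Library.Poly_Mapping"
    "HOL-Library.Function_Algebras"
begin

section \<open>Polynomials\<close>

text \<open>
  Exponent vectors are \<open>'n \<Rightarrow>\<^sub>0 nat\<close>, so the variables \<open>x\<^sub>i\<close> are indexed by the finite type
  \<open>'n\<close> and their number is \<open>CARD('n)\<close>.
\<close>

type_synonym ('n, 'k) mpoly = "('n \<Rightarrow>\<^sub>0 nat) \<Rightarrow>\<^sub>0 'k"

definition mon_degree :: "('n::finite \<Rightarrow>\<^sub>0 nat) \<Rightarrow> nat" where
  "mon_degree t = (\<Sum>i\<in>UNIV. Poly_Mapping.lookup t i)"

definition hom_polys :: "nat \<Rightarrow> ('n::finite, 'k::field) mpoly set" where
  "hom_polys d = {p. \<forall>t\<in>Poly_Mapping.keys p. mon_degree t = d}"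

definition Var :: "'n \<Rightarrow> ('n, 'k::field) mpoly" where
  "Var i = Poly_Mapping.single (Poly_Mapping.single i 1) 1"

definition poly_scale :: "'k::field \<Rightarrow> ('n, 'k) mpoly \<Rightarrow> ('n, 'k) mpoly" where
  "poly_scale c p = Poly_Mapping.single 0 c * p"

text \<open>
  Exponent subtraction truncates, but whenever it does, the coefficient is zero.
\<close>

definition pdiff :: "'n \<Rightarrow> ('n, 'k::field) mpoly \<Rightarrow> ('n, 'k) mpoly" where
  "pdiff j p = (\<Sum>t\<in>Poly_Mapping.keys p.
     Poly_Mapping.single (t - Poly_Mapping.single j 1)
       (of_nat (Poly_Mapping.lookup t j) * Poly_Mapping.lookup p t))"

global_interpretation poly: vector_space "poly_scale :: 'k::field \<Rightarrow> ('n, 'k) mpoly \<Rightarrow> ('n, 'k) mpoly"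
proof
qed (simp_all add: poly_scale_def algebra_simps single_add mult_single flip: mult.assoc)

section \<open>Endomorphisms of a space of polynomials\<close>

definition endo_scale ::
  "'k::field \<Rightarrow> (('n, 'k) mpoly \<Rightarrow> ('n, 'k) mpoly) \<Rightarrow> ('n, 'k) mpoly \<Rightarrow> ('n, 'k) mpoly" where
  "endo_scale c f = (\<lambda>p. poly_scale c (f p))"

global_interpretation endo: vector_space
  "endo_scale :: 'k::field \<Rightarrow> (('n, 'k) mpoly \<Rightarrow> ('n, 'k) mpoly) \<Rightarrow> ('n, 'k) mpoly \<Rightarrow> ('n, 'k) mpoly"
  by standard
    (simp_all add: endo_scale_def fun_eq_iff poly.scale_right_distrib poly.scale_left_distrib)

text \<open>
  A linear map \<open>V \<rightarrow> V\<close> is represented by the unique function on all polynomials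
  that extends it by \<open>0\<close> outside \<open>V\<close>, so that equality and the pointwise vector space
  operations on \<open>End V\<close> are those of the function type.
\<close>

definition restr :: "('n, 'k) mpoly set \<Rightarrow> (('n, 'k::field) mpoly \<Rightarrow> ('n, 'k) mpoly)
    \<Rightarrow> ('n, 'k) mpoly \<Rightarrow> ('n, 'k) mpoly" where
  "restr V f = (\<lambda>p. if p \<in> V then f p else 0)"

definition End :: "('n, 'k::field) mpoly set \<Rightarrow> (('n, 'k) mpoly \<Rightarrow> ('n, 'k) mpoly) set" where
  "End V = {f. (\<forall>p\<in>V. f p \<in> V)
      \<and> (\<forall>p\<in>V. \<forall>q\<in>V. f (p + q) = f p + f q)
      \<and> (\<forall>c. \<forall>p\<in>V. f (poly_scale c p) = poly_scale c (f p))
      \<and> (\<forall>p. p \<notin> V \<longrightarrow> f p = 0)}"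

definition invertible_on ::
  "('n, 'k::field) mpoly set \<Rightarrow> (('n, 'k) mpoly \<Rightarrow> ('n, 'k) mpoly) \<Rightarrow> bool" where
  "invertible_on V f \<longleftrightarrow> (\<exists>g\<in>End V. \<forall>p\<in>V. g (f p) = p \<and> f (g p) = p)"

definition singular_subspace ::
  "('n, 'k::field) mpoly set \<Rightarrow> (('n, 'k) mpoly \<Rightarrow> ('n, 'k) mpoly) set \<Rightarrow> bool" where
  "singular_subspace V \<A> \<longleftrightarrow>
     endo.subspace \<A> \<and> \<A> \<subseteq> End V \<and> (\<forall>f\<in>\<A>. \<not> invertible_on V f)"

definition maximal_singular_subspace ::
  "('n, 'k::field) mpoly set \<Rightarrow> (('n, 'k) mpoly \<Rightarrow> ('n, 'k) mpoly) set \<Rightarrow> bool" where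
  "maximal_singular_subspace V \<A> \<longleftrightarrow>
     singular_subspace V \<A> \<and>
     (\<forall>\<B>. endo.subspace \<B> \<and> \<B> \<subseteq> End V \<and> \<A> \<subset> \<B> \<longrightarrow> \<not> singular_subspace V \<B>)"

section \<open>The natural representation of the special linear Lie algebra\<close>

definition sl :: "('k::field ^ 'n ^ 'n) set" where
  "sl = {A. trace A = 0}"

text \<open>
  \<open>GL\<close> acts on polynomial functions by \<open>(g p)(x) = p (g\<^sup>-\<^sup>1 x)\<close>. Differentiating at the identity,
  a matrix \<open>A\<close> acts by \<open>(A p)(x) = - (\<Sum>i. (A x)\<^sub>i (\<partial>p/\<partial>x\<^sub>i)(x))\<close>.
\<close>

definition nat_rep :: "nat \<Rightarrow> 'k::field ^ 'n ^ 'n \<Rightarrow> ('n::finite, 'k) mpoly \<Rightarrow> ('n, 'k) mpoly" where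
  "nat_rep d A = restr (hom_polys d)
     (\<lambda>p. - (\<Sum>i\<in>UNIV. (\<Sum>j\<in>UNIV. poly_scale (A $ i $ j) (Var j)) * pdiff i p))"

lemma lookup_pdiff:
  "Poly_Mapping.lookup (pdiff j p) t =
     of_nat (Poly_Mapping.lookup t j + 1) * Poly_Mapping.lookup p (t + Poly_Mapping.single j 1)"
proof -
  let ?s = "Poly_Mapping.single j (1::nat)"
  have "(Poly_Mapping.lookup (Poly_Mapping.single (u - ?s)
          (of_nat (Poly_Mapping.lookup u j) * Poly_Mapping.lookup p u)) t)
      = (if u = t + ?s then of_nat (Poly_Mapping.lookup t j + 1) * Poly_Mapping.lookup p u else 0)"
    for u
  proof (cases "Poly_Mapping.lookup u j = 0")
    case True
    then have "u \<noteq> t + ?s"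
      by (auto simp: lookup_add)
    with True show ?thesis by simp
  next
    case False
    have *: "u - ?s + ?s = u"
      using False by (intro poly_mapping_eqI) (auto simp: lookup_add lookup_minus lookup_single when_def)
    have "u - ?s = t \<longleftrightarrow> u = t + ?s"
      using * by (metis add_diff_cancel_right')
    then show ?thesis
      by (auto simp: lookup_single when_def lookup_add)
  qed
  then have "Poly_Mapping.lookup (pdiff j p) t
      = (\<Sum>u\<in>Poly_Mapping.keys p. if u = t + ?s
          then of_nat (Poly_Mapping.lookup t j + 1) * Poly_Mapping.lookup p u else 0)"
    by (simp add: pdiff_def lookup_sum)
  then show ?thesis
    by (simp add: sum.delta' in_keys_iff)
qed

lemma lookup_poly_scale: "Poly_Mapping.lookup (poly_scale c p) t = c * Poly_Mapping.lookup p t"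
  by (simp add: poly_scale_def map.rep_eq when_def flip: mult_map_scale_conv_mult)

lemma pdiff_add: "pdiff j (p + q) = pdiff j p + pdiff j q"
  by (rule poly_mapping_eqI) (simp only: lookup_pdiff lookup_add distrib_left)

lemma pdiff_scale: "pdiff j (poly_scale c p) = poly_scale c (pdiff j p)"
  by (rule poly_mapping_eqI) (simp add: lookup_pdiff lookup_poly_scale mult.left_commute)

lemma subspace_hom_polys: "poly.subspace (hom_polys d)"
  unfolding poly.subspace_def hom_polys_def
  by (auto simp: in_keys_iff lookup_add lookup_poly_scale)

lemma Var_pdiff_hom:
  fixes p :: "('n::finite, 'k::field) mpoly"
  assumes "p \<in> hom_polys d"
  shows "Var i * pdiff j p \<in> hom_polys d"
proof -
  have "mon_degree t = d" if t: "t \<in> Poly_Mapping.keys (Var i * pdiff j p)" for t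
  proof -
    obtain u where u: "t = Poly_Mapping.single i 1 + u" "u \<in> Poly_Mapping.keys (pdiff j p)"
      using subsetD[OF keys_mult t] by (auto simp: Var_def)
    then have "u + Poly_Mapping.single j 1 \<in> Poly_Mapping.keys p"
      by (auto simp: in_keys_iff lookup_pdiff)
    then have "mon_degree (u + Poly_Mapping.single j 1) = d"
      using assms by (auto simp: hom_polys_def)
    then show ?thesis
      by (simp add: u mon_degree_def lookup_add sum.distrib lookup_single when_def)
  qed
  then show ?thesis by (simp add: hom_polys_def)
qed

text \<open>The restrictions to homogeneous polynomials of the operators \<open>x\<^sub>i \<partial>/\<partial>x\<^sub>j\<close>.\<close>

definition xd :: "nat \<Rightarrow> 'n::finite \<Rightarrow> 'n \<Rightarrow> ('n, 'k::field) mpoly \<Rightarrow> ('n, 'k) mpoly" where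
  "xd d i j = restr (hom_polys d) (\<lambda>p. Var i * pdiff j p)"

lemma xd_in_End: "xd d i j \<in> End (hom_polys d :: ('n::finite, 'k::field) mpoly set)"
proof -
  have "Var i * pdiff j (poly_scale c p) = poly_scale c (Var i * pdiff j p)"
    for c and p :: "('n, 'k) mpoly"
    by (simp only: pdiff_scale) (simp add: poly_scale_def mult.left_commute)
  then show ?thesis
    by (simp add: End_def xd_def restr_def Var_pdiff_hom pdiff_add distrib_left
        poly.subspace_add[OF subspace_hom_polys] poly.subspace_scale[OF subspace_hom_polys])
qed

lemma sum_fun_app: "(\<Sum>i\<in>S. f i) p = (\<Sum>i\<in>S. f i p)"
  by (induction S rule: infinite_finite_induct) auto

lemma nat_rep_eq:
  fixes A :: "'k::field ^ 'n ^ 'n"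
  shows "nat_rep d A = (\<Sum>i\<in>UNIV. \<Sum>j\<in>UNIV. endo_scale (- A $ i $ j) (xd d j i))"
proof
  fix p :: "('n, 'k) mpoly"
  show "nat_rep d A p = (\<Sum>i\<in>UNIV. \<Sum>j\<in>UNIV. endo_scale (- A $ i $ j) (xd d j i)) p"
    by (simp add: sum_fun_app nat_rep_def restr_def endo_scale_def xd_def
        sum_distrib_right sum_negf poly_scale_def mult.assoc single_uminus)
qed

lemma subspace_End: "endo.subspace (End (hom_polys d))"
  by (auto simp: endo.subspace_def End_def endo_scale_def poly.scale_right_distrib
      poly.scale_left_commute poly.subspace_0[OF subspace_hom_polys]
      poly.subspace_add[OF subspace_hom_polys] poly.subspace_scale[OF subspace_hom_polys])

lemma nat_rep_in_End: "nat_rep d A \<in> End (hom_polys d)"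
  unfolding nat_rep_eq
  by (intro endo.subspace_sum endo.subspace_scale subspace_End xd_in_End)

lemma subspace_nat_rep_image:
  "endo.subspace (nat_rep d ` (sl :: ('k::field ^ 'n ^ 'n) set))"
proof -
  have 0: "nat_rep d (0 :: 'k ^ 'n ^ 'n) = 0"
    by (simp add: nat_rep_eq)
  have add: "nat_rep d A + nat_rep d B = nat_rep d (A + B)" for A B :: "'k ^ 'n ^ 'n"
    by (simp only: nat_rep_eq sum.distrib[symmetric] vector_add_component minus_add_distrib
        endo.scale_left_distrib)
  have scale: "endo_scale c (nat_rep d A) = nat_rep d (\<chi> i j. c * A $ i $ j)"
    for c and A :: "'k ^ 'n ^ 'n"
    by (simp only: nat_rep_eq endo.scale_sum_right endo.scale_scale vec_lambda_beta
        mult_minus_right)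
  show ?thesis
    unfolding endo.subspace_def
  proof (intro conjI ballI allI)
    show "0 \<in> nat_rep d ` (sl :: ('k ^ 'n ^ 'n) set)"
      by (rule image_eqI[of _ _ 0]) (simp_all add: 0 sl_def trace_def)
  next
    fix f g assume "f \<in> nat_rep d ` (sl :: ('k ^ 'n ^ 'n) set)"
      and "g \<in> nat_rep d ` (sl :: ('k ^ 'n ^ 'n) set)"
    then show "f + g \<in> nat_rep d ` (sl :: ('k ^ 'n ^ 'n) set)"
      by (force simp: add sl_def trace_add)
  next
    fix c f assume "f \<in> nat_rep d ` (sl :: ('k ^ 'n ^ 'n) set)"
    then obtain A :: "'k ^ 'n ^ 'n" where A: "trace A = 0" "f = nat_rep d A"
      by (auto simp: sl_def)
    have "trace (\<chi> i j. c * A $ i $ j) = 0"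
      using A(1) by (simp add: trace_def flip: sum_distrib_left)
    then show "endo_scale c f \<in> nat_rep d ` (sl :: ('k ^ 'n ^ 'n) set)"
      by (simp add: A(2) scale sl_def)
  qed
qed

text \<open>The image of the representation, as a span of differential operators.\<close>

lemma nat_rep_image_eq_span:
  "nat_rep d ` (sl :: ('k::field ^ 'n ^ 'n) set) =
     endo.span ({xd d i j | i j. i \<noteq> j} \<union> {xd d i i - xd d j j | i j. True})"
  (is "?L = endo.span ?G")
proof
  show "?L \<subseteq> endo.span ?G"
  proof
    fix f assume "f \<in> ?L"
    then obtain A :: "'k ^ 'n ^ 'n" where A: "trace A = 0" "f = nat_rep d A"
      by (auto simp: sl_def)
    define k :: 'n where "k = undefined"
    have z: "(\<Sum>i\<in>UNIV. endo_scale (- A $ i $ i) (xd d k k)) = 0"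
      using A(1) by (simp add: trace_def sum_negf flip: endo.scale_sum_left)
    have "f = (\<Sum>i\<in>UNIV. \<Sum>j\<in>UNIV. endo_scale (- A $ i $ j) (xd d j i))
              - (\<Sum>i\<in>UNIV. endo_scale (- A $ i $ i) (xd d k k))"
      unfolding z A(2) nat_rep_eq by simp
    also have "\<dots> = (\<Sum>i\<in>UNIV. \<Sum>j\<in>UNIV.
        endo_scale (- A $ i $ j) (if i = j then xd d j i - xd d k k else xd d j i))"
    proof -
      have "(\<Sum>j\<in>UNIV. endo_scale (- A $ i $ j) (if i = j then xd d j i - xd d k k else xd d j i))
        = (\<Sum>j\<in>UNIV. endo_scale (- A $ i $ j) (xd d j i)
              - (if i = j then endo_scale (- A $ i $ i) (xd d k k) else 0))" for i
        by (rule sum.cong) (auto simp only: endo.scale_right_diff_distrib if_True if_False diff_zero split: if_splits)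
      then show ?thesis
        by (simp only: sum_subtractf sum.delta' finite UNIV_I if_True)
    qed
    also have "\<dots> \<in> endo.span ?G"
      by (intro endo.span_sum endo.span_scale endo.span_base) auto
    finally show "f \<in> endo.span ?G" .
  qed
next
  have 1: "xd d i j \<in> ?L" if "i \<noteq> j" for i j
  proof
    let ?A = "(\<chi> a b. if a = j \<and> b = i then - 1 else 0) :: 'k ^ 'n ^ 'n"
    show "?A \<in> sl"
      using that by (auto simp: sl_def trace_def intro!: sum.neutral)
    have "nat_rep d ?A = (\<Sum>a\<in>UNIV. \<Sum>b\<in>UNIV. if b = i then if a = j then xd d b a else 0 else 0)"
      unfolding nat_rep_eq by (intro sum.cong) auto
    then show "xd d i j = nat_rep d ?A"
      by simp
  qed
  have 2: "xd d i i - xd d j j \<in> ?L" for i j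
  proof
    let ?A = "(\<chi> a b. if a = b then (if a = j then 1 else 0) - (if a = i then 1 else 0) else 0) :: 'k ^ 'n ^ 'n"
    show "?A \<in> sl"
      by (simp add: sl_def trace_def sum_subtractf)
    have "nat_rep d ?A = (\<Sum>a\<in>UNIV. \<Sum>b\<in>UNIV. if a = b then
        (if a = i then xd d a a else 0) - (if a = j then xd d a a else 0) else 0)"
      unfolding nat_rep_eq by (intro sum.cong) auto
    then show "xd d i i - xd d j j = nat_rep d ?A"
      by (simp add: sum_subtractf)
  qed
  show "endo.span ?G \<subseteq> ?L"
    using 1 2 by (intro endo.span_minimal subspace_nat_rep_image) auto
qed

end

theory Submission
  imports Defs
    "HOL-Computational_Algebra.Formal_Power_Series"
    "HOL-Computational_Algebra.Polynomial"
begin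

text \<open>
  Singularity: for a traceless matrix \<open>A\<close> the derivation attached to \<open>A\<close> kills the determinant
  \<open>D\<close> of the Krylov matrix with columns \<open>x, A x, A\<^sup>2 x, \<dots>\<close>, hence also \<open>D ^ e\<close>, which lies in
  \<open>V\<close>. If \<open>A\<close> has no cyclic vector then \<open>D = 0\<close>, but then \<open>A\<close> is perturbed by a nilpotent shift.

  Maximality: let \<open>m0\<close> be the monomial with all exponents equal to \<open>e\<close>. A generic traceless
  diagonal \<open>H\<close> has kernel spanned by \<open>m0\<close>, so if all operators \<open>a + t X\<close> with \<open>a\<close> in the image of
  \<open>sl\<close> are singular, then the coefficient of \<open>m0\<close> in \<open>X m0\<close> vanishes. The same holds for all
  conjugates of \<open>X\<close> under exponentials of the \<open>x\<^sub>i \<partial>/\<partial>x\<^sub>j\<close>, so the set of such \<open>X\<close> lies in a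
  module \<open>W\<close> for the Lie algebra on which this coefficient is zero. If \<open>W\<close> is larger than the
  image of \<open>sl\<close>, it contains a nonzero operator orthogonal to that image for the trace form, and
  these operators form a submodule. A nonzero element of this submodule that is extremal for
  the grading by \<open>x\<^sub>k\<close> is a multiple of a product of operators \<open>x\<^sub>k \<partial>/\<partial>x\<^sub>j\<close>, \<open>j \<noteq> k\<close>, and the
  submodule contains all such products of the same length \<open>n\<close>. Length \<open>0\<close> is excluded by the
  coefficient, \<open>n = 1\<close> by orthogonality. For \<open>n \<ge> 2\<close> one lowers a suitable product to weight zero;
  its coefficient at \<open>m0\<close> is a nonzero multiple of a terminating sum that is nonzero by a
  special case of Dixon's identity (for \<open>n < 2 e\<close>), or a single nonzero term (for \<open>n \<ge> 2 e\<close>).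
  Odd \<open>n\<close> needs a third variable.
\<close>

section \<open>Alternating sums of products of binomial coefficients\<close>

text \<open>The flow of the linear field multiplies the Krylov matrix on the left by exp(tA), so its
  determinant changes by exp(t tr A) only. The degree em serves both halves: it puts a power of that
  determinant into V and provides a monomial of weight zero, whose coefficient in X m0 is, up to a
  nonzero factor, the linear term of det(H + tX). Singularity jointly with sl is not linear in X, so
  by itself it does not give a module; its linear consequence, required for all conjugates, does.
  Orthogonality for the trace form stands in for complete reducibility, and commuting with all
  \<open>E k j\<close> stands in for being a highest weight vector, so End V is never decomposed.
  The third variable answers a symmetry: lowering an odd power of one raising operator within two
  variables gives a sum whose terms i and n - i cancel. A product of an even power with one factor
  in a third variable has the required length, and undoing that factor weights term i by en + i,
  which destroys no symmetry but leaves a nonzero multiple of the even sum.\<close>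

lemma alternating_binomial_shift:
  assumes "n \<le> N" "n \<le> k"
  shows "(\<Sum>l\<le>n. (-1) ^ l * int (n choose l) * int ((N - l) choose k)) = int ((N - n) choose (k - n))"
  using assms
proof (induction n arbitrary: k N)
  case 0 then show ?case by simp
next
  case (Suc n)
  obtain k' where k: "k = Suc k'" using Suc.prems by (cases k) auto
  obtain N' where N: "N = Suc N'" using Suc.prems by (cases N) auto
  \<comment> \<open>Pascal's rule splits C(n+1, l). After a shift of l the two halves combine to the
    backward difference C(N-l, k) - C(N-1-l, k) = C(N-1-l, k-1), so one step lowers N and k
    together.\<close>
  have "(\<Sum>l\<le>Suc n. (-1) ^ l * int (Suc n choose l) * int ((N - l) choose k)) =
      (\<Sum>l\<le>Suc n. (-1) ^ l * int (n choose l) * int ((N - l) choose k)) +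
      (\<Sum>l\<le>Suc n. (-1) ^ l * int (if l = 0 then 0 else n choose (l - 1)) * int ((N - l) choose k))"
    unfolding sum.distrib[symmetric]
  proof (rule sum.cong[OF refl])
    fix l show "(-1) ^ l * int (Suc n choose l) * int ((N - l) choose k) =
       (-1) ^ l * int (n choose l) * int ((N - l) choose k) +
       (-1) ^ l * int (if l = 0 then 0 else n choose (l - 1)) * int ((N - l) choose k)"
      by (cases l) (simp_all add: algebra_simps)
  qed
  also have "(\<Sum>l\<le>Suc n. (-1) ^ l * int (n choose l) * int ((N - l) choose k)) =
      (\<Sum>l\<le>n. (-1) ^ l * int (n choose l) * int ((N - l) choose k))"
    by simp
  also have "(\<Sum>l\<le>Suc n. (-1) ^ l * int (if l = 0 then 0 else n choose (l - 1)) * int ((N - l) choose k)) =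
      - (\<Sum>l\<le>n. (-1) ^ l * int (n choose l) * int ((N' - l) choose k))"
    by (subst sum.atMost_Suc_shift) (simp add: N sum_negf)
  also have "(\<Sum>l\<le>n. (-1) ^ l * int (n choose l) * int ((N - l) choose k)) + \<dots> =
      (\<Sum>l\<le>n. (-1) ^ l * int (n choose l) * int ((N' - l) choose k'))"
    unfolding sum_negf[symmetric] sum.distrib[symmetric]
  proof (rule sum.cong[OF refl])
    fix l assume "l \<in> {..n}"
    then have "N - l = Suc (N' - l)" using Suc.prems N by auto
    then show "(-1) ^ l * int (n choose l) * int ((N - l) choose k) + - ((-1) ^ l * int (n choose l) * int ((N' - l) choose k))
      = (-1) ^ l * int (n choose l) * int ((N' - l) choose k')"
      by (simp add: k algebra_simps)
  qed
  also have "\<dots> = int ((N' - n) choose (k' - n))"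
    using Suc.prems k N by (intro Suc.IH) auto
  finally show ?case by (simp add: k N)
qed

text \<open>For \<open>k = 2 * j\<close> this is the alternating sum in Dixon's identity with
  parameters j, j, e - j. For odd k it vanishes by the symmetry i -> k - i.\<close>

definition dixon :: "nat \<Rightarrow> nat \<Rightarrow> int" where
  "dixon e k = (\<Sum>i\<le>k. (-1) ^ i * int (k choose i) * int (e choose i) * int (e choose (k - i)))"

text \<open>The left side is the shape in which central coefficients of iterated commutators appear.
  Vandermonde expands \<open>(e + i) choose k\<close>; trinomial revision turns the inner sum over i
  into a (k - j)-fold difference, evaluated by \<open>alternating_binomial_shift\<close>.\<close>

lemma alternating_sum_eq_dixon:
  "(\<Sum>i\<le>k. (-1) ^ i * int (k choose i) * int ((e + k - i) choose k) * int ((e + i) choose k)) = dixon e k"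
proof -
  have "(\<Sum>i\<le>k. (-1) ^ i * int (k choose i) * int ((e + k - i) choose k) * int ((e + i) choose k)) =
      (\<Sum>i\<le>k. \<Sum>j\<le>k. (-1) ^ i * int (k choose i) * int ((e + k - i) choose k) * (int (i choose j) * int (e choose (k - j))))"
  proof (rule sum.cong[OF refl])
    fix i
    have "(e + i) choose k = (\<Sum>j\<le>k. (i choose j) * (e choose (k - j)))"
      by (subst add.commute) (rule vandermonde[symmetric])
    then show "(-1) ^ i * int (k choose i) * int ((e + k - i) choose k) * int ((e + i) choose k) =
       (\<Sum>j\<le>k. (-1) ^ i * int (k choose i) * int ((e + k - i) choose k) * (int (i choose j) * int (e choose (k - j))))"
      by (simp add: sum_distrib_left)
  qed
  also have "\<dots> = (\<Sum>j\<le>k. int (e choose (k - j)) *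
      (\<Sum>i\<le>k. (-1) ^ i * int (k choose i) * int (i choose j) * int ((e + k - i) choose k)))"
    by (subst sum.swap) (simp add: sum_distrib_left mult_ac)
  also have "\<dots> = (\<Sum>j\<le>k. int (e choose (k - j)) * ((-1) ^ j * int (k choose j) * int (e choose j)))"
  proof (rule sum.cong[OF refl])
    fix j assume "j \<in> {..k}"
    then have j: "j \<le> k" by simp
    have "(\<Sum>i\<le>k. (-1) ^ i * int (k choose i) * int (i choose j) * int ((e + k - i) choose k)) =
        (\<Sum>i\<in>{j..k}. (-1) ^ i * int (k choose i) * int (i choose j) * int ((e + k - i) choose k))"
      by (rule sum.mono_neutral_right) auto
    also have "\<dots> = (\<Sum>l\<le>k - j. (-1) ^ (l + j) * int (k choose (l + j)) * int ((l + j) choose j) * int ((e + k - (l + j)) choose k))"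
      by (rule sum.reindex_bij_witness[of _ "\<lambda>l. l + j" "\<lambda>i. i - j"]) (use j in auto)
    also have "\<dots> = (-1) ^ j * int (k choose j) *
        (\<Sum>l\<le>k - j. (-1) ^ l * int ((k - j) choose l) * int ((e + k - j - l) choose k))"
      unfolding sum_distrib_left
    proof (rule sum.cong[OF refl])
      fix l assume "l \<in> {..k - j}"
      then have "(k choose (l + j)) * ((l + j) choose j) = (k choose j) * ((k - j) choose l)"
        using choose_mult[of j "l + j" k] j by simp
      then have "int (k choose (l + j)) * int ((l + j) choose j) = int (k choose j) * int ((k - j) choose l)"
        by (metis of_nat_mult)
      moreover have "e + k - (l + j) = e + k - j - l" by simp
      ultimately show "(-1) ^ (l + j) * int (k choose (l + j)) * int ((l + j) choose j) * int ((e + k - (l + j)) choose k) =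
        (-1) ^ j * int (k choose j) * ((-1) ^ l * int ((k - j) choose l) * int ((e + k - j - l) choose k))"
        by (simp add: power_add mult_ac)
    qed
    also have "(\<Sum>l\<le>k - j. (-1) ^ l * int ((k - j) choose l) * int ((e + k - j - l) choose k)) =
        int ((e + k - j - (k - j)) choose (k - (k - j)))"
      using j by (intro alternating_binomial_shift) auto
    also have "\<dots> = int (e choose j)"
      using j by simp
    finally show "int (e choose (k - j)) *
      (\<Sum>i\<le>k. (-1) ^ i * int (k choose i) * int (i choose j) * int ((e + k - i) choose k)) =
      int (e choose (k - j)) * ((-1) ^ j * int (k choose j) * int (e choose j))"
      by simp
  qed
  finally show ?thesis
    by (simp add: dixon_def mult_ac)
qed

notation fps_nth (infixl "$$" 75)

text \<open>
  The exponential generating functions \<open>F(z) = L(-z)\<close>, \<open>G(z) = L(z)\<close> of the two binomial factors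
  are Laguerre polynomials; their second-order equations give a two-term recurrence for the
  even coefficients of \<open>F G\<close>.
\<close>

lemma dixon_nonzero:
  assumes "j \<le> e"
  shows "dixon e (2 * j) \<noteq> 0"
proof -
  define f :: "nat \<Rightarrow> rat" where "f n = of_nat (e choose n) / fact n" for n
  define F where "F = Abs_fps f"
  define G where "G = Abs_fps (\<lambda>n. (-1) ^ n * f n)"
  let ?D = fps_deriv and ?X = "fps_X :: rat fps"
  define c where "c = (fps_const (of_nat e) :: rat fps)"
  have rec: "of_nat (Suc n) * of_nat (Suc n) * f (Suc n) = (of_nat e - of_nat n) * f n" for n
  proof -
    have "Suc n * (e choose Suc n) = (e - n) * (e choose n)"
      by (simp only: binomial_absorption binomial_absorb_comp)
    then have "of_nat (Suc n) * of_nat (e choose Suc n) = (of_nat (e - n) * of_nat (e choose n) :: rat)"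
      by (metis of_nat_mult)
    also have "\<dots> = (of_nat e - of_nat n) * of_nat (e choose n)"
      by (cases "n \<le> e") (simp_all add: of_nat_diff)
    finally have "of_nat (Suc n) * of_nat (e choose Suc n) = (of_nat e - of_nat n) * (of_nat (e choose n) :: rat)" .
    then show ?thesis by (simp add: f_def field_simps del: of_nat_Suc)
  qed
  have F: "?X * ?D (?D F) + (1 + ?X) * ?D F = c * F"
  proof (rule fps_ext)
    fix n show "(?X * ?D (?D F) + (1 + ?X) * ?D F) $$ n = (c * F) $$ n"
      using rec[of n] by (cases n) (simp_all add: F_def c_def algebra_simps)
  qed
  have G: "?X * ?D (?D G) + (1 - ?X) * ?D G = - c * G"
  proof (rule fps_ext)
    fix n show "(?X * ?D (?D G) + (1 - ?X) * ?D G) $$ n = (- c * G) $$ n"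
      using arg_cong[OF rec[of n], of "\<lambda>x. (-1) ^ n * x"]
      by (cases n) (simp_all add: G_def c_def algebra_simps)
  qed
  \<comment> \<open>The two equations close the products of F, F' with G, G' under differentiation,
    up to a factor z. The Wronskian \<open>W\<close> and the product \<open>Q\<close> of the
    derivatives are the auxiliary unknowns to be eliminated.\<close>
  define H where "H = F * G"
  define W where "W = ?D F * G - F * ?D G"
  define Q where "Q = ?D F * ?D G"
  have H': "?D H = ?D F * G + F * ?D G" by (simp add: H_def)
  have F': "?X * ?D (?D F) = c * F - (1 + ?X) * ?D F" using F by (simp add: algebra_simps)
  have G': "?X * ?D (?D G) = - c * G - (1 - ?X) * ?D G" using G by (simp add: algebra_simps)
  have W': "?D (?X * W) = 2 * c * H - ?X * ?D H"
  proof -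
    have "?D (?X * W) = W + (?X * ?D (?D F)) * G - F * (?X * ?D (?D G))"
      by (simp add: W_def algebra_simps)
    then show ?thesis unfolding F' G' H' by (simp add: W_def H_def algebra_simps)
  qed
  have H'': "?X * ?D (?D H) = 2 * ?X * Q - ?D H - ?X * W"
  proof -
    have "?X * ?D (?D H) = (?X * ?D (?D F)) * G + 2 * ?X * Q + F * (?X * ?D (?D G))"
      by (simp add: H_def Q_def algebra_simps)
    then show ?thesis unfolding F' G' H' by (simp add: W_def Q_def algebra_simps)
  qed
  have Q': "?X * ?D Q = - c * W - 2 * Q"
  proof -
    have "?X * ?D Q = (?X * ?D (?D F)) * ?D G + ?D F * (?X * ?D (?D G))"
      by (simp add: Q_def algebra_simps)
    then show ?thesis unfolding F' G' by (simp add: W_def Q_def algebra_simps)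
  qed
  \<comment> \<open>The power of z is chosen so that differentiating produces 2 Q + z Q', which the
    equation for Q' replaces by a multiple of W. Thus Q disappears.\<close>
  have "?X * (2 * ?X * Q) = ?X * (?X * ?D (?D H) + ?D H + ?X * W)"
    by (simp add: H'')
  then have "?D (?X * (2 * ?X * Q)) = ?D (?X * (?X * ?D (?D H) + ?D H + ?X * W))"
    by simp
  moreover have "?D (?X * (2 * ?X * Q)) = - 2 * c * (?X * W)"
  proof -
    have "?D (?X * (2 * ?X * Q)) = 2 * ?X * (2 * Q + ?X * ?D Q)"
      by (simp add: algebra_simps)
    then show ?thesis unfolding Q' by (simp add: algebra_simps)
  qed
  moreover have "?D (?X * (?X * ?D (?D H) + ?D H + ?X * W)) =
      ?D (?X * (?X * ?D (?D H) + ?D H)) + ?X * W + ?X * ?D (?X * W)"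
    by (simp add: algebra_simps)
  ultimately have key: "- 2 * c * (?X * W) =
      ?D (?X * (?X * ?D (?D H) + ?D H)) + ?X * W + ?X * (2 * c * H - ?X * ?D H)"
    unfolding W' by simp
  have w: "of_nat (Suc n) * W $$ n = (2 * of_nat e - of_nat n) * H $$ n" for n
    using arg_cong[OF W', of "\<lambda>f. f $$ n"]
    by (cases n) (simp_all add: c_def mult.assoc numeral_fps_const algebra_simps)
  have k: "- 2 * of_nat e * W $$ n = of_nat (n + 2) ^ 3 * H $$ (n + 2) + W $$ n + (2 * of_nat e - of_nat n) * H $$ n" for n
    using arg_cong[OF key, of "\<lambda>f. f $$ Suc n"]
    by (cases n) (simp_all add: c_def mult.assoc numeral_fps_const algebra_simps power3_eq_cube)
  \<comment> \<open>The factor 2e - n vanishes at n = 2e only, so coefficients at even indices up to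
    2e are nonzero. This is where \<open>j \<le> e\<close> enters.\<close>
  have rec2: "of_nat (Suc n) * of_nat (n + 2) ^ 3 * H $$ (n + 2) =
      - (2 * of_nat e - of_nat n) * (of_nat n + 2 + 2 * of_nat e) * H $$ n" for n
  proof -
    have "of_nat (Suc n) * (of_nat (n + 2) ^ 3 * H $$ (n + 2)) =
      - (2 * of_nat e + 1) * (of_nat (Suc n) * W $$ n) - of_nat (Suc n) * ((2 * of_nat e - of_nat n) * H $$ n)"
      using k[of n] by (simp add: algebra_simps)
    then show ?thesis unfolding w by (simp add: algebra_simps)
  qed
  have nz: "H $$ (2 * j) \<noteq> 0"
    using assms
  proof (induction j)
    case 0 then show ?case by (simp add: H_def F_def G_def f_def)
  next
    case (Suc j)
    have "(2 * of_nat e - of_nat (2 * j) :: rat) = of_nat (2 * (e - j))"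
      using Suc.prems by (simp add: of_nat_diff)
    moreover have "of_nat (2 * j) + 2 + 2 * of_nat e = (of_nat (2 * j + 2 + 2 * e) :: rat)" by simp
    ultimately have "- (2 * of_nat e - of_nat (2 * j)) * (of_nat (2 * j) + 2 + 2 * of_nat e) * H $$ (2 * j) \<noteq> 0"
      using Suc by (simp del: of_nat_add of_nat_mult)
    then show ?case using rec2[of "2 * j"] by auto
  qed
  have "H $$ (2 * j) * fact (2 * j) = of_int (dixon e (2 * j))"
  proof -
    have "H $$ (2 * j) * fact (2 * j) = (\<Sum>i\<le>2 * j. F $$ i * G $$ (2 * j - i) * fact (2 * j))"
      by (simp add: H_def fps_mult_nth sum_distrib_right atLeast0AtMost)
    also have "\<dots> = (\<Sum>i\<le>2 * j. of_int ((-1) ^ i * int (2 * j choose i) * int (e choose i) * int (e choose (2 * j - i))))"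
    proof (rule sum.cong[OF refl])
      fix i assume "i \<in> {..2 * j}"
      then have i: "i \<le> 2 * j" by simp
      then have "(-1) ^ (2 * j - i) = ((-1) ^ i :: rat)"
        by (auto simp: minus_one_power_iff)
      moreover have "(of_nat (2 * j choose i) :: rat) = fact (2 * j) / (fact i * fact (2 * j - i))"
        using i by (rule binomial_fact)
      ultimately show "F $$ i * G $$ (2 * j - i) * fact (2 * j) =
          of_int ((-1) ^ i * int (2 * j choose i) * int (e choose i) * int (e choose (2 * j - i)))"
        by (simp add: F_def G_def f_def)
    qed
    finally show ?thesis by (simp add: dixon_def)
  qed
  with nz show ?thesis by auto
qed

no_notation fps_nth (infixl "$$" 75)

section \<open>The ring of linear operators on polynomials\<close>

text \<open>Keeps \<open>Poly_Mapping.single i 1\<close> from being rewritten.\<close>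

declare One_nat_def [simp del]

abbreviation mon :: "('n \<Rightarrow>\<^sub>0 nat) \<Rightarrow> ('n, 'k::field) mpoly" where
  "mon t \<equiv> Poly_Mapping.single t 1"

abbreviation unit_exp :: "'n \<Rightarrow> ('n \<Rightarrow>\<^sub>0 nat)" where
  "unit_exp i \<equiv> Poly_Mapping.single i 1"

text \<open>The type consists of linear maps on all polynomials, so that it is a ring independent of
  the degree and each x_i d/dx_j is one element acting in all degrees. V is cut out afterwards by a
  projection.\<close>

typedef (overloaded) ('n, 'k::field) lin_op =
  "{f :: ('n, 'k) mpoly \<Rightarrow> ('n, 'k) mpoly.
     (\<forall>p q. f (p + q) = f p + f q) \<and> (\<forall>c p. f (poly_scale c p) = poly_scale c (f p))}"
  morphisms app Lop
  by (rule exI[of _ "\<lambda>p. p"]) simp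

setup_lifting type_definition_lin_op

lemma app_add: "app X (p + q) = app X p + app X q"
  and app_scale: "app X (poly_scale c p) = poly_scale c (app X p)"
  using app[of X] by auto

lemma app_zero [simp]: "app X 0 = 0"
  using app_add[of X 0 0] by simp

lemma app_uminus: "app X (- p) = - app X p"
  using app_add[of X p "- p"] by (simp add: eq_neg_iff_add_eq_0 add.commute)

lemma app_diff: "app X (p - q) = app X p - app X q"
  using app_add[of X p "- q"] by (simp add: app_uminus)

lemma app_sum: "app X (\<Sum>i\<in>S. f i) = (\<Sum>i\<in>S. app X (f i))"
  by (induction S rule: infinite_finite_induct) (auto simp: app_add)

instantiation lin_op :: (type, field) ring_1
begin

lift_definition zero_lin_op :: "('a, 'b) lin_op" is "\<lambda>p. 0" by simp
lift_definition one_lin_op :: "('a, 'b) lin_op" is "\<lambda>p. p" by simp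
lift_definition plus_lin_op :: "('a, 'b) lin_op \<Rightarrow> ('a, 'b) lin_op \<Rightarrow> ('a, 'b) lin_op"
  is "\<lambda>f g p. f p + g p" by (simp add: poly.scale_right_distrib)
lift_definition minus_lin_op :: "('a, 'b) lin_op \<Rightarrow> ('a, 'b) lin_op \<Rightarrow> ('a, 'b) lin_op"
  is "\<lambda>f g p. f p - g p" by (simp add: poly.scale_right_diff_distrib)
lift_definition uminus_lin_op :: "('a, 'b) lin_op \<Rightarrow> ('a, 'b) lin_op"
  is "\<lambda>f p. - f p" by simp
lift_definition times_lin_op :: "('a, 'b) lin_op \<Rightarrow> ('a, 'b) lin_op \<Rightarrow> ('a, 'b) lin_op"
  is "\<lambda>f g p. f (g p)" by simp

instance
proof
  fix a b c :: "('a, 'b) lin_op"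
  show "a * b * c = a * (b * c)" by transfer simp
  show "1 * a = a" "a * 1 = a" by (transfer; simp)+
  show "a + b + c = a + (b + c)" by transfer (simp add: add.assoc)
  show "a + b = b + a" by transfer (simp add: add.commute)
  show "0 + a = a" "- a + a = 0" by (transfer; simp)+
  show "a - b = a + - b" by transfer simp
  show "(a + b) * c = a * c + b * c" by transfer simp
  show "a * (b + c) = a * b + a * c" by transfer simp
  show "(0 :: ('a, 'b) lin_op) \<noteq> 1"
  proof
    assume "(0 :: ('a, 'b) lin_op) = 1"
    then have "(\<lambda>p :: ('a, 'b) mpoly. 0) = (\<lambda>p. p)" by transfer
    then have "(0 :: ('a, 'b) mpoly) = 1" by (rule fun_cong)
    then show False by simp
  qed
qed

end

lemma app_lin_op_simps [simp]:
  "app 0 p = 0" "app 1 p = p" "app (X + Y) p = app X p + app Y p"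
  "app (X - Y) p = app X p - app Y p" "app (- X) p = - app X p"
  "app (X * Y) p = app X (app Y p)"
  by (transfer; simp)+

lemma app_lin_op_sum: "app (\<Sum>i\<in>S. f i) p = (\<Sum>i\<in>S. app (f i) p)"
  by (induction S rule: infinite_finite_induct) auto

lemma poly_expand: "p = (\<Sum>t\<in>Poly_Mapping.keys p. poly_scale (Poly_Mapping.lookup p t) (mon t))"
  by (rule poly_mapping_eqI)
    (simp add: lookup_sum lookup_poly_scale lookup_single when_def in_keys_iff
       if_distrib[of "(*) _"] cong: if_cong)

lemma lin_op_eqI:
  assumes "\<And>t. app X (mon t) = app Y (mon t)"
  shows "X = Y"
proof -
  have "app X p = app Y p" for p
    by (subst (1 2) poly_expand) (simp only: app_sum app_scale assms)
  then show ?thesis by (simp add: app_inject[symmetric] fun_eq_iff)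
qed

text \<open>Scalars become central ring elements, so that scaling an operator is a multiplication in
  the ring.\<close>

lift_definition scal :: "'k::field \<Rightarrow> ('n, 'k) lin_op" is "poly_scale"
  by (simp add: poly.scale_right_distrib poly.scale_left_commute)

lemma app_scal [simp]: "app (scal c) p = poly_scale c p"
  by transfer simp

lemma scal_simps [simp]: "scal 0 = 0" "scal 1 = 1"
  and scal_add: "scal (a + b) = scal a + scal b"
  and scal_diff: "scal (a - b) = scal a - scal b"
  and scal_uminus: "scal (- a) = - scal a"
  and scal_mult: "scal (a * b) = scal a * scal b"
  by (rule lin_op_eqI; simp add: poly.scale_left_distrib poly.scale_left_diff_distrib)+

lemma scal_commute: "X * scal c = scal c * X"
  by (rule lin_op_eqI) (simp add: app_scale)

lemma scal_left_commute: "X * (scal c * Y) = scal c * (X * Y)"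
  by (metis scal_commute mult.assoc)

lift_definition E :: "'n \<Rightarrow> 'n \<Rightarrow> ('n, 'k::field) lin_op" is "\<lambda>i j p. Var i * pdiff j p"
  by (simp add: pdiff_add pdiff_scale distrib_left) (simp add: poly_scale_def mult.left_commute)

lemma app_E: "app (E i j) p = Var i * pdiff j p"
  by transfer simp

lemma pdiff_mon: "pdiff j (mon t) = Poly_Mapping.single (t - unit_exp j) (of_nat (Poly_Mapping.lookup t j))"
  by (simp add: pdiff_def)

lemma poly_scale_mon: "poly_scale c (mon t) = Poly_Mapping.single t c"
  by (simp add: poly_scale_def mult_single)

lemma E_mon: "app (E i j) (mon t) =
    poly_scale (of_nat (Poly_Mapping.lookup t j)) (mon (t - unit_exp j + unit_exp i))"
  by (simp add: app_E pdiff_mon Var_def mult_single poly_scale_mon add.commute)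

text \<open>Writing the exponent as \<open>t + unit_exp j\<close> avoids truncated subtraction; with
  \<open>exp_cases\<close> and \<open>E_mon_zero\<close> this covers every exponent.\<close>

lemma E_mon_add: "app (E i j) (mon (t + unit_exp j)) =
    poly_scale (of_nat (Poly_Mapping.lookup t j + 1)) (mon (t + unit_exp i))"
  by (simp add: E_mon lookup_add)

lemma E_mon_zero: "Poly_Mapping.lookup t j = 0 \<Longrightarrow> app (E i j) (mon t) = 0"
  by (simp add: E_mon)

lemma minus_unit_add:
  "Poly_Mapping.lookup t j \<noteq> 0 \<Longrightarrow> t - unit_exp j + unit_exp j = (t :: 'n \<Rightarrow>\<^sub>0 nat)"
  by (intro poly_mapping_eqI) (auto simp: lookup_add lookup_minus lookup_single when_def)

lemma exp_cases:
  obtains "Poly_Mapping.lookup t j = 0" | u :: "'n \<Rightarrow>\<^sub>0 nat" where "t = u + unit_exp j"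
  by (metis minus_unit_add)

lemma mon_degree_add: "mon_degree (s + t) = mon_degree s + mon_degree t"
  by (simp add: mon_degree_def lookup_add sum.distrib)

lemma mon_degree_single [simp]: "mon_degree (Poly_Mapping.single i k) = k"
  by (simp add: mon_degree_def lookup_single when_def)

lemma lookup_Var_mult:
  "Poly_Mapping.lookup (Var i * p) t =
     (if Poly_Mapping.lookup t i = 0 then 0 else Poly_Mapping.lookup p (t - unit_exp i))"
proof -
  have "Var i * p = (\<Sum>u\<in>Poly_Mapping.keys p. Poly_Mapping.single (unit_exp i + u) (Poly_Mapping.lookup p u))"
    by (subst poly_expand) (simp add: sum_distrib_left Var_def mult_single poly_scale_mon)
  then have "Poly_Mapping.lookup (Var i * p) t =
      (\<Sum>u\<in>Poly_Mapping.keys p. if unit_exp i + u = t then Poly_Mapping.lookup p u else 0)"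
    by (simp add: lookup_sum lookup_single when_def)
  also have "\<dots> = (\<Sum>u\<in>Poly_Mapping.keys p. if u = t - unit_exp i then
      if Poly_Mapping.lookup t i = 0 then 0 else Poly_Mapping.lookup p u else 0)"
  proof (rule sum.cong)
    fix u
    have "unit_exp i + u = t \<longleftrightarrow> u = t - unit_exp i \<and> Poly_Mapping.lookup t i \<noteq> 0"
      using minus_unit_add[of t i] by (auto simp: lookup_add add.commute)
    then show "(if unit_exp i + u = t then Poly_Mapping.lookup p u else 0) = (if u = t - unit_exp i then
      if Poly_Mapping.lookup t i = 0 then 0 else Poly_Mapping.lookup p u else 0)" by auto
  qed simp
  finally show ?thesis by (simp add: in_keys_iff)
qed

lemma pdiff_Var_mult:
  "pdiff a (Var b * p) = Var b * pdiff a p + (if a = b then p else 0)"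
proof (rule poly_mapping_eqI)
  fix t :: "'a \<Rightarrow>\<^sub>0 nat"
  show "Poly_Mapping.lookup (pdiff a (Var b * p)) t =
     Poly_Mapping.lookup (Var b * pdiff a p + (if a = b then p else 0)) t"
  proof (cases "Poly_Mapping.lookup t b = 0")
    case True
    then show ?thesis
      by (auto simp: lookup_pdiff lookup_add lookup_Var_mult lookup_single when_def)
  next
    case False
    then obtain u where "t = u + unit_exp b" by (metis exp_cases)
    have "u + unit_exp b + unit_exp a - unit_exp b = u + unit_exp a"
      by (metis add.assoc add.commute add_diff_cancel_right')
    with \<open>t = _\<close> show ?thesis
      by (cases "a = b") (simp_all add: lookup_pdiff lookup_add lookup_Var_mult lookup_single when_def distrib_right)
  qed
qed

lemma pdiff_commute: "pdiff a (pdiff b p) = pdiff b (pdiff a p)"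
  by (rule poly_mapping_eqI)
    (auto simp: lookup_pdiff lookup_add lookup_single when_def add_ac mult_ac)

text \<open>The relations of gl. The second-order part of a product of two such operators does not
  depend on their order, and the product rule leaves the first-order terms.\<close>

lemma E_commutator:
  "E i j * E k l - E k l * E i j =
     (if j = k then E i l else 0) - (if i = l then E k j else (0 :: ('n, 'k::field) lin_op))"
proof (rule lin_op_eqI)
  fix t :: "'n \<Rightarrow>\<^sub>0 nat"
  let ?p = "mon t :: ('n, 'k) mpoly"
  have *: "Var k * (Var i * pdiff l (pdiff j ?p)) = Var i * (Var k * pdiff j (pdiff l ?p))"
    by (metis pdiff_commute mult.left_commute)
  have 1: "app (E a b * E c d) ?p = Var a * (Var c * pdiff b (pdiff d ?p)) + (if b = c then app (E a d) ?p else 0)"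
    for a b c d
    by (simp only: app_E app_lin_op_simps pdiff_Var_mult distrib_left) simp
  show "app (E i j * E k l - E k l * E i j) ?p =
     app ((if j = k then E i l else 0) - (if i = l then E k j else 0) :: ('n, 'k) lin_op) ?p"
    unfolding app_lin_op_simps(4) 1 * by simp
qed

text \<open>Gaussian elimination: an equation with a nonzero coefficient at \<open>s0\<close> is
  solved for that unknown and substituted into the others. It serves as the dimension count for
  surjectivity, for the finiteness of singular parameters and for finding an orthogonal
  operator.\<close>

lemma underdetermined_system:
  fixes a :: "'f \<Rightarrow> 's \<Rightarrow> 'k::field"
  assumes "finite F" "finite S" "card F < card S"
  shows "\<exists>c. (\<exists>s\<in>S. c s \<noteq> 0) \<and> (\<forall>f\<in>F. (\<Sum>s\<in>S. c s * a f s) = 0)"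
  using assms
proof (induction F arbitrary: S a rule: finite_induct)
  case empty
  then obtain s where "s \<in> S" by fastforce
  then show ?case by (intro exI[of _ "\<lambda>_. 1"]) auto
next
  case (insert f F)
  show ?case
  proof (cases "\<forall>s\<in>S. a f s = 0")
    case True
    obtain c where "\<exists>s\<in>S. c s \<noteq> 0" "\<forall>g\<in>F. (\<Sum>s\<in>S. c s * a g s) = 0"
      using insert.IH[of S a] insert.prems insert.hyps by auto
    with True show ?thesis by (intro exI[of _ c]) auto
  next
    case False
    then obtain s0 where s0: "s0 \<in> S" "a f s0 \<noteq> 0" by blast
    let ?S = "S - {s0}"
    have "card F < card ?S"
      using insert.prems insert.hyps s0 by simp
    then obtain c where c: "\<exists>s\<in>?S. c s \<noteq> 0"
      "\<forall>g\<in>F. (\<Sum>s\<in>?S. c s * (a g s - a g s0 * a f s / a f s0)) = 0"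
      using insert.IH[of ?S "\<lambda>g s. a g s - a g s0 * a f s / a f s0"] insert.prems by auto
    define c' where "c' = c(s0 := - (\<Sum>s\<in>?S. c s * a f s) / a f s0)"
    have split: "(\<Sum>s\<in>S. c' s * a g s) = c' s0 * a g s0 + (\<Sum>s\<in>?S. c s * a g s)" for g
    proof -
      have "(\<Sum>s\<in>S. c' s * a g s) = c' s0 * a g s0 + (\<Sum>s\<in>?S. c' s * a g s)"
        using insert.prems s0 by (intro sum.remove) auto
      also have "(\<Sum>s\<in>?S. c' s * a g s) = (\<Sum>s\<in>?S. c s * a g s)"
        by (intro sum.cong) (auto simp: c'_def)
      finally show ?thesis .
    qed
    have "(\<Sum>s\<in>S. c' s * a g s) = 0" if "g \<in> F" for g
    proof -
      have "(\<Sum>s\<in>?S. c s * (a g s - a g s0 * a f s / a f s0)) =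
          (\<Sum>s\<in>?S. c s * a g s) - a g s0 / a f s0 * (\<Sum>s\<in>?S. c s * a f s)"
        by (simp add: right_diff_distrib sum_subtractf sum_distrib_left field_simps)
      with c(2) that have "(\<Sum>s\<in>?S. c s * a g s) = a g s0 / a f s0 * (\<Sum>s\<in>?S. c s * a f s)"
        by simp
      then show ?thesis
        unfolding split by (simp add: c'_def)
    qed
    moreover have "(\<Sum>s\<in>S. c' s * a f s) = 0"
      unfolding split using s0 by (simp add: c'_def)
    moreover have "\<exists>s\<in>S. c' s \<noteq> 0"
      using c(1) by (auto simp: c'_def)
    ultimately show ?thesis by blast
  qed
qed

global_interpretation lin_op: vector_space "\<lambda>c X. scal c * X :: ('n, 'k::field) lin_op"
  by standard (simp_all add: distrib_left distrib_right scal_add scal_mult mult.assoc)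

section \<open>Homogeneous components with their monomial bases\<close>

definition exps :: "nat \<Rightarrow> ('n::finite \<Rightarrow>\<^sub>0 nat) set" where
  "exps d = {t. mon_degree t = d}"

lemma finite_exps: "finite (exps d :: ('n::finite \<Rightarrow>\<^sub>0 nat) set)"
proof -
  have "Poly_Mapping.lookup ` (exps d :: ('n \<Rightarrow>\<^sub>0 nat) set) \<subseteq> PiE UNIV (\<lambda>_. {..d})"
  proof (rule image_subsetI)
    fix t :: "'n \<Rightarrow>\<^sub>0 nat"
    assume "t \<in> exps d"
    then have "Poly_Mapping.lookup t i \<le> d" for i
      using member_le_sum[of i UNIV "Poly_Mapping.lookup t"] by (simp add: exps_def mon_degree_def)
    then show "Poly_Mapping.lookup t \<in> PiE UNIV (\<lambda>_. {..d})"
      by (auto simp: PiE_def extensional_def)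
  qed
  then have "finite (Poly_Mapping.lookup ` (exps d :: ('n \<Rightarrow>\<^sub>0 nat) set))"
    by (rule finite_subset) (simp add: finite_PiE)
  then show ?thesis
    by (rule finite_imageD) (auto simp: inj_on_def poly_mapping_eqI)
qed

lemma lookup_mapp_degree:
  "Poly_Mapping.lookup (Poly_Mapping.mapp (\<lambda>t c. if mon_degree t = d then c else 0) p) t =
     (if mon_degree t = d then Poly_Mapping.lookup p t else 0)"
  by (simp add: lookup_mapp when_def in_keys_iff)

lift_definition proj :: "nat \<Rightarrow> ('n::finite, 'k::field) lin_op"
  is "\<lambda>d. Poly_Mapping.mapp (\<lambda>t c. if mon_degree t = d then c else 0)"
  by (auto intro!: poly_mapping_eqI simp: lookup_add lookup_poly_scale lookup_mapp_degree)

lemma app_proj: "app (proj d) p = Poly_Mapping.mapp (\<lambda>t c. if mon_degree t = d then c else 0) p"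
  by (simp add: proj.rep_eq)

lemma lookup_proj: "Poly_Mapping.lookup (app (proj d) p) t =
    (if mon_degree t = d then Poly_Mapping.lookup p t else 0)"
  by (simp add: app_proj lookup_mapp_degree)

lemma hom_polys_iff: "p \<in> hom_polys d \<longleftrightarrow> (\<forall>t. Poly_Mapping.lookup p t \<noteq> 0 \<longrightarrow> mon_degree t = d)"
  by (auto simp: hom_polys_def in_keys_iff)

lemma proj_in_hom: "app (proj d) p \<in> hom_polys d"
  by (auto simp: hom_polys_iff lookup_proj)

lemma proj_hom: "p \<in> hom_polys d \<Longrightarrow> app (proj d) p = p"
  by (intro poly_mapping_eqI) (auto simp: hom_polys_iff lookup_proj)

lemma proj_idem [simp]: "proj d * proj d = proj d"
  by (rule lin_op_eqI) (simp add: proj_hom proj_in_hom)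

lemma proj_idem_left [simp]: "proj d * (proj d * X) = proj d * X"
  by (simp flip: mult.assoc)

lemma proj_mon: "app (proj d) (mon t) = (if mon_degree t = d then mon t else 0)"
  by (rule poly_mapping_eqI) (auto simp: lookup_proj lookup_single when_def)

lemma mon_in_hom: "mon t \<in> hom_polys d \<longleftrightarrow> mon_degree t = d"
  by (auto simp: hom_polys_iff lookup_single when_def)

lemma proj_E: "proj d * E i j = E i j * proj d"
proof (rule lin_op_eqI)
  fix t
  show "app (proj d * E i j) (mon t) = app (E i j * proj d) (mon t)"
    by (rule exp_cases[of t j])
      (simp_all add: E_mon_zero proj_mon E_mon_add app_scale mon_degree_add)
qed

lemma hom_expand:
  assumes "p \<in> hom_polys d"
  shows "p = (\<Sum>t\<in>exps d. poly_scale (Poly_Mapping.lookup p t) (mon t))"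
proof (rule poly_mapping_eqI)
  fix u
  have "Poly_Mapping.lookup (\<Sum>t\<in>exps d. poly_scale (Poly_Mapping.lookup p t) (mon t)) u =
      (\<Sum>t\<in>exps d. if t = u then Poly_Mapping.lookup p t else 0)"
    by (simp add: lookup_sum lookup_poly_scale lookup_single when_def if_distrib[of "(*) _"] cong: if_cong)
  also have "\<dots> = Poly_Mapping.lookup p u"
    using assms by (auto simp: finite_exps sum.delta) (auto simp: exps_def hom_polys_iff)
  finally show "Poly_Mapping.lookup p u =
      Poly_Mapping.lookup (\<Sum>t\<in>exps d. poly_scale (Poly_Mapping.lookup p t) (mon t)) u" ..
qed

lemma lookup_hom_expand:
  "t \<in> exps d \<Longrightarrow> Poly_Mapping.lookup (\<Sum>t\<in>exps d. poly_scale (c t) (mon t)) t = c t"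
  by (simp add: lookup_sum lookup_poly_scale lookup_single when_def finite_exps
       if_distrib[of "(*) _"] cong: if_cong)

lemma hom_eqI:
  assumes "p \<in> hom_polys d" "q \<in> hom_polys d"
    and "\<And>t. t \<in> exps d \<Longrightarrow> Poly_Mapping.lookup p t = Poly_Mapping.lookup q t"
  shows "p = q"
proof (rule poly_mapping_eqI)
  fix t
  show "Poly_Mapping.lookup p t = Poly_Mapping.lookup q t"
  proof (cases "t \<in> exps d")
    case False
    then have "Poly_Mapping.lookup p t = 0" "Poly_Mapping.lookup q t = 0"
      using assms(1,2) unfolding hom_polys_iff exps_def by blast+
    then show ?thesis by simp
  qed (rule assms(3))
qed

lemma hom_0 [simp]: "0 \<in> hom_polys d"
  by (rule poly.subspace_0[OF subspace_hom_polys])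

lemma hom_sum: "(\<And>i. i \<in> S \<Longrightarrow> f i \<in> hom_polys d) \<Longrightarrow> (\<Sum>i\<in>S. f i) \<in> hom_polys d"
  by (rule poly.subspace_sum[OF subspace_hom_polys])

lemma hom_scale: "p \<in> hom_polys d \<Longrightarrow> poly_scale c p \<in> hom_polys d"
  by (rule poly.subspace_scale[OF subspace_hom_polys])

text \<open>
  The endomorphisms of \<open>hom_polys d\<close>, extended by \<open>0\<close> to the other homogeneous components.
\<close>

definition end_ops :: "nat \<Rightarrow> ('n::finite, 'k::field) lin_op set" where
  "end_ops d = {X. proj d * X = X \<and> X * proj d = X}"

lemma end_ops_subspace: "lin_op.subspace (end_ops d)"
  by (auto simp: lin_op.subspace_def end_ops_def distrib_left distrib_right scal_left_commute mult.assoc)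

lemma end_ops_mult: "X \<in> end_ops d \<Longrightarrow> Y \<in> end_ops d \<Longrightarrow> X * Y \<in> end_ops d"
  by (simp add: end_ops_def mult.assoc) (simp flip: mult.assoc)

lemma end_ops_app: "X \<in> end_ops d \<Longrightarrow> app X p \<in> hom_polys d"
  by (metis (mono_tags, lifting) end_ops_def app_lin_op_simps(6) mem_Collect_eq proj_in_hom)

lemma end_ops_app_zero: "X \<in> end_ops d \<Longrightarrow> mon_degree t \<noteq> d \<Longrightarrow> app X (mon t) = 0"
  by (metis (mono_tags, lifting) end_ops_def app_lin_op_simps(6) mem_Collect_eq proj_mon app_zero)

lemma E_proj_end_ops: "E i j * proj d \<in> end_ops d"
proof -
  have "proj d * (E i j * proj d) = E i j * (proj d * proj d)"
    by (simp only: proj_E mult.assoc[symmetric])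
  then show ?thesis by (simp add: end_ops_def mult.assoc)
qed

lemma proj_E_left: "proj d * (E i j * X) = E i j * (proj d * X)"
  by (simp only: mult.assoc[symmetric] proj_E)

lemma end_ops_E_commutator:
  assumes "X \<in> end_ops d"
  shows "E i j * X - X * E i j \<in> end_ops d"
proof -
  have "proj d * X = X" "X * proj d = X"
    using assms by (auto simp: end_ops_def)
  moreover from this have "proj d * (X * Y) = X * Y" "X * (proj d * Y) = X * Y" for Y
    by (simp_all flip: mult.assoc)
  ultimately show ?thesis
    by (simp add: end_ops_def right_diff_distrib left_diff_distrib proj_E_left mult.assoc proj_E[symmetric])
qed

lemma end_ops_E_commutator_proj:
  assumes "X \<in> end_ops d"
  shows "E i j * proj d * X - X * (E i j * proj d) = E i j * X - X * E i j"
proof -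
  have "proj d * X = X" "X * proj d = X"
    using assms by (auto simp: end_ops_def)
  moreover from this have "X * (proj d * Y) = X * Y" for Y
    by (simp flip: mult.assoc)
  moreover have "X * (E i j * proj d) = X * E i j"
    using \<open>X * (proj d * E i j) = X * E i j\<close> by (simp add: proj_E)
  ultimately show ?thesis
    by (simp add: mult.assoc proj_E)
qed

definition entry :: "('n, 'k::field) lin_op \<Rightarrow> ('n \<Rightarrow>\<^sub>0 nat) \<Rightarrow> ('n \<Rightarrow>\<^sub>0 nat) \<Rightarrow> 'k" where
  "entry X s t = Poly_Mapping.lookup (app X (mon t)) s"

lemma entry_simps [simp]:
  "entry 0 s t = 0" "entry (X + Y) s t = entry X s t + entry Y s t" "entry (X - Y) s t = entry X s t - entry Y s t"
  "entry (- X) s t = - entry X s t" "entry (scal c * X) s t = c * entry X s t"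
  by (simp_all add: entry_def lookup_add lookup_minus lookup_poly_scale)

lemma entry_sum: "entry (\<Sum>i\<in>S. f i) s t = (\<Sum>i\<in>S. entry (f i) s t)"
  by (simp add: entry_def app_lin_op_sum lookup_sum)

lemma entry_eqI: "(\<And>s t. entry X s t = entry Y s t) \<Longrightarrow> X = Y"
  by (intro lin_op_eqI poly_mapping_eqI) (simp add: entry_def)

lemma end_ops_entry: "X \<in> end_ops d \<Longrightarrow> entry X s t \<noteq> 0 \<Longrightarrow> mon_degree s = d \<and> mon_degree t = d"
  using end_ops_app[of X d "mon t"] end_ops_app_zero[of X d t] by (auto simp: entry_def hom_polys_iff)

lemma entry_mult:
  assumes "Y \<in> end_ops d"
  shows "entry (X * Y) s t = (\<Sum>u\<in>exps d. entry X s u * entry Y u t)"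
proof -
  have "app X (app Y (mon t)) = (\<Sum>u\<in>exps d. poly_scale (entry Y u t) (app X (mon u)))"
    by (subst hom_expand[OF end_ops_app[OF assms]]) (simp add: app_sum app_scale entry_def)
  then show ?thesis
    by (simp add: entry_def lookup_sum lookup_poly_scale mult.commute)
qed

definition op_trace :: "nat \<Rightarrow> ('n::finite, 'k::field) lin_op \<Rightarrow> 'k" where
  "op_trace d X = (\<Sum>t\<in>exps d. entry X t t)"

lemma op_trace_simps [simp]: "op_trace d 0 = 0" "op_trace d (X + Y) = op_trace d X + op_trace d Y" "op_trace d (X - Y) = op_trace d X - op_trace d Y"
  "op_trace d (scal c * X) = c * op_trace d X"
  by (simp_all add: op_trace_def sum.distrib sum_subtractf sum_distrib_left)

lemma op_trace_sum: "op_trace d (\<Sum>i\<in>S. f i) = (\<Sum>i\<in>S. op_trace d (f i))"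
  by (induction S rule: infinite_finite_induct) auto

lemma op_trace_commute:
  assumes "X \<in> end_ops d" "Y \<in> end_ops d"
  shows "op_trace d (X * Y) = op_trace d (Y * X)"
  unfolding op_trace_def entry_mult[OF assms(1)] entry_mult[OF assms(2)]
  by (subst sum.swap) (simp add: mult.commute)

definition singular_op :: "nat \<Rightarrow> ('n::finite, 'k::field) lin_op \<Rightarrow> bool" where
  "singular_op d X \<longleftrightarrow> (\<exists>v\<in>hom_polys d. v \<noteq> 0 \<and> app X v = 0)"

text \<open>The images of the monomials together with \<open>w\<close>, indexed by
  \<open>None\<close>, are one vector too many for the component, hence dependent. Injectivity
  forces the coefficient of \<open>w\<close> to be nonzero, so the relation can be solved for
  \<open>w\<close>.\<close>

lemma nonsingular_surj:
  fixes X :: "('n::finite, 'k::field) lin_op"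
  assumes inj: "\<not> singular_op d X" and X: "\<And>v. v \<in> hom_polys d \<Longrightarrow> app X v \<in> hom_polys d"
    and w: "w \<in> hom_polys d"
  shows "\<exists>v\<in>hom_polys d. app X v = w"
proof -
  let ?T = "exps d :: ('n \<Rightarrow>\<^sub>0 nat) set"
  let ?S = "insert None (Some ` ?T)"
  define f where "f = (\<lambda>s. case s of None \<Rightarrow> w | Some t \<Rightarrow> app X (mon t))"
  have "card ?S = Suc (card ?T)"
    by (simp add: finite_exps card_image)
  then obtain c where c: "\<exists>s\<in>?S. c s \<noteq> 0"
    "\<forall>t\<in>?T. (\<Sum>s\<in>?S. c s * Poly_Mapping.lookup (f s) t) = 0"
    using underdetermined_system[of ?T ?S "\<lambda>t s. Poly_Mapping.lookup (f s) t"]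
    by (auto simp: finite_exps)
  define v where "v = (\<Sum>t\<in>?T. poly_scale (c (Some t)) (mon t))"
  have v: "v \<in> hom_polys d"
    unfolding v_def by (intro hom_sum hom_scale) (simp add: mon_in_hom exps_def)
  have "poly_scale (c None) w + app X v = (\<Sum>s\<in>?S. poly_scale (c s) (f s))"
    by (simp add: finite_exps sum.reindex f_def v_def app_sum app_scale)
  also have "\<dots> = 0"
  proof (rule hom_eqI)
    show "(\<Sum>s\<in>?S. poly_scale (c s) (f s)) \<in> hom_polys d"
    proof (intro hom_sum hom_scale)
      fix s assume "s \<in> ?S"
      then show "f s \<in> hom_polys d"
      proof (cases s)
        case (Some t)
        with \<open>s \<in> ?S\<close> have "mon t \<in> hom_polys d" by (auto simp: mon_in_hom exps_def)
        then show ?thesis using Some X by (simp add: f_def)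
      qed (simp add: f_def w)
    qed
  qed (use c(2) in \<open>simp_all add: lookup_sum lookup_poly_scale\<close>)
  finally have eq: "poly_scale (c None) w + app X v = 0" .
  have "c None \<noteq> 0"
  proof
    assume 0: "c None = 0"
    with eq inj v have "v = 0" by (auto simp: singular_op_def)
    then have "c (Some t) = 0" if "t \<in> ?T" for t
      using lookup_hom_expand[OF that, of "\<lambda>t. c (Some t)"] by (simp add: v_def)
    with 0 c(1) show False by auto
  qed
  have "app X v = - poly_scale (c None) w"
    using eq by (simp add: eq_neg_iff_add_eq_0 add.commute)
  then have "app X (poly_scale (- 1 / c None) v) = poly_scale (- 1 / c None) (- poly_scale (c None) w)"
    by (simp only: app_scale)
  also have "\<dots> = w"
    using \<open>c None \<noteq> 0\<close> by simp
  finally show ?thesis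
    using hom_scale[OF v] by blast
qed

text \<open>
  Kernel vectors of \<open>P + t N\<close> for distinct \<open>t\<close> are linearly independent, like eigenvectors of
  \<open>P\<^sup>-\<^sup>1 N\<close>, so there are only finitely many such \<open>t\<close>. No determinant on \<open>hom_polys d\<close> is needed.
\<close>

lemma finite_singular_perturbation:
  fixes P N :: "('n::finite, 'k::field) lin_op"
  assumes inj: "\<not> singular_op d P"
    and P: "\<And>v. v \<in> hom_polys d \<Longrightarrow> app P v \<in> hom_polys d"
    and N: "\<And>v. v \<in> hom_polys d \<Longrightarrow> app N v \<in> hom_polys d"
  shows "finite {t. singular_op d (P + scal t * N)}"
proof (rule ccontr)
  let ?T = "exps d :: ('n \<Rightarrow>\<^sub>0 nat) set"
  assume "infinite {t. singular_op d (P + scal t * N)}"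
  then obtain S where S: "S \<subseteq> {t. singular_op d (P + scal t * N)}" "finite S" "card S = Suc (card ?T)"
    by (metis infinite_arbitrarily_large)
  then have "\<forall>t\<in>S. \<exists>v\<in>hom_polys d. v \<noteq> 0 \<and> app P v + poly_scale t (app N v) = 0"
    by (auto simp: singular_op_def)
  then obtain v where v: "\<And>t. t \<in> S \<Longrightarrow> v t \<in> hom_polys d" "\<And>t. t \<in> S \<Longrightarrow> v t \<noteq> 0"
    "\<And>t. t \<in> S \<Longrightarrow> app P (v t) + poly_scale t (app N (v t)) = 0"
    by metis
  have indep: "c t = 0" if "U \<subseteq> S" "(\<Sum>t\<in>U. poly_scale (c t) (v t)) = 0" "t \<in> U" for U c t
  proof -
    have "finite U" using that(1) S(2) by (rule finite_subset)
    then show ?thesis using that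
    proof (induction U arbitrary: c t rule: finite_induct)
      case (insert t0 U)
      let ?U = "insert t0 U"
      have nz: "t \<noteq> 0" if "t \<in> ?U" for t
      proof
        assume "t = 0"
        with insert.prems(1) that have "0 \<in> S" by auto
        with v[of 0] inj show False by (auto simp: singular_op_def)
      qed
      have PN: "app N (v t) = poly_scale (- 1 / t) (app P (v t))" if "t \<in> ?U" for t
      proof -
        have "poly_scale t (app N (v t)) = - app P (v t)"
          using v(3)[of t] that insert.prems(1) by (auto simp: eq_neg_iff_add_eq_0 add.commute)
        then have "poly_scale (1 / t) (poly_scale t (app N (v t))) = poly_scale (1 / t) (- app P (v t))"
          by simp
        then show ?thesis using nz[OF that] by simp
      qed
      \<comment> \<open>Since N v = - P v / t on each kernel vector, P sends \<open>?w\<close> to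
        minus N of the given relation, that is to 0. So the coefficients c t / t give a second
        relation; subtracting the first one divided by t0 removes the t0 term.\<close>
      let ?w = "\<Sum>t\<in>?U. poly_scale (c t / t) (v t)"
      have "app P ?w = - app N (\<Sum>t\<in>?U. poly_scale (c t) (v t))"
        unfolding app_sum app_scale sum_negf[symmetric]
        by (rule sum.cong) (simp_all add: PN)
      then have "app P ?w = 0"
        using insert.prems(2) by simp
      moreover have "?w \<in> hom_polys d"
        using v(1) insert.prems(1) by (intro hom_sum hom_scale) auto
      ultimately have w: "?w = 0"
        using inj by (auto simp: singular_op_def)
      have "(\<Sum>t\<in>?U. poly_scale (c t * (1 / t - 1 / t0)) (v t)) =
          ?w - poly_scale (1 / t0) (\<Sum>t\<in>?U. poly_scale (c t) (v t))"
        unfolding poly.scale_sum_right sum_subtractf[symmetric]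
        by (rule sum.cong) (simp_all add: algebra_simps flip: poly.scale_left_diff_distrib)
      also have "\<dots> = 0"
        using w insert.prems(2) by simp
      finally have "(\<Sum>t\<in>U. poly_scale (c t * (1 / t - 1 / t0)) (v t)) = 0"
        using insert.hyps by simp
      then have *: "c t * (1 / t - 1 / t0) = 0" if "t \<in> U" for t
        using insert.IH[of "\<lambda>t. c t * (1 / t - 1 / t0)" t] insert.prems(1) that by auto
      have **: "c t = 0" if "t \<in> U" for t
      proof -
        have "t \<noteq> t0" using that insert.hyps by auto
        then have "1 / t - 1 / t0 \<noteq> 0" using nz[of t] nz[of t0] that by (simp add: field_simps)
        with *[OF that] show ?thesis by simp
      qed
      then have "poly_scale (c t0) (v t0) = 0"
        using insert.prems(2) insert.hyps by simp
      then have "c t0 = 0"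
        using v(2)[of t0] insert.prems(1) by simp
      with ** insert.prems(3) show ?case by auto
    qed auto
  qed
  obtain c where c: "\<exists>s\<in>S. c s \<noteq> 0" "\<forall>t\<in>?T. (\<Sum>s\<in>S. c s * Poly_Mapping.lookup (v s) t) = 0"
    using underdetermined_system[of ?T S "\<lambda>t s. Poly_Mapping.lookup (v s) t"] S finite_exps
    by auto
  have "(\<Sum>s\<in>S. poly_scale (c s) (v s)) = 0"
  proof (rule hom_eqI)
    show "(\<Sum>s\<in>S. poly_scale (c s) (v s)) \<in> hom_polys d"
      using v(1) by (intro hom_sum hom_scale) auto
  qed (use c(2) in \<open>simp_all add: lookup_sum lookup_poly_scale\<close>)
  with indep c(1) show False by blast
qed

section \<open>Linear vector fields and singularity\<close>

text \<open>The index order is that of the vector field x -> M x: the derivation sends x_i to the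
  i-th coordinate of M x. On V, \<open>nat_rep\<close> is the negative of this.\<close>

definition lin_field :: "('n \<Rightarrow> 'n \<Rightarrow> 'k::field) \<Rightarrow> ('n::finite, 'k) lin_op" where
  "lin_field M = (\<Sum>i\<in>UNIV. \<Sum>j\<in>UNIV. scal (M i j) * E j i)"

lemma lin_field_add: "lin_field (\<lambda>i j. M i j + N i j) = lin_field M + lin_field N"
  by (simp add: lin_field_def scal_add distrib_right sum.distrib)

lemma lin_field_diff: "lin_field (\<lambda>i j. M i j - N i j) = lin_field M - lin_field N"
  by (simp add: lin_field_def scal_diff left_diff_distrib sum_subtractf)

lemma lin_field_scale: "lin_field (\<lambda>i j. c * M i j) = scal c * lin_field M"
  by (simp add: lin_field_def sum_distrib_left)

lemma lin_field_col: "lin_field (\<lambda>i j. if j = a then f i else 0) = (\<Sum>i\<in>UNIV. scal (f i) * E a i)"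
  by (simp add: lin_field_def if_distrib[of scal] if_distrib[of "\<lambda>X. X * _"] cong: if_cong)

lemma lin_field_row: "lin_field (\<lambda>i j. if i = b then f j else 0) = (\<Sum>j\<in>UNIV. scal (f j) * E j b)"
  unfolding lin_field_def
  by (subst sum.swap) (simp add: if_distrib[of scal] if_distrib[of "\<lambda>X. X * _"] cong: if_cong)

lemma lin_field_diag: "lin_field (\<lambda>i j. if i = j then h i else 0) = (\<Sum>i\<in>UNIV. scal (h i) * E i i)"
  by (simp add: lin_field_def if_distrib[of scal] if_distrib[of "\<lambda>X. X * _"] cong: if_cong)

definition sl_ops :: "nat \<Rightarrow> ('n::finite, 'k::field) lin_op set" where
  "sl_ops d = {lin_field M * proj d | M. (\<Sum>i\<in>UNIV. M i i) = 0}"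

lemma sl_ops_I: "(\<Sum>i\<in>UNIV. M i i) = 0 \<Longrightarrow> lin_field M * proj d \<in> sl_ops d"
  by (auto simp: sl_ops_def)

lemma sl_ops_subspace: "lin_op.subspace (sl_ops d :: ('n::finite, 'k::field) lin_op set)"
  unfolding lin_op.subspace_def
proof (intro conjI ballI allI)
  show "(0 :: ('n, 'k) lin_op) \<in> sl_ops d"
    using sl_ops_I[of "\<lambda>_ _. 0" d] by (simp add: lin_field_def)
next
  fix X Y :: "('n, 'k) lin_op"
  assume "X \<in> sl_ops d" "Y \<in> sl_ops d"
  then obtain M N where "X = lin_field M * proj d" "(\<Sum>i\<in>UNIV. M i i) = 0" "Y = lin_field N * proj d" "(\<Sum>i\<in>UNIV. N i i) = 0"
    by (auto simp: sl_ops_def)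
  then show "X + Y \<in> sl_ops d"
    using sl_ops_I[of "\<lambda>i j. M i j + N i j" d] by (simp add: lin_field_add sum.distrib distrib_right)
next
  fix c and X :: "('n, 'k) lin_op"
  assume "X \<in> sl_ops d"
  then obtain M where "X = lin_field M * proj d" "(\<Sum>i\<in>UNIV. M i i) = 0"
    by (auto simp: sl_ops_def)
  then show "scal c * X \<in> sl_ops d"
    using sl_ops_I[of "\<lambda>i j. c * M i j" d] by (simp add: lin_field_scale mult.assoc flip: sum_distrib_left)
qed

lemma sl_ops_diag: "(\<Sum>i\<in>UNIV. h i) = 0 \<Longrightarrow> (\<Sum>i\<in>UNIV. scal (h i) * E i i) * proj d \<in> sl_ops d"
  using sl_ops_I[of "\<lambda>i j. if i = j then h i else 0" d] by (simp add: lin_field_diag)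

lemma sl_ops_E: "a \<noteq> b \<Longrightarrow> (E a b * proj d :: ('n::finite, 'k::field) lin_op) \<in> sl_ops d"
proof -
  assume "a \<noteq> b"
  then have "(\<Sum>i\<in>UNIV. (if i = a then if i = b then 1 else 0 else 0)) = (0 :: 'k)"
    by simp
  from sl_ops_I[of "\<lambda>i j. if j = a then if i = b then 1 else 0 else 0", OF this]
  show ?thesis
    unfolding lin_field_col by (simp add: if_distrib[of scal] if_distrib[of "\<lambda>X. X * _"] cong: if_cong)
qed

lemma lin_field_proj_end_ops: "lin_field M * proj d \<in> end_ops d"
  unfolding lin_field_def sum_distrib_right mult.assoc
  by (intro lin_op.subspace_sum end_ops_subspace lin_op.subspace_scale[OF end_ops_subspace] E_proj_end_ops)

lemma sl_ops_end_ops: "X \<in> sl_ops d \<Longrightarrow> X \<in> end_ops d"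
  by (auto simp: sl_ops_def lin_field_proj_end_ops)

lemma E_lin_field_commutator: "E a b * lin_field M - lin_field M * E a b =
    lin_field (\<lambda>i j. (if j = a then M i b else 0) - (if i = b then M a j else 0))"
proof -
  have "E a b * lin_field M - lin_field M * E a b =
     (\<Sum>i\<in>UNIV. \<Sum>j\<in>UNIV. scal (M i j) * (E a b * E j i - E j i * E a b))"
    by (simp add: lin_field_def sum_distrib_left sum_distrib_right right_diff_distrib sum_subtractf
        scal_left_commute mult.assoc)
  also have "\<dots> = (\<Sum>i\<in>UNIV. \<Sum>j\<in>UNIV. scal (M i j) * (if j = b then E a i else 0))
       - (\<Sum>i\<in>UNIV. \<Sum>j\<in>UNIV. scal (M i j) * (if i = a then E j b else 0))"
    by (simp add: E_commutator right_diff_distrib sum_subtractf eq_commute[of a] eq_commute[of b])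
  also have "(\<Sum>i\<in>UNIV. \<Sum>j\<in>UNIV. scal (M i j) * (if j = b then E a i else 0)) =
      (\<Sum>i\<in>UNIV. scal (M i b) * E a i)"
    by (simp add: if_distrib[of "\<lambda>X. _ * X"] cong: if_cong)
  also have "(\<Sum>i\<in>UNIV. \<Sum>j\<in>UNIV. scal (M i j) * (if i = a then E j b else 0)) =
      (\<Sum>j\<in>UNIV. scal (M a j) * E j b)"
    by (subst sum.swap) (simp add: if_distrib[of "\<lambda>X. _ * X"] cong: if_cong)
  finally show ?thesis
    by (simp only: lin_field_diff lin_field_col lin_field_row)
qed

lemma sl_ops_E_commutator:
  assumes "X \<in> sl_ops d"
  shows "E a b * X - X * E a b \<in> sl_ops d"
proof -
  obtain M where M: "X = lin_field M * proj d" "(\<Sum>i\<in>UNIV. M i i) = 0"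
    using assms by (auto simp: sl_ops_def)
  have "E a b * X - X * E a b = (E a b * lin_field M - lin_field M * E a b) * proj d"
    by (simp add: M left_diff_distrib mult.assoc proj_E)
  also have "\<dots> \<in> sl_ops d"
    unfolding E_lin_field_commutator
    by (intro sl_ops_I) (simp add: sum_subtractf)
  finally show ?thesis .
qed

section \<open>Derivations, determinants and cyclic vectors\<close>

lemma pdiff_0 [simp]: "pdiff j 0 = 0"
  by (simp add: pdiff_def)

lemma pdiff_sum: "pdiff j (\<Sum>i\<in>S. f i) = (\<Sum>i\<in>S. pdiff j (f i))"
  by (induction S rule: infinite_finite_induct) (auto simp: pdiff_add)

lemma poly_scale_mult: "poly_scale c p * q = poly_scale c (p * q)" "p * poly_scale c q = poly_scale c (p * q)"
  by (simp_all add: poly_scale_def mult_ac)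

lemma pdiff_mult: "pdiff j (p * q) = pdiff j p * q + p * pdiff j (q :: ('n, 'k::field) mpoly)"
proof -
  have mono: "pdiff j (mon s * mon t) = pdiff j (mon s) * mon t + mon s * (pdiff j (mon t) :: ('n, 'k) mpoly)"
    for s t
  proof -
    have swap: "u + unit_exp j + v - unit_exp j = u + v" for u v :: "'n \<Rightarrow>\<^sub>0 nat"
      by (metis add.assoc add.commute add_diff_cancel_right')
    have "s + t - unit_exp j = s - unit_exp j + t" if "Poly_Mapping.lookup s j \<noteq> 0"
      using swap[of "s - unit_exp j" t] minus_unit_add[OF that] by simp
    moreover have "s + t - unit_exp j = s + (t - unit_exp j)" if "Poly_Mapping.lookup t j \<noteq> 0"
      using swap[of "t - unit_exp j" s] minus_unit_add[OF that] by (simp add: add.commute)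
    ultimately show ?thesis
      by (cases "Poly_Mapping.lookup s j = 0"; cases "Poly_Mapping.lookup t j = 0")
        (simp_all add: mult_single pdiff_mon lookup_add single_add)
  qed
  have left: "pdiff j (p * mon t) = pdiff j p * mon t + p * pdiff j (mon t)" for t
  proof -
    define c where "c = Poly_Mapping.lookup p"
    define K where "K = Poly_Mapping.keys p"
    have p: "p = (\<Sum>s\<in>K. poly_scale (c s) (mon s))"
      unfolding c_def K_def by (rule poly_expand)
    show ?thesis
      unfolding p by (simp only: pdiff_sum sum_distrib_right pdiff_scale poly_scale_mult mono
          sum.distrib poly.scale_right_distrib)
  qed
  define c where "c = Poly_Mapping.lookup q"
  define K where "K = Poly_Mapping.keys q"
  have q: "q = (\<Sum>s\<in>K. poly_scale (c s) (mon s))"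
    unfolding c_def K_def by (rule poly_expand)
  show ?thesis
    unfolding q by (simp only: pdiff_sum sum_distrib_left pdiff_scale poly_scale_mult left
        sum.distrib poly.scale_right_distrib)
qed

lemma lin_field_app: "app (lin_field M) p = (\<Sum>i\<in>UNIV. \<Sum>j\<in>UNIV. poly_scale (M i j) (Var j * pdiff i p))"
  by (simp add: lin_field_def app_lin_op_sum app_E)

lemma lin_field_mult: "app (lin_field M) (p * q) = app (lin_field M) p * q + p * app (lin_field M) q"
  unfolding lin_field_app sum_distrib_left sum_distrib_right sum.distrib[symmetric]
  by (intro sum.cong refl)
    (simp add: pdiff_mult poly_scale_mult distrib_left poly.scale_right_distrib mult_ac)

lemma lin_field_one: "app (lin_field M) 1 = 0"
  using lin_field_mult[of M 1 1] by simp

lemma pdiff_Var: "pdiff k (Var i) = (if k = i then 1 else 0)"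
  by (simp add: Var_def pdiff_mon lookup_single when_def flip: single_one)

lemma lin_field_Var: "app (lin_field M) (Var i) = (\<Sum>j\<in>UNIV. poly_scale (M i j) (Var j))"
  unfolding lin_field_app
  by (subst sum.swap) (simp add: pdiff_Var if_distrib[of "\<lambda>p. _ * p"] if_distrib[of "poly_scale _"] cong: if_cong)

lemma derivation_prod:
  fixes D :: "'a::comm_ring_1 \<Rightarrow> 'a"
  assumes mult: "\<And>p q. D (p * q) = D p * q + p * D q" and "finite S"
  shows "D (\<Prod>i\<in>S. f i) = (\<Sum>r\<in>S. D (f r) * (\<Prod>i\<in>S - {r}. f i))"
  using \<open>finite S\<close>
proof (induction S rule: finite_induct)
  case empty
  then show ?case using mult[of 1 1] by simp
next
  case (insert x S)
  have "(\<Sum>r\<in>S. D (f r) * (\<Prod>i\<in>insert x S - {r}. f i)) = f x * (\<Sum>r\<in>S. D (f r) * (\<Prod>i\<in>S - {r}. f i))"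
    unfolding sum_distrib_left
  proof (rule sum.cong[OF refl])
    fix r assume "r \<in> S"
    then have "insert x S - {r} = insert x (S - {r})" using insert.hyps by auto
    then show "D (f r) * (\<Prod>i\<in>insert x S - {r}. f i) = f x * (D (f r) * (\<Prod>i\<in>S - {r}. f i))"
      using insert.hyps by (simp add: mult_ac)
  qed
  with insert show ?case
    by (simp add: mult)
qed

lemma derivation_det:
  fixes D :: "'a::comm_ring_1 \<Rightarrow> 'a" and A :: "'a^'n^'n"
  assumes mult: "\<And>p q. D (p * q) = D p * q + p * D q" and add: "\<And>p q. D (p + q) = D p + D q"
  shows "D (det A) = (\<Sum>r\<in>UNIV. det (\<chi> i. if i = r then (\<chi> j. D (A $ r $ j)) else A $ i))"
proof -
  have 0: "D 0 = 0" using add[of 0 0] by simp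
  have neg: "D (- p) = - D p" for p
    using add[of p "- p"] 0 by (simp add: eq_neg_iff_add_eq_0 add.commute)
  have sum: "D (\<Sum>i\<in>S. f i) = (\<Sum>i\<in>S. D (f i))" for f :: "('n \<Rightarrow> 'n) \<Rightarrow> 'a" and S
    by (induction S rule: infinite_finite_induct) (auto simp: add 0)
  have sign: "D (of_int (sign p) * q) = of_int (sign p) * D q" for p :: "'n \<Rightarrow> 'n" and q
    by (simp add: sign_def neg)
  have "(\<Prod>i\<in>UNIV. (if i = r then (\<chi> j. D (A $ r $ j)) else A $ i) $ p i) =
      D (A $ r $ p r) * (\<Prod>i\<in>UNIV - {r}. A $ i $ p i)" for p r
    by (subst prod.remove[of _ r]) (auto intro!: prod.cong)
  then show ?thesis
    unfolding det_def sum sign derivation_prod[OF mult finite]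
    by (subst sum.swap) (simp add: sum_distrib_left)
qed

text \<open>Liouville's formula. In the row-wise product rule the r-th row is replaced by a
  combination of all rows; every summand other than the multiple of row r itself repeats a
  row.\<close>

lemma derivation_det_row_operator:
  fixes D :: "'a::comm_ring_1 \<Rightarrow> 'a" and A :: "'a^'n^'n"
  assumes mult: "\<And>p q. D (p * q) = D p * q + p * D q" and add: "\<And>p q. D (p + q) = D p + D q"
    and row: "\<And>i j. D (A $ i $ j) = (\<Sum>l\<in>UNIV. M i l * A $ l $ j)"
  shows "D (det A) = (\<Sum>i\<in>UNIV. M i i) * det A"
proof -
  have "det (\<chi> i. if i = r then (\<chi> j. D (A $ r $ j)) else A $ i) = M r r * det A" for r
  proof -
    have "(\<chi> j. D (A $ r $ j)) = (\<Sum>l\<in>UNIV. M r l *s A $ l)"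
      by (simp add: vec_eq_iff row)
    then have "det (\<chi> i. if i = r then (\<chi> j. D (A $ r $ j)) else A $ i) =
        (\<Sum>l\<in>UNIV. M r l * det (\<chi> i. if i = r then A $ l else A $ i))"
      by (simp add: det_linear_row_sum det_row_mul cong: if_cong)
    also have "\<dots> = (\<Sum>l\<in>UNIV. if l = r then M r r * det A else 0)"
    proof (rule sum.cong[OF refl])
      fix l
      show "M r l * det (\<chi> i. if i = r then A $ l else A $ i) = (if l = r then M r r * det A else 0)"
      proof (cases "l = r")
        case True
        then have "(\<chi> i. if i = r then A $ l else A $ i) = A" by (simp add: vec_eq_iff)
        with True show ?thesis by simp
      next
        case False
        then have "det (\<chi> i. if i = r then A $ l else A $ i) = 0"
          by (intro det_identical_rows[of l r]) (auto simp: row_def)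
        with False show ?thesis by simp
      qed
    qed
    finally show ?thesis by simp
  qed
  then show ?thesis
    by (simp add: derivation_det[of D, OF mult add] sum_distrib_right)
qed

definition eval_at :: "('n::finite \<Rightarrow> 'k::field) \<Rightarrow> ('n, 'k) mpoly \<Rightarrow> 'k" where
  "eval_at a p = (\<Sum>t\<in>Poly_Mapping.keys p. Poly_Mapping.lookup p t * (\<Prod>i\<in>UNIV. a i ^ Poly_Mapping.lookup t i))"

lemma eval_at_superset:
  "finite K \<Longrightarrow> Poly_Mapping.keys p \<subseteq> K \<Longrightarrow>
    eval_at a p = (\<Sum>t\<in>K. Poly_Mapping.lookup p t * (\<Prod>i\<in>UNIV. a i ^ Poly_Mapping.lookup t i))"
  unfolding eval_at_def by (rule sum.mono_neutral_left) (auto simp: in_keys_iff)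

lemma eval_at_add: "eval_at a (p + q) = eval_at a p + eval_at a q"
proof -
  let ?K = "Poly_Mapping.keys p \<union> Poly_Mapping.keys q"
  have "Poly_Mapping.keys (p + q) \<subseteq> ?K" by (rule keys_add)
  then show ?thesis
    by (simp add: eval_at_superset[of ?K] lookup_add distrib_right sum.distrib)
qed

lemma eval_at_0 [simp]: "eval_at a 0 = 0"
  by (simp add: eval_at_def)

lemma eval_at_sum: "eval_at a (\<Sum>i\<in>S. f i) = (\<Sum>i\<in>S. eval_at a (f i))"
  by (induction S rule: infinite_finite_induct) (auto simp: eval_at_add)

lemma eval_at_single: "eval_at a (Poly_Mapping.single t c) = c * (\<Prod>i\<in>UNIV. a i ^ Poly_Mapping.lookup t i)"
  by (subst eval_at_superset[of "{t}"]) auto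

lemma eval_at_1 [simp]: "eval_at a 1 = 1"
  by (simp add: eval_at_single flip: single_one)

lemma eval_at_mult: "eval_at a (p * q) = eval_at a p * eval_at a (q :: ('n::finite, 'k::field) mpoly)"
proof -
  have expand: "r = (\<Sum>s\<in>Poly_Mapping.keys r. Poly_Mapping.single s (Poly_Mapping.lookup r s))"
    for r :: "('n, 'k) mpoly"
    using poly_expand[of r] by (simp add: poly_scale_mon)
  have "p * q = (\<Sum>s\<in>Poly_Mapping.keys p. \<Sum>t\<in>Poly_Mapping.keys q.
      Poly_Mapping.single (s + t) (Poly_Mapping.lookup p s * Poly_Mapping.lookup q t))"
    by (subst (1) expand[of p], subst (1) expand[of q]) (simp add: sum_product mult_single)
  then show ?thesis
    by (simp add: eval_at_sum eval_at_single lookup_add power_add prod.distrib)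
      (simp add: eval_at_def sum_product mult_ac)
qed

lemma eval_at_Var: "eval_at a (Var i) = a i"
proof -
  have "(\<Prod>j\<in>UNIV. a j ^ Poly_Mapping.lookup (unit_exp i) j) = (\<Prod>j\<in>UNIV. if j = i then a i else 1)"
    by (intro prod.cong) (auto simp: lookup_single when_def)
  then show ?thesis by (simp add: Var_def eval_at_single)
qed

lemma eval_at_power: "eval_at a (p ^ k) = eval_at a p ^ k"
  by (induction k) (auto simp: eval_at_mult)

lemma ring_hom_det:
  fixes h :: "'a::comm_ring_1 \<Rightarrow> 'b::comm_ring_1" and A :: "'a^'n^'n"
  assumes add: "\<And>p q. h (p + q) = h p + h q" and mult: "\<And>p q. h (p * q) = h p * h q" and one: "h 1 = 1"
  shows "h (det A) = det (\<chi> i j. h (A $ i $ j))"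
proof -
  have 0: "h 0 = 0" using add[of 0 0] by simp
  have neg: "h (- p) = - h p" for p
    using add[of p "- p"] 0 by (simp add: eq_neg_iff_add_eq_0 add.commute)
  have sum: "h (\<Sum>i\<in>S. f i) = (\<Sum>i\<in>S. h (f i))" for f :: "('n \<Rightarrow> 'n) \<Rightarrow> 'a" and S
    by (induction S rule: infinite_finite_induct) (auto simp: add 0)
  have prod: "h (\<Prod>i\<in>S. f i) = (\<Prod>i\<in>S. h (f i))" for f :: "'n \<Rightarrow> 'a" and S
    by (induction S rule: infinite_finite_induct) (auto simp: mult one)
  have sign: "h (of_int (sign p) * q) = of_int (sign p) * h q" for p :: "'n \<Rightarrow> 'n" and q
    by (simp add: sign_def neg)
  show ?thesis
    by (simp add: det_def sum sign prod)
qed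

lemma hom_mult: "p \<in> hom_polys a \<Longrightarrow> q \<in> hom_polys b \<Longrightarrow> p * q \<in> hom_polys (a + b)"
  using keys_mult[of p q] by (fastforce simp: hom_polys_def mon_degree_add)

lemma hom_1: "1 \<in> hom_polys 0"
  by (simp add: hom_polys_def mon_degree_def)

lemma hom_prod: "(\<And>i. i \<in> S \<Longrightarrow> f i \<in> hom_polys 1) \<Longrightarrow> finite S \<Longrightarrow> (\<Prod>i\<in>S. f i) \<in> hom_polys (card S)"
proof (induction S rule: infinite_finite_induct)
  case (insert x F)
  then show ?case using hom_mult[of "f x" 1 "prod f F" "card F"] by (simp add: plus_1_eq_Suc)
qed (auto simp: hom_1)

lemma hom_power: "p \<in> hom_polys a \<Longrightarrow> p ^ k \<in> hom_polys (k * a)"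
  by (induction k) (auto simp: hom_1 hom_mult)

lemma hom_det:
  fixes A :: "('n::finite, 'k::field) mpoly^'m^'m"
  assumes "\<And>i j. A $ i $ j \<in> hom_polys 1"
  shows "det A \<in> hom_polys CARD('m)"
  unfolding det_def
proof (rule hom_sum)
  fix p :: "'m \<Rightarrow> 'm"
  have "(\<Prod>i\<in>UNIV. A $ i $ p i) \<in> hom_polys CARD('m)"
    using assms by (intro hom_prod) auto
  then show "of_int (sign p) * (\<Prod>i\<in>UNIV. A $ i $ p i) \<in> hom_polys CARD('m)"
    by (simp add: sign_def poly.subspace_neg[OF subspace_hom_polys])
qed

text \<open>The vector M^k v over any commutative ring, because it is used for the generic vector x,
  for scalars, and for matrices depending polynomially on a parameter.\<close>

fun krylov :: "('n \<Rightarrow> 'n \<Rightarrow> 'a::comm_ring_1) \<Rightarrow> ('n::finite \<Rightarrow> 'a) \<Rightarrow> nat \<Rightarrow> 'n \<Rightarrow> 'a" where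
  "krylov M v 0 i = v i"
| "krylov M v (Suc k) i = (\<Sum>j\<in>UNIV. M i j * krylov M v k j)"

lemma krylov_hom:
  fixes h :: "'a::comm_ring_1 \<Rightarrow> 'b::comm_ring_1" and M :: "'n::finite \<Rightarrow> 'n \<Rightarrow> 'a"
  assumes add: "\<And>p q. h (p + q) = h p + h q" and mult: "\<And>p q. h (p * q) = h p * h q"
  shows "h (krylov M v k i) = krylov (\<lambda>i j. h (M i j)) (\<lambda>i. h (v i)) k i"
proof (induction k arbitrary: i)
  case (Suc k)
  have 0: "h 0 = 0" using add[of 0 0] by simp
  have "h (\<Sum>i\<in>S. f i) = (\<Sum>i\<in>S. h (f i))" for f :: "'n \<Rightarrow> 'a" and S
    by (induction S rule: infinite_finite_induct) (auto simp: add 0)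
  with Suc show ?case by (simp add: mult)
qed simp

text \<open>All entries of the generic Krylov matrix are linear forms, which fixes the degree of the
  determinant. Evaluation at the single point \<open>a\<close> shows that the determinant and its
  powers are nonzero.\<close>

lemma singular_if_cyclic:
  fixes M :: "'n::finite \<Rightarrow> 'n \<Rightarrow> 'k::field" and idx :: "'n \<Rightarrow> nat"
  assumes trace: "(\<Sum>i\<in>UNIV. M i i) = 0"
    and cyc: "det (\<chi> i c. krylov M a (idx c) i) \<noteq> 0"
  shows "singular_op (e * CARD('n)) (lin_field M)"
proof -
  let ?M = "\<lambda>i j. Poly_Mapping.single 0 (M i j) :: ('n, 'k) mpoly"
  define A :: "('n, 'k) mpoly^'n^'n" where "A = (\<chi> i c. krylov ?M Var (idx c) i)"
  have kr: "app (lin_field M) (krylov ?M Var k i) = (\<Sum>j\<in>UNIV. ?M i j * krylov ?M Var k j)" for k i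
  proof (induction k arbitrary: i)
    case 0
    then show ?case by (simp add: lin_field_Var poly_scale_def)
  next
    case (Suc k)
    then show ?case by (simp add: app_sum app_scale flip: poly_scale_def)
  qed
  have "app (lin_field M) (det A) = (\<Sum>i\<in>UNIV. ?M i i) * det A"
    by (rule derivation_det_row_operator) (auto simp: lin_field_mult app_add A_def kr)
  also have "(\<Sum>i\<in>UNIV. ?M i i) = Poly_Mapping.single 0 (\<Sum>i\<in>UNIV. M i i)"
    by (rule poly_mapping_eqI) (simp add: lookup_sum lookup_single when_def sum_distrib_right)
  finally have D: "app (lin_field M) (det A) = 0" by (simp add: trace)
  have "app (lin_field M) (det A ^ e) = 0"
    by (induction e) (auto simp: lin_field_one lin_field_mult D)
  moreover have "det A ^ e \<in> hom_polys (e * CARD('n))"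
  proof (intro hom_power hom_det)
    fix i c
    have "krylov ?M Var k i \<in> hom_polys 1" for k i
      by (induction k arbitrary: i)
        (auto intro!: hom_sum hom_scale simp: Var_def mon_in_hom simp flip: poly_scale_def)
    then show "A $ i $ c \<in> hom_polys 1" by (simp add: A_def)
  qed
  moreover have "det A ^ e \<noteq> 0"
  proof -
    have "eval_at a (det A) = det (\<chi> i c. krylov M a (idx c) i)"
      by (simp add: ring_hom_det[of "eval_at a"] eval_at_add eval_at_mult A_def krylov_hom[of "eval_at a"] eval_at_Var eval_at_single)
    then have "eval_at a (det A ^ e) \<noteq> 0"
      using cyc by (simp add: eval_at_power)
    then show ?thesis by auto
  qed
  ultimately show ?thesis by (auto simp: singular_op_def)
qed

text \<open>If \<open>lin_field M\<close> were nonsingular, only finitely many of its perturbations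
  by multiples of \<open>lin_field C\<close> would be singular. But C + s M has a cyclic vector,
  hence a singular field, for all but finitely many s, and dividing by s makes M + C / s such a
  perturbation.\<close>

lemma singular_lin_field:
  fixes M :: "'n::finite \<Rightarrow> 'n \<Rightarrow> 'k::field_char_0"
  assumes trace: "(\<Sum>i\<in>UNIV. M i i) = 0"
  shows "singular_op (e * CARD('n)) (lin_field M)"
proof (rule ccontr)
  let ?d = "e * CARD('n)"
  assume ns: "\<not> singular_op ?d (lin_field M)"
  obtain idx :: "'n \<Rightarrow> nat" where idx: "bij_betw idx UNIV {0..<CARD('n)}"
    using ex_bij_betw_finite_nat[OF finite_class.finite_UNIV] by blast
  \<comment> \<open>\<open>C\<close> shifts the basis along the enumeration and \<open>a\<close> is
    its first vector, so the Krylov matrix of C at a is the identity and \<open>det W\<close> is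
    nonzero at s = 0.\<close>
  define C :: "'n \<Rightarrow> 'n \<Rightarrow> 'k" where "C i j = (if idx i = Suc (idx j) then 1 else 0)" for i j
  define a :: "'n \<Rightarrow> 'k" where "a i = (if idx i = 0 then 1 else 0)" for i
  define W :: "'k poly ^'n^'n" where "W = (\<chi> i c. krylov (\<lambda>i j. [:C i j, M i j:]) (\<lambda>i. [:a i:]) (idx c) i)"
  have W: "poly (det W) s = det (\<chi> i c. krylov (\<lambda>i j. C i j + s * M i j) a (idx c) i)" for s
  proof -
    have "poly (det W) s = det (\<chi> i c. poly (W $ i $ c) s)"
      by (rule ring_hom_det) simp_all
    moreover have "poly (W $ i $ c) s = krylov (\<lambda>i j. C i j + s * M i j) a (idx c) i" for i c
      unfolding W_def vec_lambda_beta by (subst krylov_hom[of "\<lambda>p. poly p s"]) simp_all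
    ultimately show ?thesis by simp
  qed
  have "krylov C a k i = (if idx i = k then 1 else 0)" if "k < CARD('n)" for k i
    using that
  proof (induction k arbitrary: i)
    case (Suc k)
    then have "k \<in> range idx"
      using idx by (simp add: bij_betw_def)
    then obtain l where l: "idx l = k" by auto
    have "idx j = k \<longleftrightarrow> j = l" for j
      using idx l by (auto simp: bij_betw_def inj_on_def)
    with Suc have "krylov C a (Suc k) i = C i l"
      by (simp add: if_distrib[of "\<lambda>p. _ * p"] cong: if_cong)
    also have "\<dots> = (if idx i = Suc k then 1 else 0)"
      by (simp add: C_def l)
    finally show ?case .
  qed (simp add: a_def)
  moreover have "idx c < CARD('n)" for c
    using idx by (auto simp: bij_betw_def)
  moreover have "idx i = idx c \<longleftrightarrow> i = c" for i c
    using idx by (auto simp: bij_betw_def inj_on_def)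
  ultimately have "(\<chi> i c. krylov C a (idx c) i) = mat 1"
    by (simp add: mat_def vec_eq_iff)
  then have "poly (det W) 0 \<noteq> 0"
    by (simp add: W)
  then have fin: "finite {s. poly (det W) s = 0}"
    by (intro poly_roots_finite) auto
  have app_hom: "v \<in> hom_polys ?d \<Longrightarrow> app (lin_field N) v \<in> hom_polys ?d" for v and N :: "'n \<Rightarrow> 'n \<Rightarrow> 'k"
    by (metis end_ops_app lin_field_proj_end_ops app_lin_op_simps(6) proj_hom)
  have "finite {t. singular_op ?d (lin_field M + scal t * lin_field C)}"
    by (rule finite_singular_perturbation[OF ns app_hom app_hom])
  then have "finite ((\<lambda>t. 1 / t) ` {t. singular_op ?d (lin_field M + scal t * lin_field C)})"
    by (rule finite_imageI)
  moreover have "s \<in> (\<lambda>t. 1 / t) ` {t. singular_op ?d (lin_field M + scal t * lin_field C)}"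
    if "poly (det W) s \<noteq> 0" "s \<noteq> 0" for s
  proof
    have "(\<Sum>i\<in>UNIV. C i i + s * M i i) = 0"
      using trace by (simp add: C_def sum.distrib flip: sum_distrib_left)
    then have "singular_op ?d (lin_field (\<lambda>i j. C i j + s * M i j))"
      by (rule singular_if_cyclic) (use that W in auto)
    then obtain v where v: "v \<in> hom_polys ?d" "v \<noteq> 0" "app (lin_field C) v + poly_scale s (app (lin_field M) v) = 0"
      by (auto simp: singular_op_def lin_field_add lin_field_scale)
    then have "poly_scale (1 / s) (app (lin_field C) v + poly_scale s (app (lin_field M) v)) = 0"
      by simp
    then have "app (lin_field M) v + poly_scale (1 / s) (app (lin_field C) v) = 0"
      using that by (simp add: poly.scale_right_distrib add.commute)
    then show "1 / s \<in> {t. singular_op ?d (lin_field M + scal t * lin_field C)}"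
      using v by (auto simp: singular_op_def)
    show "s = 1 / (1 / s)" by simp
  qed
  then have "UNIV = {s. poly (det W) s = 0} \<union> {0} \<union> (\<lambda>t. 1 / t) ` {t. singular_op ?d (lin_field M + scal t * lin_field C)}"
    by blast
  ultimately have "finite (UNIV :: 'k set)"
    using fin by (metis finite.emptyI finite.insertI finite_Un)
  then show False by (simp add: infinite_UNIV_char_0)
qed

section \<open>Rank-neutral operators\<close>

definition const_exp :: "nat \<Rightarrow> ('n::finite \<Rightarrow>\<^sub>0 nat)" where
  "const_exp e = (\<Sum>i\<in>UNIV. Poly_Mapping.single i e)"

lemma lookup_const_exp [simp]: "Poly_Mapping.lookup (const_exp e) i = e"
  by (simp add: const_exp_def lookup_sum lookup_single when_def)

lemma mon_degree_const_exp [simp]: "mon_degree (const_exp e :: 'n::finite \<Rightarrow>\<^sub>0 nat) = e * CARD('n)"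
  by (simp add: mon_degree_def)

lemma E_diag_mon: "app (E i i) (mon t) = poly_scale (of_nat (Poly_Mapping.lookup t i)) (mon t)"
  by (cases "Poly_Mapping.lookup t i = 0") (simp_all add: E_mon minus_unit_add)

text \<open>The weights are powers of a generic x, made traceless by subtracting their mean. On
  exponents of degree em this amounts to replacing t_i by t_i - e, so the weight of t is the value
  at x of a polynomial that is zero for the central exponent only; x avoids the finitely many roots
  of the others.\<close>

lemma separating_weights:
  obtains h :: "'n::finite \<Rightarrow> 'k::field_char_0" where "(\<Sum>i\<in>UNIV. h i) = 0"
    "\<And>t. t \<in> exps (e * CARD('n)) \<Longrightarrow> t \<noteq> const_exp e \<Longrightarrow>
       (\<Sum>i\<in>UNIV. h i * of_nat (Poly_Mapping.lookup t i)) \<noteq> 0"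
proof -
  let ?T = "exps (e * CARD('n)) - {const_exp e} :: ('n \<Rightarrow>\<^sub>0 nat) set"
  obtain idx :: "'n \<Rightarrow> nat" where idx: "bij_betw idx UNIV {0..<CARD('n)}"
    using ex_bij_betw_finite_nat[OF finite_class.finite_UNIV] by blast
  then have inj: "idx i = idx j \<longleftrightarrow> i = j" for i j
    by (auto simp: bij_betw_def inj_on_def)
  define q :: "('n \<Rightarrow>\<^sub>0 nat) \<Rightarrow> 'k poly"
    where "q t = (\<Sum>i\<in>UNIV. monom (of_nat (Poly_Mapping.lookup t i) - of_nat e) (idx i))" for t
  have "q t \<noteq> 0" if "t \<noteq> const_exp e" for t
  proof
    assume "q t = 0"
    have "Poly_Mapping.lookup t i = e" for i
    proof -
      have "coeff (q t) (idx i) = of_nat (Poly_Mapping.lookup t i) - of_nat e"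
        by (simp add: q_def coeff_sum inj)
      with \<open>q t = 0\<close> show ?thesis by simp
    qed
    then have "t = const_exp e" by (intro poly_mapping_eqI) simp
    with that show False by simp
  qed
  then have "finite (\<Union>t\<in>?T. {x. poly (q t) x = 0})"
    by (intro finite_UN_I finite_Diff finite_exps poly_roots_finite) auto
  then obtain x where x: "x \<notin> (\<Union>t\<in>?T. {x. poly (q t) x = 0})"
    using infinite_UNIV_char_0 by (metis ex_new_if_finite)
  define c where "c = (\<Sum>i\<in>UNIV. x ^ idx i) / of_nat CARD('n)"
  define h where "h i = x ^ idx i - c" for i
  have "(\<Sum>i\<in>UNIV. h i) = 0"
    by (simp add: h_def sum_subtractf c_def)
  moreover have "(\<Sum>i\<in>UNIV. h i * of_nat (Poly_Mapping.lookup t i)) \<noteq> 0"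
    if t: "t \<in> exps (e * CARD('n))" "t \<noteq> const_exp e" for t
  proof -
    have "(\<Sum>i\<in>UNIV. of_nat (Poly_Mapping.lookup t i) :: 'k) = of_nat (e * CARD('n))"
      using t(1) by (simp add: exps_def mon_degree_def flip: of_nat_sum)
    then have "(\<Sum>i\<in>UNIV. c * of_nat (Poly_Mapping.lookup t i)) = (\<Sum>i\<in>UNIV. x ^ idx i * of_nat e)"
      by (simp add: c_def flip: sum_distrib_left sum_distrib_right times_divide_eq_left) simp
    moreover have "(\<Sum>i\<in>UNIV. h i * of_nat (Poly_Mapping.lookup t i)) =
        (\<Sum>i\<in>UNIV. x ^ idx i * of_nat (Poly_Mapping.lookup t i)) - (\<Sum>i\<in>UNIV. c * of_nat (Poly_Mapping.lookup t i))"
      by (simp only: h_def left_diff_distrib sum_subtractf)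
    moreover have "poly (q t) x =
        (\<Sum>i\<in>UNIV. x ^ idx i * of_nat (Poly_Mapping.lookup t i)) - (\<Sum>i\<in>UNIV. x ^ idx i * of_nat e)"
      by (simp only: q_def poly_sum poly_monom sum_subtractf[symmetric] right_diff_distrib[symmetric])
        (simp only: mult.commute)
    ultimately have "(\<Sum>i\<in>UNIV. h i * of_nat (Poly_Mapping.lookup t i)) = poly (q t) x"
      by simp
    with x t show ?thesis by auto
  qed
  ultimately show ?thesis by (rule that)
qed

text \<open>A rank-one projection: \<open>coef_op s * X\<close> keeps only row \<open>s\<close> of
  \<open>X\<close>.\<close>

lift_definition coef_op :: "('n \<Rightarrow>\<^sub>0 nat) \<Rightarrow> ('n, 'k::field) lin_op"
  is "\<lambda>s p. poly_scale (Poly_Mapping.lookup p s) (mon s)"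
  by (simp add: lookup_add lookup_poly_scale poly.scale_left_distrib)

lemma app_coef_op: "app (coef_op s) p = poly_scale (Poly_Mapping.lookup p s) (mon s)"
  by transfer simp

text \<open>
  Otherwise, adding to \<open>H\<close> the row of \<open>X\<close> at the central monomial gives a nonsingular \<open>P\<close>,
  and for some \<open>t \<noteq> 0\<close> scaling that row turns \<open>P + t N\<close> into \<open>H + t X\<close>.
\<close>

lemma rank_neutral:
  fixes X :: "('n::finite, 'k::field_char_0) lin_op"
  assumes X: "X \<in> end_ops (e * CARD('n))"
    and singular_op: "\<And>a t. a \<in> sl_ops (e * CARD('n)) \<Longrightarrow> singular_op (e * CARD('n)) (a + scal t * X)"
  shows "entry X (const_exp e) (const_exp e) = 0"
proof (rule ccontr)
  let ?d = "e * CARD('n)" and ?s = "const_exp e :: 'n \<Rightarrow>\<^sub>0 nat"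
  assume nz: "entry X ?s ?s \<noteq> 0"
  obtain h :: "'n \<Rightarrow> 'k" where h: "(\<Sum>i\<in>UNIV. h i) = 0"
    "\<And>t. t \<in> exps ?d \<Longrightarrow> t \<noteq> ?s \<Longrightarrow> (\<Sum>i\<in>UNIV. h i * of_nat (Poly_Mapping.lookup t i)) \<noteq> 0"
    by (rule separating_weights) blast
  define w where "w t = (\<Sum>i\<in>UNIV. h i * of_nat (Poly_Mapping.lookup t i))" for t :: "'n \<Rightarrow>\<^sub>0 nat"
  have ws: "w ?s = 0"
    by (simp add: w_def h(1) flip: sum_distrib_right)
  define H where "H = (\<Sum>i\<in>UNIV. scal (h i) * E i i) * proj ?d"
  have HA: "H \<in> sl_ops ?d"
    unfolding H_def by (rule sl_ops_diag[OF h(1)])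
  have Hmon: "app H (mon t) = poly_scale (w t) (mon t)" if "t \<in> exps ?d" for t
    using that by (simp add: H_def exps_def proj_mon app_lin_op_sum E_diag_mon w_def poly.scale_sum_left)
  have H: "Poly_Mapping.lookup (app H v) t = w t * Poly_Mapping.lookup v t"
    if "v \<in> hom_polys ?d" "t \<in> exps ?d" for v t
  proof -
    have "app H v = (\<Sum>t\<in>exps ?d. poly_scale (Poly_Mapping.lookup v t) (app H (mon t)))"
      by (subst hom_expand[OF that(1)]) (simp add: app_sum app_scale)
    also have "\<dots> = (\<Sum>t\<in>exps ?d. poly_scale (w t * Poly_Mapping.lookup v t) (mon t))"
      by (intro sum.cong refl) (simp add: Hmon mult.commute)
    finally show ?thesis
      by (simp only: lookup_hom_expand[OF that(2)])
  qed
  have s: "?s \<in> exps ?d" by (simp add: exps_def)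
  define R where "R = coef_op ?s * X"
  have lR: "Poly_Mapping.lookup (app R v) t = (if t = ?s then Poly_Mapping.lookup (app X v) ?s else 0)" for v t
    by (simp add: R_def app_coef_op lookup_poly_scale lookup_single when_def)
  have Rhom: "app R v \<in> hom_polys ?d" for v
    by (simp add: R_def app_coef_op hom_scale mon_in_hom)
  \<comment> \<open>Outside the central row H + R multiplies each coordinate by a nonzero weight, so
    a kernel vector is a multiple of the central monomial; the central row then excludes it.\<close>
  have "\<not> singular_op ?d (H + R)"
  proof
    assume "singular_op ?d (H + R)"
    then obtain v where v: "v \<in> hom_polys ?d" "v \<noteq> 0" "app H v + app R v = 0"
      by (auto simp: singular_op_def)
    have eq: "w t * Poly_Mapping.lookup v t + Poly_Mapping.lookup (app R v) t = 0" if "t \<in> exps ?d" for t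
      using arg_cong[OF v(3), of "\<lambda>p. Poly_Mapping.lookup p t"] H[OF v(1) that] by (simp add: lookup_add)
    have "Poly_Mapping.lookup v t = 0" if "t \<in> exps ?d" "t \<noteq> ?s" for t
      using eq[OF that(1)] that h(2)[OF that] by (simp add: lR w_def)
    then have vs: "v = poly_scale (Poly_Mapping.lookup v ?s) (mon ?s)"
      using v(1) by (intro hom_eqI[of _ ?d])
        (auto simp: hom_scale mon_in_hom lookup_poly_scale lookup_single when_def)
    have "Poly_Mapping.lookup (app X v) ?s = 0"
      using eq[OF s] by (simp add: ws lR)
    then have "Poly_Mapping.lookup v ?s * entry X ?s ?s = 0"
      by (subst (asm) vs) (simp add: app_scale lookup_poly_scale entry_def)
    with nz have "Poly_Mapping.lookup v ?s = 0" by simp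
    with vs v(2) show False by simp
  qed
  then have "finite {t. singular_op ?d (H + R + scal t * (X - R))}"
    using end_ops_app[OF sl_ops_end_ops[OF HA]] end_ops_app[OF X] Rhom
    by (intro finite_singular_perturbation)
      (auto intro: poly.subspace_add[OF subspace_hom_polys] poly.subspace_diff[OF subspace_hom_polys])
  then obtain t where t: "t \<noteq> 0" "\<not> singular_op ?d (H + R + scal t * (X - R))"
    using ex_new_if_finite[OF infinite_UNIV_char_0, of "insert 0 {t. singular_op ?d (H + R + scal t * (X - R))}"]
    by auto
  obtain v where v: "v \<in> hom_polys ?d" "v \<noteq> 0" "app H v + poly_scale t (app X v) = 0"
    using singular_op[OF HA, of t] by (auto simp: singular_op_def)
  \<comment> \<open>The central row of \<open>H\<close> is zero and t is not, so the central
    coefficient of X v vanishes. Hence R kills v, and the two pencils agree on v.\<close>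
  have "Poly_Mapping.lookup (app X v) ?s = 0"
    using arg_cong[OF v(3), of "\<lambda>p. Poly_Mapping.lookup p ?s"] H[OF v(1) s] t(1)
    by (simp add: lookup_add lookup_poly_scale ws)
  then have "app R v = 0"
    by (simp add: R_def app_coef_op)
  then have "app (H + R + scal t * (X - R)) v = 0"
    using v(3) by simp
  with t(2) v show False
    by (auto simp: singular_op_def)
qed

section \<open>Conjugation by exponentials and the module of neutral operators\<close>

definition ad_pow :: "('n, 'k::field) lin_op \<Rightarrow> nat \<Rightarrow> ('n, 'k) lin_op \<Rightarrow> ('n, 'k) lin_op" where
  "ad_pow N n = ((\<lambda>X. N * X - X * N) ^^ n)"

lemma ad_pow_simps [simp]: "ad_pow N 0 X = X" "ad_pow N (Suc n) X = N * ad_pow N n X - ad_pow N n X * N"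
  by (simp_all add: ad_pow_def)

lemma ad_pow_expand:
  "ad_pow N n X = (\<Sum>i\<le>n. scal ((-1) ^ i * of_nat (n choose i)) * (N ^ (n - i) * X * N ^ i))"
proof (induction n)
  case 0
  then show ?case by simp
next
  case (Suc n)
  let ?c = "\<lambda>n i. (-1) ^ i * of_nat (n choose i) :: 'b"
  let ?t = "\<lambda>i. N ^ (Suc n - i) * X * N ^ i"
  have "(\<Sum>i\<le>Suc n. scal (?c (Suc n) i) * ?t i) =
      (\<Sum>i\<le>Suc n. scal (?c n i) * ?t i) +
      (\<Sum>i\<le>Suc n. scal (if i = 0 then 0 else - ?c n (i - 1)) * ?t i)"
    unfolding sum.distrib[symmetric]
  proof (rule sum.cong[OF refl])
    fix i
    have "?c (Suc n) i = ?c n i + (if i = 0 then 0 else - ?c n (i - 1))"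
      by (cases i) (simp_all add: algebra_simps)
    then show "scal (?c (Suc n) i) * ?t i =
        scal (?c n i) * ?t i + scal (if i = 0 then 0 else - ?c n (i - 1)) * ?t i"
      by (simp only: scal_add distrib_right)
  qed
  also have "(\<Sum>i\<le>Suc n. scal (?c n i) * ?t i) = (\<Sum>i\<le>n. scal (?c n i) * ?t i)"
    by (simp add: binomial_eq_0)
  also have "\<dots> = N * ad_pow N n X"
    unfolding Suc.IH sum_distrib_left
  proof (rule sum.cong[OF refl])
    fix i assume "i \<in> {..n}"
    then have "N ^ (Suc n - i) = N * N ^ (n - i)" by (simp add: Suc_diff_le)
    then show "scal (?c n i) * ?t i = N * (scal (?c n i) * (N ^ (n - i) * X * N ^ i))"
      by (simp add: scal_left_commute mult.assoc)
  qed
  also have "(\<Sum>i\<le>Suc n. scal (if i = 0 then 0 else - ?c n (i - 1)) * ?t i) = - (ad_pow N n X * N)"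
    unfolding Suc.IH sum_distrib_right sum_negf[symmetric]
    by (subst sum.atMost_Suc_shift) (simp add: scal_uminus mult.assoc power_commutes)
  finally show ?case by simp
qed

definition exp_op :: "('n, 'k::field_char_0) lin_op \<Rightarrow> nat \<Rightarrow> 'k \<Rightarrow> ('n, 'k) lin_op" where
  "exp_op N r t = (\<Sum>n<r. scal (t ^ n / fact n) * N ^ n)"

text \<open>The identity exp(tN) X exp(-tN) = exp(t ad N) X with truncated series. The triangle of
  index sums below \<open>2 * r\<close> contains the square of indices below r; its other terms
  vanish because one exponent is at least r.\<close>

lemma exp_op_conj:
  fixes N :: "('n, 'k::field_char_0) lin_op"
  assumes "N ^ r = 0"
  shows "exp_op N r t * X * exp_op N r (- t) = (\<Sum>n<2 * r. scal (t ^ n / fact n) * ad_pow N n X)"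
proof -
  define F where "F j i = scal (t ^ i / fact i * ((- t) ^ j / fact j)) * (N ^ i * X * N ^ j)" for i j
  have pow: "N ^ i = 0" if "r \<le> i" for i
    using assms that by (metis le_add_diff_inverse power_add mult_zero_left)
  have F0: "F j i = 0" if "r \<le> j \<or> r \<le> i" for i j
    using that pow by (auto simp: F_def)
  have "exp_op N r t * X * exp_op N r (- t) = (\<Sum>j<r. \<Sum>i<r. F j i)"
    unfolding exp_op_def sum_distrib_left sum_distrib_right F_def
  proof (intro sum.cong refl)
    fix i j
    show "scal (t ^ i / fact i) * N ^ i * X * (scal ((- t) ^ j / fact j) * N ^ j) =
        scal (t ^ i / fact i * ((- t) ^ j / fact j)) * (N ^ i * X * N ^ j)"
      by (rule lin_op_eqI) (simp add: app_scale mult.commute)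
  qed
  also have "\<dots> = (\<Sum>(j, i)\<in>{..<r} \<times> {..<r}. F j i)"
    by (simp add: sum.cartesian_product)
  also have "\<dots> = (\<Sum>(j, i)\<in>{(j, i). j + i < 2 * r}. F j i)"
  proof (rule sum.mono_neutral_left)
    have "{(j, i). j + i < 2 * r} \<subseteq> {..<2 * r} \<times> {..<2 * r}" by auto
    then show "finite {(j, i). j + i < 2 * r}" by (rule finite_subset) auto
    show "\<forall>x\<in>{(j, i). j + i < 2 * r} - {..<r} \<times> {..<r}. (case x of (j, i) \<Rightarrow> F j i) = 0"
      by (auto intro!: F0 simp: not_less)
  qed auto
  also have "\<dots> = (\<Sum>n<2 * r. \<Sum>j\<le>n. F j (n - j))"
    by (rule sum.triangle_reindex)
  also have "\<dots> = (\<Sum>n<2 * r. scal (t ^ n / fact n) * ad_pow N n X)"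
    unfolding ad_pow_expand sum_distrib_left
  proof (intro sum.cong refl)
    fix n j :: nat assume "j \<in> {..n}"
    then have j: "j \<le> n" by simp
    have "t ^ n = t ^ j * t ^ (n - j)" using j by (simp flip: power_add)
    then have "t ^ (n - j) / fact (n - j) * ((- t) ^ j / fact j) =
        t ^ n / fact n * ((- 1) ^ j * of_nat (n choose j))"
      by (simp add: binomial_fact[OF j] power_minus[of t] mult_ac)
    then show "F j (n - j) = scal (t ^ n / fact n) *
        (scal ((- 1) ^ j * of_nat (n choose j)) * (N ^ (n - j) * X * N ^ j))"
      by (simp only: F_def scal_mult mult.assoc)
  qed
  finally show ?thesis .
qed

text \<open>The case X = 1 of the conjugation formula, in which all proper commutators
  vanish.\<close>

lemma exp_op_inverse:
  fixes N :: "('n, 'k::field_char_0) lin_op"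
  assumes "N ^ r = 0"
  shows "exp_op N r t * exp_op N r (- t) = 1"
proof -
  have "r \<noteq> 0" using assms by (cases r) auto
  have "ad_pow N n 1 = (if n = 0 then 1 else 0)" for n
    by (induction n) auto
  then have "(\<Sum>n<2 * r. scal (t ^ n / fact n) * ad_pow N n 1) = 1"
    using \<open>r \<noteq> 0\<close> by (simp add: if_distrib[of "\<lambda>X. _ * X"] cong: if_cong)
  then show ?thesis
    using exp_op_conj[OF assms, of t 1] by simp
qed

text \<open>An operator is carried together with its inverse. The direction g a g' matches the use:
  a + t g' X g is conjugate to g a g' + t X.\<close>

definition normalizer_pairs :: "nat \<Rightarrow> (('n::finite, 'k::field) lin_op \<times> ('n, 'k) lin_op) set" where
  "normalizer_pairs d = {(g, g'). g * g' = 1 \<and> g' * g = 1 \<and> g * proj d = proj d * g \<and>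
     g' * proj d = proj d * g' \<and> (\<forall>a\<in>sl_ops d. g * a * g' \<in> sl_ops d)}"

lemma normalizer_pairs_one: "(1, 1) \<in> normalizer_pairs d"
  by (simp add: normalizer_pairs_def)

lemma normalizer_pairs_mult:
  assumes "(g, g') \<in> normalizer_pairs d" "(k, k') \<in> normalizer_pairs d"
  shows "(g * k, k' * g') \<in> normalizer_pairs d"
proof -
  have "g * k * (k' * g') = g * (k * k') * g'" "k' * g' * (g * k) = k' * (g' * g) * k"
    "g * k * a * (k' * g') = g * (k * a * k') * g'" for a
    by (simp_all only: mult.assoc)
  moreover have "g * k * proj d = proj d * (g * k)" "k' * g' * proj d = proj d * (k' * g')"
    using assms unfolding normalizer_pairs_def by (auto simp: mult.assoc) (auto simp flip: mult.assoc)
  ultimately show ?thesis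
    using assms by (simp add: normalizer_pairs_def)
qed

text \<open>The condition is linear in X, hence gives a subspace, and quantifying over all pairs
  makes it stable under conjugation by them.\<close>

definition neutral_ops :: "nat \<Rightarrow> nat \<Rightarrow> ('n::finite, 'k::field) lin_op set" where
  "neutral_ops d e = {X \<in> end_ops d. \<forall>g g'. (g, g') \<in> normalizer_pairs d \<longrightarrow> entry (g' * X * g) (const_exp e) (const_exp e) = 0}"

lemma neutral_ops_end_ops: "X \<in> neutral_ops d e \<Longrightarrow> X \<in> end_ops d"
  by (simp add: neutral_ops_def)

lemma neutral_ops_entry: "X \<in> neutral_ops d e \<Longrightarrow> entry X (const_exp e) (const_exp e) = 0"
  using normalizer_pairs_one[of d] by (force simp: neutral_ops_def)

lemma neutral_ops_subspace: "lin_op.subspace (neutral_ops d e)"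
  using end_ops_subspace[of d]
  by (auto simp: lin_op.subspace_def neutral_ops_def distrib_left distrib_right scal_left_commute mult.assoc)

text \<open>The hypothesis is inherited by conjugates, since g' maps a kernel vector of g a g' + t X
  to one of a + t g' X g. So \<open>rank_neutral\<close> applies to each of them.\<close>

lemma neutral_ops_I:
  fixes X :: "('n::finite, 'k::field_char_0) lin_op"
  assumes X: "X \<in> end_ops (e * CARD('n))"
    and singular_op: "\<And>a t. a \<in> sl_ops (e * CARD('n)) \<Longrightarrow> singular_op (e * CARD('n)) (a + scal t * X)"
  shows "X \<in> neutral_ops (e * CARD('n)) e"
proof -
  let ?d = "e * CARD('n)"
  have "entry (g' * X * g) (const_exp e) (const_exp e) = 0" if "(g, g') \<in> normalizer_pairs ?d" for g g'
  proof (rule rank_neutral)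
    have g: "g * g' = 1" "g' * g = 1" "g * proj ?d = proj ?d * g" "g' * proj ?d = proj ?d * g'"
      "\<And>a. a \<in> sl_ops ?d \<Longrightarrow> g * a * g' \<in> sl_ops ?d"
      using that by (auto simp: normalizer_pairs_def)
    have "proj ?d * (g' * X * g) = g' * (proj ?d * X) * g" "g' * X * g * proj ?d = g' * (X * proj ?d) * g"
      by (simp_all only: mult.assoc g(3)) (simp only: g(4) flip: mult.assoc)
    with X show "g' * X * g \<in> end_ops ?d"
      by (simp add: end_ops_def)
    fix a :: "('n, 'k) lin_op" and t
    assume a: "a \<in> sl_ops ?d"
    obtain v where v: "v \<in> hom_polys ?d" "v \<noteq> 0" "app (g * a * g' + scal t * X) v = 0"
      using singular_op[OF g(5)[OF a], of t] by (auto simp: singular_op_def)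
    have gg: "app g (app g' p) = p" "app g' (app g p) = p" for p
      using arg_cong[OF g(1), of "\<lambda>X. app X p"] arg_cong[OF g(2), of "\<lambda>X. app X p"] by simp_all
    have "app (a + scal t * (g' * X * g)) (app g' v) = app g' (app (g * a * g' + scal t * X) v)"
      by (simp add: gg app_add app_scale)
    also have "\<dots> = 0" by (simp only: v(3) app_zero)
    finally have "app (a + scal t * (g' * X * g)) (app g' v) = 0" .
    moreover have "app g' v \<in> hom_polys ?d"
      using arg_cong[OF g(4), of "\<lambda>X. app X v"] v(1) proj_in_hom[of ?d "app g' v"] by (simp add: proj_hom)
    moreover have "app g' v \<noteq> 0"
      using gg(1)[of v] v(2) by auto
    ultimately show "singular_op ?d (a + scal t * (g' * X * g))"
      by (auto simp: singular_op_def)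
  qed
  with X show ?thesis
    by (auto simp: neutral_ops_def)
qed

lemma E_power_zero:
  assumes "a \<noteq> b" "Poly_Mapping.lookup t b < n"
  shows "app (E a b ^ n) (mon t) = 0"
  using assms(2)
proof (induction n arbitrary: t)
  case (Suc n)
  show ?case
  proof (rule exp_cases[of t b])
    fix u assume "t = u + unit_exp b"
    moreover have "Poly_Mapping.lookup (u + unit_exp a) b < n"
      using assms(1) Suc.prems calculation by (simp add: lookup_add lookup_single)
    ultimately show ?thesis
      using Suc.IH[of "u + unit_exp a"] by (simp add: power_Suc2 E_mon_add app_scale del: power_Suc)
  qed (simp add: power_Suc2 E_mon_zero del: power_Suc)
qed simp

lemma E_proj_power: "(E a b * proj d :: ('n::finite, 'k::field) lin_op) ^ Suc n = E a b ^ Suc n * proj d"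
proof (induction n)
  case (Suc n)
  have "(E a b * proj d :: ('n, 'k) lin_op) ^ Suc (Suc n) = E a b * proj d * (E a b * proj d) ^ Suc n"
    by simp
  also have "\<dots> = E a b * (proj d * E a b ^ Suc n) * proj d"
    unfolding Suc.IH by (simp only: mult.assoc)
  also have "proj d * E a b ^ k = (E a b ^ k * proj d :: ('n, 'k) lin_op)" for k
    by (induction k) (simp_all add: proj_E_left mult.assoc)
  finally show ?case by (simp add: mult.assoc)
qed simp

lemma lookup_le_degree: "Poly_Mapping.lookup t i \<le> mon_degree t"
  using member_le_sum[of i UNIV "Poly_Mapping.lookup t"] by (simp add: mon_degree_def)

text \<open>Each application consumes one x_b, and at most d of them are available.\<close>

lemma E_proj_nilpotent:
  assumes "a \<noteq> b"
  shows "(E a b * proj d) ^ Suc d = 0"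
proof (rule lin_op_eqI)
  fix t
  show "app ((E a b * proj d) ^ Suc d) (mon t) = app 0 (mon t)"
    using lookup_le_degree[of t b]
    by (simp add: E_proj_power proj_mon E_power_zero[OF assms] del: power_Suc)
qed

lemma ad_pow_sl_ops:
  assumes "X \<in> sl_ops d"
  shows "ad_pow (E a b * proj d) n X \<in> sl_ops d"
proof (induction n)
  case (Suc n)
  then show ?case
    using end_ops_E_commutator_proj[OF sl_ops_end_ops[OF Suc], of a b] sl_ops_E_commutator[OF Suc, of a b] by simp
qed (simp add: assms)

lemma exp_normalizer:
  fixes t :: "'k::field_char_0"
  assumes "a \<noteq> (b :: 'n::finite)"
  shows "(exp_op (E a b * proj d) (Suc d) t, exp_op (E a b * proj d) (Suc d) (- t)) \<in> normalizer_pairs d"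
proof -
  let ?N = "E a b * proj d :: ('n, 'k) lin_op"
  have N: "?N ^ Suc d = 0" by (rule E_proj_nilpotent[OF assms])
  have comm: "?N ^ n * proj d = proj d * ?N ^ n" for n
  proof (induction n)
    case (Suc n)
    have "?N ^ Suc n * proj d = ?N * (proj d * ?N ^ n)"
      by (simp add: Suc mult.assoc)
    also have "\<dots> = proj d * (?N * ?N ^ n)"
      by (simp add: mult.assoc proj_E_left)
    finally show ?case by simp
  qed simp
  have "exp_op ?N (Suc d) s * proj d = proj d * exp_op ?N (Suc d) s" for s
    unfolding exp_op_def sum_distrib_left sum_distrib_right
    by (intro sum.cong refl) (simp only: mult.assoc comm scal_left_commute)
  moreover have "exp_op ?N (Suc d) t * X * exp_op ?N (Suc d) (- t) \<in> sl_ops d" if "X \<in> sl_ops d" for X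
    unfolding exp_op_conj[OF N]
    by (intro lin_op.subspace_sum[OF sl_ops_subspace] lin_op.subspace_scale[OF sl_ops_subspace] ad_pow_sl_ops that)
  ultimately show ?thesis
    using exp_op_inverse[OF N, of t] exp_op_inverse[OF N, of "- t"] by (simp add: normalizer_pairs_def)
qed

lemma poly_fun_zero:
  fixes c :: "nat \<Rightarrow> 'k::field_char_0"
  assumes "\<And>t. (\<Sum>n<r. c n * t ^ n) = 0" "n < r"
  shows "c n = 0"
proof -
  define p where "p = (\<Sum>n<r. monom (c n) n)"
  have "poly p t = 0" for t
    using assms(1)[of t] by (simp add: p_def poly_sum poly_monom)
  then have "p = 0" using poly_all_0_iff_0 by blast
  moreover have "coeff p n = c n"
    using assms(2) by (simp add: p_def coeff_sum)
  ultimately show ?thesis by simp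
qed

text \<open>
  The conjugate of \<open>X\<close> by \<open>exp (t N)\<close> is a polynomial in \<open>t\<close>, and the commutator with \<open>N\<close> is its
  linear coefficient.
\<close>

lemma neutral_ops_E_commutator:
  fixes X :: "('n::finite, 'k::field_char_0) lin_op"
  assumes "X \<in> neutral_ops d e" "a \<noteq> b"
  shows "E a b * X - X * E a b \<in> neutral_ops d e"
proof -
  let ?N = "E a b * proj d :: ('n, 'k) lin_op" and ?s = "const_exp e :: 'n \<Rightarrow>\<^sub>0 nat"
  have N: "?N ^ Suc d = 0" by (rule E_proj_nilpotent[OF assms(2)])
  have X: "X \<in> end_ops d" using assms(1) by (rule neutral_ops_end_ops)
  have "entry (g' * (E a b * X - X * E a b) * g) ?s ?s = 0" if g: "(g, g') \<in> normalizer_pairs d" for g g'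
  proof -
    define c where "c n = entry (g' * ad_pow ?N n X * g) ?s ?s / fact n" for n
    have "(\<Sum>n<2 * Suc d. c n * t ^ n) = 0" for t
    proof -
      \<comment> \<open>The exponential is composed with the given g because the entry has to vanish
        for every conjugate of the commutator.\<close>
      have "(exp_op ?N (Suc d) (- t) * g, g' * exp_op ?N (Suc d) t) \<in> normalizer_pairs d"
        using normalizer_pairs_mult[OF exp_normalizer[OF assms(2), of d "- t"] g] by simp
      then have "entry (g' * exp_op ?N (Suc d) t * X * (exp_op ?N (Suc d) (- t) * g)) ?s ?s = 0"
        using assms(1) by (auto simp: neutral_ops_def)
      also have "g' * exp_op ?N (Suc d) t * X * (exp_op ?N (Suc d) (- t) * g) =
          g' * (exp_op ?N (Suc d) t * X * exp_op ?N (Suc d) (- t)) * g"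
        by (simp only: mult.assoc)
      also have "\<dots> = (\<Sum>n<2 * Suc d. scal (t ^ n / fact n) * (g' * ad_pow ?N n X * g))"
        unfolding exp_op_conj[OF N] sum_distrib_left sum_distrib_right
        by (intro sum.cong refl) (simp only: mult.assoc scal_left_commute)
      finally show ?thesis
        by (simp add: entry_sum c_def mult.commute)
    qed
    then have "c 1 = 0" by (rule poly_fun_zero) simp
    then show ?thesis
      using end_ops_E_commutator_proj[OF X, of a b] by (simp add: c_def One_nat_def)
  qed
  with end_ops_E_commutator[OF X] show ?thesis
    by (auto simp: neutral_ops_def)
qed

section \<open>Extremal operators\<close>

lemma entry_E_left: "entry (E i j * X) (u + unit_exp i) t = of_nat (Poly_Mapping.lookup u j + 1) * entry X (u + unit_exp j) t"
  by (simp add: entry_def app_E lookup_Var_mult lookup_add lookup_pdiff)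

lemma entry_E_left_zero: "Poly_Mapping.lookup s i = 0 \<Longrightarrow> entry (E i j * X) s t = 0"
  by (simp add: entry_def app_E lookup_Var_mult)

lemma entry_E_right: "entry (X * E i j) s (v + unit_exp j) = of_nat (Poly_Mapping.lookup v j + 1) * entry X s (v + unit_exp i)"
  by (simp add: entry_def E_mon_add app_scale lookup_poly_scale)

lemma entry_E_right_zero: "Poly_Mapping.lookup t j = 0 \<Longrightarrow> entry (X * E i j) s t = 0"
  by (simp add: entry_def E_mon_zero)

lemma entry_E_diag:
  "entry (E i i * X) s t = of_nat (Poly_Mapping.lookup s i) * entry X s t"
  "entry (X * E i i) s t = of_nat (Poly_Mapping.lookup t i) * entry X s t"
proof -
  show "entry (E i i * X) s t = of_nat (Poly_Mapping.lookup s i) * entry X s t"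
    by (rule exp_cases[of s i]) (simp_all add: entry_E_left entry_E_left_zero lookup_add)
qed (simp add: entry_def E_diag_mon app_scale lookup_poly_scale)

text \<open>Adding two elements of the image of sl gives a singular operator again. This allows a
  neutral operator to be corrected by such elements.\<close>

lemma sl_ops_neutral_ops:
  fixes X :: "('n::finite, 'k::field_char_0) lin_op"
  assumes "X \<in> sl_ops (e * CARD('n))"
  shows "X \<in> neutral_ops (e * CARD('n)) e"
proof (rule neutral_ops_I)
  let ?d = "e * CARD('n)"
  fix a :: "('n, 'k) lin_op" and t
  assume "a \<in> sl_ops ?d"
  then have "a + scal t * X \<in> sl_ops ?d"
    using assms sl_ops_subspace[of ?d] by (auto simp: lin_op.subspace_def)
  then obtain M where M: "a + scal t * X = lin_field M * proj ?d" "(\<Sum>i\<in>UNIV. M i i) = 0"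
    by (auto simp: sl_ops_def)
  then show "singular_op ?d (a + scal t * X)"
    using singular_lin_field[where M = M and e = e, OF M(2)] by (auto simp: singular_op_def M(1) proj_hom)
qed (rule sl_ops_end_ops[OF assms])

section \<open>The orthogonal complement for the trace form\<close>

definition ortho_ops :: "nat \<Rightarrow> nat \<Rightarrow> ('n::finite, 'k::field) lin_op set" where
  "ortho_ops d e = {X \<in> neutral_ops d e. \<forall>a\<in>sl_ops d. op_trace d (X * a) = 0}"

lemma ortho_ops_subspace: "lin_op.subspace (ortho_ops d e)"
  using neutral_ops_subspace[of d e]
  by (auto simp: lin_op.subspace_def ortho_ops_def distrib_right mult.assoc)

lemma ortho_ops_end_ops: "X \<in> ortho_ops d e \<Longrightarrow> X \<in> end_ops d"
  by (auto simp: ortho_ops_def dest: neutral_ops_end_ops)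

text \<open>Invariance of the trace form: tr([N, X] c) = - tr(X [N, c]), and [N, c] lies in the
  image of sl again.\<close>

lemma ortho_ops_E_commutator:
  fixes X :: "('n::finite, 'k::field_char_0) lin_op"
  assumes X: "X \<in> ortho_ops d e" and "a \<noteq> b"
  shows "E a b * X - X * E a b \<in> ortho_ops d e"
proof -
  let ?N = "E a b * proj d :: ('n, 'k) lin_op"
  have "op_trace d ((E a b * X - X * E a b) * c) = 0" if c: "c \<in> sl_ops d" for c
  proof -
    have "(E a b * X - X * E a b) * c = ?N * (X * c) - X * (?N * c)"
      by (simp only: end_ops_E_commutator_proj[OF ortho_ops_end_ops[OF X], symmetric] left_diff_distrib mult.assoc)
    then have "op_trace d ((E a b * X - X * E a b) * c) = op_trace d (X * c * ?N) - op_trace d (X * (?N * c))"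
      using op_trace_commute[OF E_proj_end_ops end_ops_mult[OF ortho_ops_end_ops[OF X] sl_ops_end_ops[OF c]], of a b] by simp
    also have "\<dots> = - op_trace d (X * (?N * c - c * ?N))"
      by (simp add: right_diff_distrib mult.assoc)
    also have "?N * c - c * ?N = E a b * c - c * E a b"
      by (rule end_ops_E_commutator_proj[OF sl_ops_end_ops[OF c]])
    also have "op_trace d (X * (E a b * c - c * E a b)) = 0"
      using X sl_ops_E_commutator[OF c, of a b] by (simp add: ortho_ops_def)
    finally show ?thesis by simp
  qed
  then show ?thesis
    using neutral_ops_E_commutator[of X d e a b] assms by (simp add: ortho_ops_def)
qed

text \<open>Truncated exponentials do not reach diagonal operators, which are not nilpotent. But
  E_aa - E_bb is the bracket of two nilpotent ones, and the Jacobi identity expresses its action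
  through theirs.\<close>

lemma ortho_ops_diag_commutator:
  fixes X :: "('n::finite, 'k::field_char_0) lin_op"
  assumes X: "X \<in> ortho_ops d e"
  shows "(E a a - E b b) * X - X * (E a a - E b b) \<in> ortho_ops d e"
proof (cases "a = b")
  case True
  then show ?thesis using ortho_ops_subspace[of d e] by (auto simp: lin_op.subspace_def)
next
  case False
  have H: "E a a - E b b = E a b * E b a - (E b a * E a b :: ('n, 'k) lin_op)"
    by (simp add: E_commutator)
  have "(E a a - E b b) * X - X * (E a a - E b b) =
      (E a b * (E b a * X - X * E b a) - (E b a * X - X * E b a) * E a b) -
      (E b a * (E a b * X - X * E a b) - (E a b * X - X * E a b) * E b a)"
    unfolding H by (simp add: algebra_simps)
  also have "\<dots> \<in> ortho_ops d e"
    using False by (intro lin_op.subspace_diff[OF ortho_ops_subspace] ortho_ops_E_commutator X) auto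
  finally show ?thesis .
qed

text \<open>Finitely many test operators suffice: the reference index \<open>k\<close> corrects the
  diagonal ones, and in a traceless combination the corrections cancel.\<close>

lemma sl_ops_orthogonal_I:
  fixes Y :: "('n::finite, 'k::field) lin_op"
  assumes "\<And>i j. op_trace d (Y * (E j i * proj d - (if i = j then E k k * proj d else 0))) = 0" and "a \<in> sl_ops d"
  shows "op_trace d (Y * a) = 0"
proof -
  obtain M where M: "a = lin_field M * proj d" "(\<Sum>i\<in>UNIV. M i i) = 0"
    using assms(2) by (auto simp: sl_ops_def)
  have "op_trace d (Y * a) = (\<Sum>i\<in>UNIV. \<Sum>j\<in>UNIV. M i j * op_trace d (Y * (E j i * proj d)))"
    by (simp add: M(1) lin_field_def sum_distrib_left sum_distrib_right op_trace_sum scal_left_commute mult.assoc)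
  also have "\<dots> = (\<Sum>i\<in>UNIV. \<Sum>j\<in>UNIV. if i = j then M i i * op_trace d (Y * (E k k * proj d)) else 0)"
  proof (intro sum.cong refl)
    fix i j
    show "M i j * op_trace d (Y * (E j i * proj d)) = (if i = j then M i i * op_trace d (Y * (E k k * proj d)) else 0)"
      using assms(1)[of j i] by (auto simp: right_diff_distrib)
  qed
  also have "\<dots> = 0"
    using M(2) by (simp flip: sum_distrib_right)
  finally show ?thesis .
qed

lemma unit_exp_eq_iff [simp]: "unit_exp i = unit_exp j \<longleftrightarrow> i = j"
  by (metis lookup_single_eq lookup_single_not_eq zero_neq_one)

lemma entry_E_extremal:
  assumes "0 < d"
  shows "entry (E b a * proj d) (Poly_Mapping.single i (d - 1) + unit_exp j) (Poly_Mapping.single i d) =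
    (if a = i \<and> b = j then of_nat d else (0 :: 'k::field))"
proof -
  have s: "Poly_Mapping.single i d = Poly_Mapping.single i (d - 1) + unit_exp i"
    using assms by (simp add: single_add[symmetric])
  show ?thesis
  proof (cases "a = i")
    case True
    then show ?thesis
      using assms by (subst s)
        (auto simp: entry_def proj_mon mon_degree_add E_mon_add lookup_poly_scale lookup_single when_def of_nat_diff)
  next
    case False
    then show ?thesis
      by (simp add: entry_def proj_mon E_mon_zero lookup_single)
  qed
qed

text \<open>The m^2 operators X and \<open>B p\<close> face m^2 - 1 orthogonality conditions, so
  some nontrivial combination meets them all. It is nonzero because the \<open>B p\<close> with p in
  \<open>?J\<close> are independent and X lies outside the image of sl. The index (k, k) is left out
  since \<open>B (k, k)\<close> is 0.\<close>

lemma ortho_ops_nontrivial: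
  fixes X :: "('n::finite, 'k::field_char_0) lin_op"
  assumes "X \<in> neutral_ops (e * CARD('n)) e" "X \<notin> sl_ops (e * CARD('n))" "e > 0"
  obtains Y :: "('n, 'k) lin_op" where "Y \<in> ortho_ops (e * CARD('n)) e" "Y \<noteq> 0"
proof -
  let ?d = "e * CARD('n)"
  have d: "0 < ?d" using assms(3) by simp
  fix k :: 'n
  let ?J = "UNIV - {(k, k)} :: ('n \<times> 'n) set"
  define B :: "'n \<times> 'n \<Rightarrow> ('n, 'k) lin_op"
    where "B = (\<lambda>(i, j). E j i * proj ?d - (if i = j then E k k * proj ?d else 0))"
  define f where "f = (\<lambda>s. case s of None \<Rightarrow> X | Some p \<Rightarrow> B p)"
  let ?S = "insert None (Some ` ?J)"
  have BA: "B p \<in> sl_ops ?d" for p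
  proof (cases p)
    case (Pair i j)
    show ?thesis
    proof (cases "i = j")
      case True
      have "(\<Sum>l\<in>UNIV. (if l = i then 1 else 0) - (if l = k then 1 else 0)) = (0 :: 'k)"
        by (simp add: sum_subtractf)
      from sl_ops_diag[OF this, of ?d] have "(E i i - E k k) * proj ?d \<in> (sl_ops ?d :: ('n, 'k) lin_op set)"
        by (simp add: scal_diff left_diff_distrib sum_subtractf if_distrib[of scal] if_distrib[of "\<lambda>X. X * _"] cong: if_cong)
      then show ?thesis using True Pair by (simp add: B_def left_diff_distrib)
    next
      case False
      then show ?thesis using Pair sl_ops_E[of j i ?d] by (simp add: B_def)
    qed
  qed
  have "card ?S = Suc (card ?J)"
    by (simp add: card_image)
  then obtain c where c: "\<exists>s\<in>?S. c s \<noteq> 0" "\<forall>p\<in>?J. (\<Sum>s\<in>?S. c s * op_trace ?d (f s * B p)) = 0"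
    using underdetermined_system[of ?J ?S "\<lambda>p s. op_trace ?d (f s * B p)"] by auto
  define Z where "Z = (\<Sum>p\<in>?J. scal (c (Some p)) * B p)"
  define Y where "Y = (\<Sum>s\<in>?S. scal (c s) * f s)"
  have YZ: "Y = scal (c None) * X + Z"
    by (simp add: Y_def Z_def f_def sum.reindex)
  have ZA: "Z \<in> sl_ops ?d"
    unfolding Z_def by (intro lin_op.subspace_sum[OF sl_ops_subspace] lin_op.subspace_scale[OF sl_ops_subspace] BA)
  have "Y \<noteq> 0"
  proof
    assume Y0: "Y = 0"
    have c0: "c None = 0"
    proof (rule ccontr)
      assume nz: "c None \<noteq> 0"
      have "scal (c None) * X = - Z"
        using Y0 YZ by (simp add: eq_neg_iff_add_eq_0)
      then have "scal (1 / c None) * (scal (c None) * X) = scal (1 / c None) * - Z" by simp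
      then have "X = scal (1 / c None) * - Z" using nz by simp
      also have "\<dots> \<in> sl_ops ?d"
        by (intro lin_op.subspace_scale[OF sl_ops_subspace] lin_op.subspace_neg[OF sl_ops_subspace] ZA)
      finally show False using assms(2) by simp
    qed
    have "c (Some (i, j)) = 0" if "(i, j) \<noteq> (k, k)" for i j
    proof -
      \<comment> \<open>At the coefficient of x_i^(d-1) x_j in the image of x_i^d, only
        \<open>B (i, j)\<close> among the \<open>B p\<close> has a nonzero entry.\<close>
      let ?s = "Poly_Mapping.single i (?d - 1) + unit_exp j" and ?t = "Poly_Mapping.single i ?d"
      have "0 = entry Z ?s ?t" using Y0 YZ c0 by simp
      also have "\<dots> = (\<Sum>p\<in>?J. c (Some p) * entry (B p) ?s ?t)"
        by (simp add: Z_def entry_sum)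
      also have "\<dots> = (\<Sum>p\<in>?J. if p = (i, j) then c (Some (i, j)) * of_nat ?d else 0)"
      proof (intro sum.cong refl)
        fix p
        show "c (Some p) * entry (B p) ?s ?t = (if p = (i, j) then c (Some (i, j)) * of_nat ?d else 0)"
          using that by (cases p) (auto simp: B_def entry_E_extremal[OF d])
      qed
      also have "\<dots> = c (Some (i, j)) * of_nat ?d"
        using that by simp
      finally show ?thesis using d by simp
    qed
    with c0 c(1) show False by auto
  qed
  moreover have "Y \<in> ortho_ops ?d e"
  proof -
    have "Y \<in> neutral_ops ?d e"
      unfolding YZ by (intro lin_op.subspace_add[OF neutral_ops_subspace] lin_op.subspace_scale[OF neutral_ops_subspace] assms(1) sl_ops_neutral_ops ZA)
    moreover have YB: "op_trace ?d (Y * B p) = 0" for p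
    proof (cases "p = (k, k)")
      case False
      then have "(\<Sum>s\<in>?S. c s * op_trace ?d (f s * B p)) = 0" using c(2) by simp
      then show ?thesis unfolding Y_def sum_distrib_right op_trace_sum by (simp only: mult.assoc op_trace_simps)
    qed (simp add: B_def)
    have "op_trace ?d (Y * a) = 0" if "a \<in> sl_ops ?d" for a
      by (rule sl_ops_orthogonal_I[OF _ that, of Y k]) (use YB[of "(_, _)"] in \<open>simp add: B_def\<close>)
    ultimately show ?thesis by (simp add: ortho_ops_def)
  qed
  ultimately show ?thesis by (rule that[rotated])
qed

text \<open>Take a nonzero entry (s, t) with the exponent of x_k in t maximal. If s contained
  another variable x_j, trading it for x_k would force, through commutation with
  \<open>E k j\<close>, the same trade in t, against maximality. So s is x_k^d.\<close>

lemma centralizer_row: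
  fixes X :: "('n::finite, 'k::field_char_0) lin_op"
  assumes X: "X \<in> end_ops d" and comm: "\<And>j. j \<noteq> k \<Longrightarrow> E k j * X = X * E k j"
    and row: "\<And>t. entry X (Poly_Mapping.single k d) t = 0"
  shows "X = 0"
proof (rule ccontr)
  assume "X \<noteq> 0"
  then obtain s0 t0 where "entry X s0 t0 \<noteq> 0"
    using entry_eqI[of X 0] by auto
  then obtain p where p: "entry X (fst p) (snd p) \<noteq> 0"
    "\<And>q. entry X (fst q) (snd q) \<noteq> 0 \<Longrightarrow> d - Poly_Mapping.lookup (snd p) k \<le> d - Poly_Mapping.lookup (snd q) k"
    using ex_has_least_nat[of "\<lambda>p. entry X (fst p) (snd p) \<noteq> 0" "(s0, t0)" "\<lambda>p. d - Poly_Mapping.lookup (snd p) k"]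
    by auto
  obtain s t where st: "p = (s, t)" by (cases p)
  have nz: "entry X s t \<noteq> 0" using p(1) st by simp
  have deg: "mon_degree s = d" "mon_degree t = d" using end_ops_entry[OF X nz] by auto
  have max: "Poly_Mapping.lookup t' k \<le> Poly_Mapping.lookup t k" if "entry X s' t' \<noteq> 0" for s' t'
    using p(2)[of "(s', t')"] that st lookup_le_degree[of t' k] lookup_le_degree[of t k] deg end_ops_entry[OF X that]
    by auto
  have "Poly_Mapping.lookup s j = 0" if "j \<noteq> k" for j
  proof (rule ccontr)
    assume "Poly_Mapping.lookup s j \<noteq> 0"
    then obtain u where u: "s = u + unit_exp j" by (metis exp_cases)
    have "entry (X * E k j) (u + unit_exp k) t \<noteq> 0"
      using nz unfolding comm[OF that, symmetric] by (simp add: entry_E_left u del: of_nat_add of_nat_Suc)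
    moreover from this obtain v where v: "t = v + unit_exp j" by (metis exp_cases entry_E_right_zero)
    ultimately have "entry X (u + unit_exp k) (v + unit_exp k) \<noteq> 0"
      by (simp add: entry_E_right)
    from max[OF this] that v show False by (simp add: lookup_add lookup_single)
  qed
  then have "s = Poly_Mapping.single k (Poly_Mapping.lookup s k)"
    by (intro poly_mapping_eqI) (auto simp: lookup_single when_def)
  then have "s = Poly_Mapping.single k d"
    using deg(1) by (metis mon_degree_single)
  with nz row show False by simp
qed

text \<open>By \<open>centralizer_row\<close> the row at x_k^d determines P, and \<open>t0\<close>
  records which product of operators \<open>E k j\<close> it is a multiple of.\<close>

definition extremal :: "'n \<Rightarrow> nat \<Rightarrow> nat \<Rightarrow> ('n::finite \<Rightarrow>\<^sub>0 nat) \<Rightarrow> ('n, 'k::field) lin_op \<Rightarrow> bool" where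
  "extremal k d e t0 P \<longleftrightarrow> P \<in> ortho_ops d e \<and> (\<forall>j. j \<noteq> k \<longrightarrow> E k j * P = P * E k j) \<and>
     (\<forall>t. entry P (Poly_Mapping.single k d) t \<noteq> 0 \<longleftrightarrow> t = t0)"

text \<open>
  Among the nonzero operators of maximal \<open>x\<^sub>k\<close>-shift, one with the fewest nonzero entries
  is a weight vector, since a commutator with a diagonal operator minus the right multiple has
  strictly fewer entries.
\<close>

lemma extremal_exists:
  fixes Y :: "('n::finite, 'k::field_char_0) lin_op"
  assumes Y: "Y \<in> ortho_ops d e" "Y \<noteq> 0"
  obtains t0 and P :: "('n, 'k) lin_op" where "extremal k d e t0 P"
proof -
  \<comment> \<open>\<open>Q n X\<close> bounds the shift of the exponent of x_k below by n - d. The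
    offset d keeps the index a natural number, at most 2d.\<close>
  define Q where "Q n X \<longleftrightarrow> X \<in> ortho_ops d e \<and> X \<noteq> 0 \<and>
     (\<forall>s t. entry X s t \<noteq> 0 \<longrightarrow> n + Poly_Mapping.lookup t k \<le> d + Poly_Mapping.lookup s k)"
    for n and X :: "('n, 'k) lin_op"
  define supp where "supp X = {p. entry X (fst p) (snd p) \<noteq> 0}" for X :: "('n, 'k) lin_op"
  have fin: "finite (supp X)" if "X \<in> ortho_ops d e" for X
  proof (rule finite_subset)
    show "supp X \<subseteq> exps d \<times> exps d"
      using end_ops_entry[OF ortho_ops_end_ops[OF that]] by (auto simp: supp_def exps_def)
  qed (simp add: finite_exps)
  have "Poly_Mapping.lookup t k \<le> d" if "entry Y s t \<noteq> 0" for s t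
    using lookup_le_degree[of t k] end_ops_entry[OF ortho_ops_end_ops[OF Y(1)] that] by simp
  then have "Q 0 Y"
    using Y by (auto simp: Q_def intro: trans_le_add1)
  moreover have bound: "n \<le> 2 * d" if Q: "Q n X" for n X
  proof -
    obtain s t where st: "entry X s t \<noteq> 0"
      using Q entry_eqI[of X 0] by (auto simp: Q_def)
    moreover have "X \<in> ortho_ops d e" using Q by (simp add: Q_def)
    ultimately have "n + Poly_Mapping.lookup t k \<le> d + Poly_Mapping.lookup s k" "mon_degree s = d"
      using Q end_ops_entry[OF ortho_ops_end_ops[of X d e] st] by (auto simp: Q_def)
    then show ?thesis using lookup_le_degree[of s k] by simp
  qed
  ultimately obtain n where n: "\<exists>X. Q n X" "\<And>m X. Q m X \<Longrightarrow> m \<le> n"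
    using GreatestI_nat[of "\<lambda>n. \<exists>X. Q n X" 0 "2 * d"] Greatest_le_nat[of "\<lambda>n. \<exists>X. Q n X" _ "2 * d"]
    by blast
  then obtain P where P: "Q n P" "\<And>X. Q n X \<Longrightarrow> card (supp P) \<le> card (supp X)"
    using ex_has_least_nat[of "Q n" _ "\<lambda>X. card (supp X)"] by blast
  have PU: "P \<in> ortho_ops d e" and P0: "P \<noteq> 0" using P(1) by (auto simp: Q_def)
  have PQ: "n + Poly_Mapping.lookup t k \<le> d + Poly_Mapping.lookup s k" if "entry P s t \<noteq> 0" for s t
    using P(1) that by (auto simp: Q_def)
  have comm: "E k j * P = P * E k j" if j: "j \<noteq> k" for j
  proof (rule ccontr)
    let ?Z = "E k j * P - P * E k j"
    assume "E k j * P \<noteq> P * E k j"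
    then have "?Z \<noteq> 0" by simp
    moreover have "?Z \<in> ortho_ops d e" using j by (intro ortho_ops_E_commutator PU) auto
    moreover have "Suc n + Poly_Mapping.lookup t k \<le> d + Poly_Mapping.lookup s k" if "entry ?Z s t \<noteq> 0" for s t
    proof -
      from that consider "entry (E k j * P) s t \<noteq> 0" | "entry (P * E k j) s t \<noteq> 0" by fastforce
      then show ?thesis
      proof cases
        case 1
        then obtain u where u: "s = u + unit_exp k" by (metis exp_cases entry_E_left_zero)
        with 1 have "entry P (u + unit_exp j) t \<noteq> 0" by (simp add: entry_E_left)
        from PQ[OF this] j u show ?thesis by (simp add: lookup_add lookup_single)
      next
        case 2
        then obtain v where v: "t = v + unit_exp j" by (metis exp_cases entry_E_right_zero)
        with 2 have "entry P s (v + unit_exp k) \<noteq> 0" by (simp add: entry_E_right)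
        from PQ[OF this] j v show ?thesis by (simp add: lookup_add lookup_single)
      qed
    qed
    ultimately have "Q (Suc n) ?Z" by (simp add: Q_def)
    from n(2)[OF this] show False by simp
  qed
  have wt: "Poly_Mapping.lookup s i + Poly_Mapping.lookup t' i = Poly_Mapping.lookup s' i + Poly_Mapping.lookup t i"
    if st: "entry P s t \<noteq> 0" and st': "entry P s' t' \<noteq> 0" for s t s' t' i
  proof -
    \<comment> \<open>The weight of the entry (s, t) under E_ii - E_jj. As s and t have equal
      degree, summing over j gives m (s_i - t_i), so traceless diagonal operators determine the full
      weight.\<close>
    define q where "q i j s t = int (Poly_Mapping.lookup s i) - int (Poly_Mapping.lookup s j)
        - (int (Poly_Mapping.lookup t i) - int (Poly_Mapping.lookup t j))" for i j and s t :: "'n \<Rightarrow>\<^sub>0 nat"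
    have eq: "q i j s t = q i j s' t'" for j
    proof -
      let ?H = "E i i - E j j :: ('n, 'k) lin_op"
      let ?Z = "?H * P - P * ?H - scal (of_int (q i j s t)) * P"
      have Z: "entry ?Z a b = of_int (q i j a b - q i j s t) * entry P a b" for a b
        by (simp add: left_diff_distrib right_diff_distrib entry_E_diag q_def)
      have ZU: "?Z \<in> ortho_ops d e"
        by (intro lin_op.subspace_diff[OF ortho_ops_subspace] lin_op.subspace_scale[OF ortho_ops_subspace] ortho_ops_diag_commutator PU)
      have sub: "supp ?Z \<subseteq> supp P - {(s, t)}"
        unfolding supp_def Z by auto
      then have "supp ?Z \<subset> supp P"
        using st by (auto simp: supp_def)
      then have "card (supp ?Z) < card (supp P)"
        by (rule psubset_card_mono[OF fin[OF PU]])
      then have "\<not> Q n ?Z" using P(2) by (meson not_le)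
      moreover have "n + Poly_Mapping.lookup b k \<le> d + Poly_Mapping.lookup a k" if "entry ?Z a b \<noteq> 0" for a b
        using that PQ[of a b] unfolding Z by auto
      ultimately have "?Z = 0" using ZU by (auto simp: Q_def)
      then have "of_int (q i j s' t' - q i j s t) * entry P s' t' = 0"
        using Z[of s' t'] by simp
      with st' show ?thesis by simp
    qed
    have deg: "(\<Sum>j\<in>UNIV. int (Poly_Mapping.lookup a j)) = int d" if "mon_degree a = d" for a :: "'n \<Rightarrow>\<^sub>0 nat"
      using that by (simp add: mon_degree_def flip: of_nat_sum)
    have q: "(\<Sum>j\<in>UNIV. q i j a b) = int CARD('n) * (int (Poly_Mapping.lookup a i) - int (Poly_Mapping.lookup b i))"
      if "entry P a b \<noteq> 0" for a b
      using end_ops_entry[OF ortho_ops_end_ops[OF PU] that] deg[of a] deg[of b] by (simp add: q_def sum_subtractf right_diff_distrib)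
    have "int CARD('n) * (int (Poly_Mapping.lookup s i) - int (Poly_Mapping.lookup t i)) =
        int CARD('n) * (int (Poly_Mapping.lookup s' i) - int (Poly_Mapping.lookup t' i))"
      using q[OF st] q[OF st'] eq by simp
    then show ?thesis by simp
  qed
  obtain t0 where t0: "entry P (Poly_Mapping.single k d) t0 \<noteq> 0"
    using centralizer_row[OF ortho_ops_end_ops[OF PU] comm] P0 by blast
  have uniq: "t = t0" if "entry P (Poly_Mapping.single k d) t \<noteq> 0" for t
    using wt[OF t0 that] by (intro poly_mapping_eqI) simp
  have "extremal k d e t0 P"
    unfolding extremal_def using t0 PU comm uniq by blast
  then show ?thesis by (rule that)
qed

text \<open>The Jacobi identity [A, [B, P]] = [D, P] + [B, [A, P]] with D = [A, B].\<close>

lemma commutator_centralizes: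
  fixes A B D P :: "'a::ring"
  assumes "A * B = B * A + D" "A * P = P * A" "D * P = P * D"
  shows "A * (B * P - P * B) = (B * P - P * B) * A"
proof -
  have "A * (B * P) = (B * A + D) * P" by (simp only: assms(1)[symmetric] mult.assoc)
  also have "\<dots> = B * (P * A) + P * D" by (simp only: distrib_right mult.assoc assms(2,3))
  finally have "A * (B * P) = B * (P * A) + P * D" .
  moreover have "A * (P * B) = P * (A * B)" by (simp only: assms(2) mult.assoc[symmetric])
  ultimately show ?thesis by (simp add: assms(1) algebra_simps)
qed

text \<open>The bracket of \<open>E k l\<close> with \<open>E i j\<close> is 0 or
  \<open>E k j\<close>, so the commutator still commutes with all of them. In row x_k^d the term
  \<open>E i j * P\<close> vanishes because x_i does not occur there, and the other term trades x_i
  for x_j in the weight.\<close>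

lemma extremal_step:
  fixes P :: "('n::finite, 'k::field_char_0) lin_op"
  assumes P: "extremal k d e (v + unit_exp i) P" and ij: "i \<noteq> j" "i \<noteq> k" "j \<noteq> k"
  shows "extremal k d e (v + unit_exp j) (E i j * P - P * E i j)"
  unfolding extremal_def
proof (intro conjI allI impI)
  show "E i j * P - P * E i j \<in> ortho_ops d e"
    using P ij by (intro ortho_ops_E_commutator) (auto simp: extremal_def)
  fix l assume l: "l \<noteq> k"
  have comm: "E k j * P = P * E k j" "E k l * P = P * E k l"
    using P ij l by (auto simp: extremal_def)
  have br: "E k l * E i j = E i j * E k l + (if l = i then E k j else (0 :: ('n, 'k) lin_op))"
    using E_commutator[of k l i j] ij by (simp add: algebra_simps split: if_splits)
  show "E k l * (E i j * P - P * E i j) = (E i j * P - P * E i j) * E k l"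
    by (rule commutator_centralizes[OF br comm(2)]) (simp add: comm(1))
next
  fix t
  let ?r = "Poly_Mapping.single k d"
  have "entry (E i j * P) ?r t = 0" using ij by (intro entry_E_left_zero) (simp add: lookup_single)
  then have *: "entry (E i j * P - P * E i j) ?r t \<noteq> 0 \<longleftrightarrow> entry (P * E i j) ?r t \<noteq> 0" by simp
  show "entry (E i j * P - P * E i j) ?r t \<noteq> 0 \<longleftrightarrow> t = v + unit_exp j"
    unfolding *
  proof (rule exp_cases[of t j])
    assume "Poly_Mapping.lookup t j = 0"
    then show "(entry (P * E i j) ?r t \<noteq> 0) = (t = v + unit_exp j)"
      by (auto simp: entry_E_right_zero lookup_add)
  next
    fix u assume t: "t = u + unit_exp j"
    have "entry P ?r (u + unit_exp i) \<noteq> 0 \<longleftrightarrow> u + unit_exp i = v + unit_exp i"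
      using P by (simp add: extremal_def)
    then show "(entry (P * E i j) ?r t \<noteq> 0) = (t = v + unit_exp j)"
      by (simp add: t entry_E_right del: of_nat_add of_nat_Suc)
  qed
qed

text \<open>Units move one at a time from a variable in excess to one in deficit, never touching
  x_k; the total excess over \<open>t1\<close> decreases.\<close>

lemma extremal_transport:
  fixes P :: "('n::finite, 'k::field_char_0) lin_op"
  assumes "extremal k d e t0 P" "mon_degree t0 = mon_degree t1" "Poly_Mapping.lookup t0 k = Poly_Mapping.lookup t1 k"
  shows "\<exists>P :: ('n, 'k) lin_op. extremal k d e t1 P"
  using assms
proof (induction "\<Sum>i\<in>UNIV. Poly_Mapping.lookup t0 i - Poly_Mapping.lookup t1 i" arbitrary: t0 P rule: less_induct)
  case less
  show ?case
  proof (cases "\<exists>i. Poly_Mapping.lookup t1 i < Poly_Mapping.lookup t0 i")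
    case False
    then have le: "Poly_Mapping.lookup t0 i \<le> Poly_Mapping.lookup t1 i" for i by (simp add: not_less)
    have "Poly_Mapping.lookup t0 i = Poly_Mapping.lookup t1 i" for i
    proof (rule ccontr)
      assume "Poly_Mapping.lookup t0 i \<noteq> Poly_Mapping.lookup t1 i"
      then have "Poly_Mapping.lookup t0 i < Poly_Mapping.lookup t1 i" using le[of i] by simp
      then have "mon_degree t0 < mon_degree t1"
        unfolding mon_degree_def by (intro sum_strict_mono_ex1) (use le in auto)
      with less.prems show False by simp
    qed
    then have "t0 = t1" by (rule poly_mapping_eqI)
    with less.prems show ?thesis by auto
  next
    case True
    then obtain i where i: "Poly_Mapping.lookup t1 i < Poly_Mapping.lookup t0 i" by blast
    have "\<exists>j. Poly_Mapping.lookup t0 j < Poly_Mapping.lookup t1 j"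
    proof (rule ccontr)
      assume "\<not> (\<exists>j. Poly_Mapping.lookup t0 j < Poly_Mapping.lookup t1 j)"
      then have "mon_degree t1 < mon_degree t0"
        unfolding mon_degree_def using i by (intro sum_strict_mono_ex1) (auto simp: not_less intro!: bexI[of _ i])
      with less.prems show False by simp
    qed
    then obtain j where j: "Poly_Mapping.lookup t0 j < Poly_Mapping.lookup t1 j" by blast
    have ij: "i \<noteq> j" "i \<noteq> k" "j \<noteq> k" using i j less.prems(3) by auto
    obtain v where v: "t0 = v + unit_exp i" using i by (metis exp_cases not_less0)
    let ?t = "v + unit_exp j"
    have l0: "Poly_Mapping.lookup t0 l = Poly_Mapping.lookup v l + (if l = i then 1 else 0)"
      and lt: "Poly_Mapping.lookup ?t l = Poly_Mapping.lookup v l + (if l = j then 1 else 0)" for l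
      by (auto simp: v lookup_add lookup_single when_def)
    have "Poly_Mapping.lookup v j < Poly_Mapping.lookup t1 j" "Poly_Mapping.lookup t1 i < Poly_Mapping.lookup v i + 1"
      using i j ij(1) by (simp_all add: l0)
    then have "Poly_Mapping.lookup ?t l - Poly_Mapping.lookup t1 l \<le> Poly_Mapping.lookup t0 l - Poly_Mapping.lookup t1 l"
      "Poly_Mapping.lookup ?t i - Poly_Mapping.lookup t1 i < Poly_Mapping.lookup t0 i - Poly_Mapping.lookup t1 i" for l
      unfolding l0 lt using ij(1) by auto
    then have "(\<Sum>l\<in>UNIV. Poly_Mapping.lookup ?t l - Poly_Mapping.lookup t1 l) <
        (\<Sum>l\<in>UNIV. Poly_Mapping.lookup t0 l - Poly_Mapping.lookup t1 l)"
      by (intro sum_strict_mono_ex1) auto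
    moreover have "mon_degree ?t = mon_degree t1" "Poly_Mapping.lookup ?t k = Poly_Mapping.lookup t1 k"
      using less.prems ij by (auto simp: v mon_degree_add lookup_add lookup_single)
    ultimately show ?thesis
      using extremal_step[OF less.prems(1)[unfolded v] ij] less.hyps[of ?t] by blast
  qed
qed

section \<open>Products of raising operators\<close>

definition raising :: "'n \<Rightarrow> 'n list \<Rightarrow> ('n, 'k::field) lin_op" where
  "raising k js = prod_list (map (E k) js)"

definition list_exp :: "'n list \<Rightarrow> ('n \<Rightarrow>\<^sub>0 nat)" where
  "list_exp js = sum_list (map unit_exp js)"

lemma raising_simps [simp]: "raising k [] = 1" "raising k (j # js) = E k j * raising k js"
  and list_exp_simps [simp]: "list_exp [] = 0" "list_exp (j # js) = unit_exp j + list_exp js"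
  by (simp_all add: raising_def list_exp_def)

lemma raising_append: "raising k (is @ js) = raising k is * raising k js"
  by (induction "is") (simp_all add: mult.assoc)

lemma mon_degree_list_exp [simp]: "mon_degree (list_exp js) = length js"
  by (induction js) (simp_all add: mon_degree_add mon_degree_def[of 0])

lemma lookup_list_exp_notin: "k \<notin> set js \<Longrightarrow> Poly_Mapping.lookup (list_exp js) k = 0"
  by (induction js) (auto simp: lookup_add lookup_single)

text \<open>Only the positivity of the factor matters: in characteristic zero it stays nonzero. Its
  value is therefore left existential.\<close>

lemma raising_mon:
  "\<exists>n > 0. app (raising k js) (mon (v + list_exp js)) =
     poly_scale (of_nat n :: 'k::field) (mon (v + Poly_Mapping.single k (length js)))"
proof (induction js arbitrary: v)
  case Nil
  show ?case by (intro exI[of _ 1]) simp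
next
  case (Cons j js)
  obtain n where n: "n > 0" "app (raising k js) (mon (v + unit_exp j + list_exp js)) =
     poly_scale (of_nat n :: 'k) (mon (v + unit_exp j + Poly_Mapping.single k (length js)))"
    using Cons[of "v + unit_exp j"] by blast
  let ?w = "v + Poly_Mapping.single k (length js)"
  have eq: "v + unit_exp j + Poly_Mapping.single k (length js) = ?w + unit_exp j"
    "v + Poly_Mapping.single k (length (j # js)) = ?w + unit_exp k"
    "v + list_exp (j # js) = v + unit_exp j + list_exp js"
    by (simp_all add: add_ac single_add[symmetric] plus_1_eq_Suc)
  have "app (raising k (j # js)) (mon (v + list_exp (j # js))) =
      poly_scale (of_nat (n * (Poly_Mapping.lookup ?w j + 1)) :: 'k) (mon (v + Poly_Mapping.single k (length (j # js))))"
    unfolding raising_simps app_lin_op_simps eq(3) n(2) app_scale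
    unfolding eq(1,2) E_mon_add by simp
  with n(1) show ?case by (intro exI[of _ "n * (Poly_Mapping.lookup ?w j + 1)"]) simp
qed

lemma entry_raising:
  "entry (raising k js :: ('n, 'k::field) lin_op) s t \<noteq> 0 \<Longrightarrow> s + list_exp js = t + Poly_Mapping.single k (length js)"
proof (induction js arbitrary: s)
  case Nil
  then show ?case by (auto simp: entry_def lookup_single when_def split: if_splits)
next
  case (Cons j js)
  then obtain u where u: "s = u + unit_exp k" by (metis exp_cases entry_E_left_zero raising_simps(2))
  with Cons.prems have "entry (raising k js :: ('n, 'k) lin_op) (u + unit_exp j) t \<noteq> 0" by (auto simp: entry_E_left)
  from Cons.IH[OF this] have "u + unit_exp j + list_exp js + unit_exp k =
      t + Poly_Mapping.single k (length js) + unit_exp k"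
    by simp
  then show ?case
    by (simp add: u add_ac single_add[symmetric] plus_1_eq_Suc)
qed

lemma raising_commute: "j \<noteq> k \<Longrightarrow> k \<notin> set js \<Longrightarrow> E k j * raising k js = (raising k js * E k j :: ('n, 'k::field) lin_op)"
proof (induction js)
  case (Cons l js)
  have "E k j * E k l = (E k l * E k j :: ('n, 'k) lin_op)"
    using E_commutator[of k j k l] Cons.prems by simp
  then have "E k j * raising k (l # js) = (E k l * (E k j * raising k js) :: ('n, 'k) lin_op)"
    by (metis mult.assoc raising_simps(2))
  also have "\<dots> = raising k (l # js) * E k j"
    using Cons by (simp add: mult.assoc)
  finally show ?case .
qed simp

lemma raising_proj: "raising k js * proj d = proj d * raising k js"
proof (induction js)
  case (Cons j js)
  then show ?case by (simp add: mult.assoc proj_E_left)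
qed simp

text \<open>The product and a transported extremal operator both commute with all
  \<open>E k j\<close>, and their rows at x_k^d are supported at the same exponent. Scaling makes
  these rows equal, so by \<open>centralizer_row\<close> the operators are proportional.\<close>

lemma raising_in_ortho_ops:
  fixes P :: "('n::finite, 'k::field_char_0) lin_op"
  assumes P: "extremal k d e t0 P"
    and js: "k \<notin> set js" "length js + Poly_Mapping.lookup t0 k = d"
  shows "raising k js * proj d \<in> (ortho_ops d e :: ('n, 'k) lin_op set)"
proof -
  let ?r = "Poly_Mapping.single k d" and ?R = "raising k js * proj d :: ('n, 'k) lin_op"
  \<comment> \<open>The exponent that the product turns into x_k^d: the variables of
    \<open>js\<close> are traded for x_k, and the remaining power of x_k is that of
    \<open>t0\<close>.\<close>
  define t1 where "t1 = Poly_Mapping.single k (Poly_Mapping.lookup t0 k) + list_exp js"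
  have "entry P ?r t0 \<noteq> 0" using P by (simp add: extremal_def)
  then have "mon_degree t0 = d" using end_ops_entry[OF ortho_ops_end_ops[of P d e], of ?r t0] P by (auto simp: extremal_def)
  moreover have t1: "mon_degree t1 = d" "Poly_Mapping.lookup t1 k = Poly_Mapping.lookup t0 k"
    using js by (simp_all add: t1_def mon_degree_add lookup_add lookup_list_exp_notin)
  ultimately obtain P1 :: "('n, 'k) lin_op" where P1: "extremal k d e t1 P1"
    using extremal_transport[OF P, of t1] by auto
  have REV: "?R \<in> end_ops d"
    by (simp add: end_ops_def mult.assoc raising_proj)
  have Rrow: "entry ?R ?r t = 0" if "t \<noteq> t1" for t
  proof (rule ccontr)
    assume nz: "entry ?R ?r t \<noteq> 0"
    then have "mon_degree t = d" using end_ops_entry[OF REV] by auto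
    with nz have "entry (raising k js :: ('n, 'k) lin_op) ?r t \<noteq> 0" by (simp add: entry_def proj_mon)
    from entry_raising[OF this] js(2)
    have "Poly_Mapping.single k (Poly_Mapping.lookup t0 k) + list_exp js + Poly_Mapping.single k (length js) =
      t + Poly_Mapping.single k (length js)"
      by (metis add.assoc add.commute single_add)
    with that show False by (simp add: t1_def)
  qed
  obtain n where n: "n > 0" "app (raising k js) (mon t1) =
      poly_scale (of_nat n :: 'k) (mon (Poly_Mapping.single k (Poly_Mapping.lookup t0 k) + Poly_Mapping.single k (length js)))"
    using raising_mon[of k js "Poly_Mapping.single k (Poly_Mapping.lookup t0 k)"] by (auto simp: t1_def)
  have "entry ?R ?r t1 = of_nat n"
    using t1(1) js(2) by (simp add: entry_def proj_mon n(2) lookup_poly_scale add.commute flip: single_add)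
  then have nz: "entry ?R ?r t1 \<noteq> 0" using n(1) by simp
  have P1r: "entry P1 ?r t1 \<noteq> 0" "\<And>t. t \<noteq> t1 \<Longrightarrow> entry P1 ?r t = 0"
    using P1 by (auto simp: extremal_def)
  define c where "c = entry ?R ?r t1 / entry P1 ?r t1"
  have P1U: "P1 \<in> ortho_ops d e" using P1 by (simp add: extremal_def)
  have "?R - scal c * P1 = 0"
  proof (rule centralizer_row)
    show "?R - scal c * P1 \<in> end_ops d"
      by (intro lin_op.subspace_diff[OF end_ops_subspace] lin_op.subspace_scale[OF end_ops_subspace] REV ortho_ops_end_ops[OF P1U])
    show "E k j * (?R - scal c * P1) = (?R - scal c * P1) * E k j" if "j \<noteq> k" for j
    proof -
      have "E k j * P1 = P1 * E k j" using P1 that by (simp add: extremal_def)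
      moreover have "E k j * ?R = ?R * E k j"
        by (metis mult.assoc proj_E raising_commute[OF that js(1)])
      ultimately show ?thesis
        by (simp add: left_diff_distrib right_diff_distrib mult.assoc scal_left_commute[of "E k j"])
    qed
    show "entry (?R - scal c * P1) ?r t = 0" for t
      by (cases "t = t1") (simp_all add: Rrow P1r c_def)
  qed
  then have "?R = scal c * P1" by simp
  then show ?thesis
    using lin_op.subspace_scale[OF ortho_ops_subspace P1U] by simp
qed

section \<open>Nonvanishing at the central monomial\<close>

text \<open>For even k the unweighted summand is symmetric under i -> k - i, so i may be replaced by
  its mean k / 2; the factor 2 keeps the identity integral. The weight ek + i arises from a
  commutator in the third variable.\<close>

lemma weighted_alternating_sum:
  assumes "even k"
  shows "2 * (\<Sum>i\<le>k. (-1) ^ i * int (k choose i) * int ((e + k - i) choose k) * int ((e + i) choose k) * (int (e * k) + int i))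
     = int k * (2 * int e + 1) * dixon e k"
proof -
  define T where "T i = (-1) ^ i * int (k choose i) * int ((e + k - i) choose k) * int ((e + i) choose k)" for i
  have sym: "T (k - i) = T i" if "i \<le> k" for i
  proof -
    have "e + k - (k - i) = e + i" "e + (k - i) = e + k - i" using that by auto
    moreover have "(-1) ^ (k - i) = ((-1) ^ i :: int)"
      using assms that by (auto simp: minus_one_power_iff)
    moreover have "k choose (k - i) = k choose i"
      using binomial_symmetric[OF that] by simp
    ultimately show ?thesis by (simp add: T_def mult_ac)
  qed
  have rev: "(\<Sum>i\<le>k. T i * int i) = (\<Sum>i\<le>k. T i * int (k - i))"
    by (rule sum.reindex_bij_witness[of _ "\<lambda>i. k - i" "\<lambda>i. k - i"]) (auto simp: sym)
  have "2 * (\<Sum>i\<le>k. T i * int i) = (\<Sum>i\<le>k. T i * int i + T i * int (k - i))"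
    unfolding sum.distrib rev[symmetric] by simp
  also have "\<dots> = (\<Sum>i\<le>k. int k * T i)"
    by (rule sum.cong) (auto simp: of_nat_diff algebra_simps)
  finally have 1: "2 * (\<Sum>i\<le>k. T i * int i) = int k * (\<Sum>i\<le>k. T i)"
    by (simp add: sum_distrib_left)
  have "2 * (\<Sum>i\<le>k. T i * (int (e * k) + int i)) = 2 * int (e * k) * (\<Sum>i\<le>k. T i) + 2 * (\<Sum>i\<le>k. T i * int i)"
    by (simp add: distrib_left sum.distrib sum_distrib_left mult_ac)
  also have "\<dots> = int k * (2 * int e + 1) * (\<Sum>i\<le>k. T i)"
    unfolding 1 by (simp add: algebra_simps)
  also have "(\<Sum>i\<le>k. T i) = dixon e k"
    unfolding T_def by (rule alternating_sum_eq_dixon)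
  finally show ?thesis by (simp only: T_def)
qed

lemma ad_pow_ortho_ops:
  fixes X :: "('n::finite, 'k::field_char_0) lin_op"
  assumes "X \<in> ortho_ops d e" "a \<noteq> b"
  shows "ad_pow (E a b) n X \<in> ortho_ops d e"
  by (induction n) (simp_all add: assms ortho_ops_E_commutator)

lemma ortho_ops_entry: "X \<in> ortho_ops d e \<Longrightarrow> entry X (const_exp e) (const_exp e) = 0"
  by (auto simp: ortho_ops_def dest: neutral_ops_entry)

lemma entry_ad_pow:
  "entry (ad_pow N n X) s t = (\<Sum>i\<le>n. (-1) ^ i * of_nat (n choose i) * entry (N ^ (n - i) * X * N ^ i) s t)"
  by (simp add: ad_pow_expand entry_sum)

lemma entry_E_power_left_zero:
  assumes "a \<noteq> b" "Poly_Mapping.lookup s a < n"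
  shows "entry (E a b ^ n * X) s t = 0"
  using assms(2)
proof (induction n arbitrary: s)
  case (Suc n)
  show ?case
  proof (rule exp_cases[of s a])
    fix u assume s: "s = u + unit_exp a"
    then have "Poly_Mapping.lookup (u + unit_exp b) a < n"
      using assms(1) Suc.prems by (simp add: lookup_add lookup_single)
    from Suc.IH[OF this] show ?thesis
      by (simp add: s mult.assoc entry_E_left)
  qed (simp add: mult.assoc entry_E_left_zero)
qed simp

definition lowering :: "'n \<Rightarrow> 'n list \<Rightarrow> ('n, 'k::field) lin_op" where
  "lowering k js = prod_list (map (\<lambda>j. E j k) js)"

lemma lowering_simps [simp]: "lowering k [] = 1" "lowering k (j # js) = E j k * lowering k js"
  by (simp_all add: lowering_def)

lemma lowering_replicate: "lowering k (replicate n j) = E j k ^ n"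
  and raising_replicate: "raising k (replicate n j) = E k j ^ n"
  and list_exp_replicate: "list_exp (replicate n j) = Poly_Mapping.single j n"
  by (induction n) (simp_all add: single_add[symmetric] plus_1_eq_Suc)

lemma list_exp_append: "list_exp (is @ js) = list_exp is + list_exp js"
  by (simp add: list_exp_def)

lemma lookup_list_exp: "Poly_Mapping.lookup (list_exp js) i = count_list js i"
  by (induction js) (auto simp: lookup_add lookup_single when_def)

lemma lowering_mon:
  "\<exists>n > 0. app (lowering k js) (mon (v + Poly_Mapping.single k (length js))) =
     poly_scale (of_nat n :: 'k::field) (mon (v + list_exp js))"
proof (induction js arbitrary: v)
  case Nil
  show ?case by (intro exI[of _ 1]) simp
next
  case (Cons j js)
  obtain n where n: "n > 0" "app (lowering k js) (mon (v + unit_exp k + Poly_Mapping.single k (length js))) =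
     poly_scale (of_nat n :: 'k) (mon (v + unit_exp k + list_exp js))"
    using Cons[of "v + unit_exp k"] by blast
  let ?w = "v + list_exp js"
  have eq: "v + unit_exp k + list_exp js = ?w + unit_exp k"
    "v + Poly_Mapping.single k (length (j # js)) = v + unit_exp k + Poly_Mapping.single k (length js)"
    "v + list_exp (j # js) = ?w + unit_exp j"
    by (simp_all add: add_ac single_add[symmetric] plus_1_eq_Suc)
  have "app (lowering k (j # js)) (mon (v + Poly_Mapping.single k (length (j # js)))) =
      poly_scale (of_nat (n * (Poly_Mapping.lookup ?w k + 1)) :: 'k) (mon (v + list_exp (j # js)))"
    unfolding lowering_simps app_lin_op_simps eq(2) n(2) app_scale
    unfolding eq(1,3) E_mon_add by (simp add: distrib_left)
  with n(1) show ?case by (intro exI[of _ "n * (Poly_Mapping.lookup ?w k + 1)"]) simp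
qed

text \<open>On monomials free of x_k a commutator with \<open>E j k\<close> acts as left
  multiplication, because \<open>E j k\<close> kills them.\<close>

lemma ortho_ops_lowering:
  fixes X :: "('n::finite, 'k::field_char_0) lin_op"
  assumes "X \<in> ortho_ops d e" "k \<notin> set js"
  shows "\<exists>Z\<in>ortho_ops d e. \<forall>t. Poly_Mapping.lookup t k = 0 \<longrightarrow> app Z (mon t) = app (lowering k js) (app X (mon t))"
  using assms(2)
proof (induction js)
  case Nil
  with assms(1) show ?case by auto
next
  case (Cons j js)
  then obtain Z where Z: "Z \<in> ortho_ops d e"
    "\<forall>t. Poly_Mapping.lookup t k = 0 \<longrightarrow> app Z (mon t) = app (lowering k js) (app X (mon t))"
    by auto
  have "E j k * Z - Z * E j k \<in> ortho_ops d e"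
    using Cons.prems by (intro ortho_ops_E_commutator Z(1)) auto
  then show ?case
    using Z(2) by (intro bexI[of _ "E j k * Z - Z * E j k"]) (auto simp: E_mon_zero)
qed

lemma bounded_count_list:
  assumes "finite S" "n \<le> card S * e"
  shows "\<exists>js. set js \<subseteq> S \<and> length js = n \<and> (\<forall>i. count_list js i \<le> e)"
  using assms
proof (induction S arbitrary: n rule: finite_induct)
  case (insert x S)
  have "n - min n e \<le> card S * e"
    using insert.prems insert.hyps by (auto simp: min_def)
  then obtain js where js: "set js \<subseteq> S" "length js = n - min n e" "\<forall>i. count_list js i \<le> e"
    using insert.IH by blast
  have "count_list (replicate (min n e) x @ js) i \<le> e" for i
  proof (cases "i = x")
    case True
    then have "count_list js i = 0" using js(1) insert.hyps by (auto simp: count_list_0_iff)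
    moreover have "count_list (replicate m x) x = m" for m by (induction m) auto
    ultimately show ?thesis using True by simp
  next
    case False
    then have "count_list (replicate (min n e) x) i = 0" by (simp add: count_list_0_iff)
    with js(3) show ?thesis by simp
  qed
  then show ?case
    using js by (intro exI[of _ "replicate (min n e) x @ js"]) auto
qed simp

text \<open>In the 2e-fold commutator with \<open>E a k\<close> at the central monomial, more than e
  factors on the right exhaust x_k, and more than e on the left would produce more than e powers of
  x_a. Only i = e survives; there the monomial is free of x_k, so \<open>Z\<close> acts as lowering
  after raising, and all steps multiply by positive integers.\<close>

lemma raising_large_notin_ortho_ops:
  fixes k a :: "'n::finite"
  assumes ka: "k \<noteq> a" and js: "k \<notin> set js" "a \<notin> set js" "\<And>i. count_list js i \<le> e"
  shows "raising k (replicate (2 * e) a @ js) * proj (e * CARD('n)) \<notin> (ortho_ops (e * CARD('n)) e :: ('n, 'k::field_char_0) lin_op set)"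
proof
  let ?d = "e * CARD('n)" and ?s = "const_exp e :: 'n \<Rightarrow>\<^sub>0 nat" and ?N = "E a k :: ('n, 'k) lin_op"
  let ?js = "replicate (2 * e) a @ js"
  let ?R = "raising k ?js * proj ?d :: ('n, 'k) lin_op"
  assume "?R \<in> ortho_ops ?d e"
  from ortho_ops_lowering[OF this js(1)] obtain Z where Z: "Z \<in> ortho_ops ?d e"
    "\<And>t. Poly_Mapping.lookup t k = 0 \<Longrightarrow> app Z (mon t) = app (lowering k js) (app ?R (mon t))"
    by blast
  have "entry (?N ^ (2 * e - i) * Z * ?N ^ i) ?s ?s = 0" if "i \<noteq> e" "i \<le> 2 * e" for i
  proof (cases "e < i")
    case True
    then have "app (?N ^ i) (mon ?s) = 0"
      using E_power_zero[of a k ?s i] ka by simp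
    then show ?thesis
      by (simp add: entry_def)
  next
    case False
    then show ?thesis
      using entry_E_power_left_zero[of a k ?s "2 * e - i" "Z * ?N ^ i" ?s] ka that by (simp add: mult.assoc)
  qed
  then have "entry (ad_pow ?N (2 * e) Z) ?s ?s =
      (\<Sum>i\<le>2 * e. if i = e then (-1) ^ e * of_nat (2 * e choose e) * entry (?N ^ e * Z * ?N ^ e) ?s ?s else 0)"
    unfolding entry_ad_pow by (intro sum.cong refl) (auto simp: mult_2)
  also have "\<dots> = (-1) ^ e * of_nat (2 * e choose e) * entry (?N ^ e * Z * ?N ^ e) ?s ?s"
    by simp
  finally have "(-1) ^ e * of_nat (2 * e choose e) * entry (?N ^ e * Z * ?N ^ e) ?s ?s = 0"
    using ortho_ops_entry[OF ad_pow_ortho_ops[OF Z(1), of a k "2 * e"]] ka by simp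
  then have zero: "entry (?N ^ e * Z * ?N ^ e) ?s ?s = 0" by simp
  define v where "v = ?s - Poly_Mapping.single k e"
  \<comment> \<open>What remains after the raising operators have consumed their variables. At that
    stage x_a has exponent 2e, x_k has 0 and the others have e, which is why multiplicities in
    \<open>js\<close> are bounded by e.\<close>
  define w where "w = v + Poly_Mapping.single a e - list_exp ?js"
  have s: "?s = v + Poly_Mapping.single k e"
    by (intro poly_mapping_eqI) (auto simp: v_def lookup_add lookup_minus lookup_single when_def)
  have cnt: "count_list (replicate m a) i = (if i = a then m else 0)" for m i
    by (induction m) auto
  have w: "v + Poly_Mapping.single a e = w + list_exp ?js"
  proof (rule poly_mapping_eqI)
    fix i
    have "count_list js i = 0" if "i = k \<or> i = a" using that js by (auto simp: count_list_0_iff)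
    then show "Poly_Mapping.lookup (v + Poly_Mapping.single a e) i = Poly_Mapping.lookup (w + list_exp ?js) i"
      using js(3)[of i] ka
      by (auto simp: w_def v_def lookup_add lookup_minus lookup_single when_def lookup_list_exp cnt)
  qed
  then have "v + Poly_Mapping.single a e = w + Poly_Mapping.single a e + list_exp js + Poly_Mapping.single a e"
    by (simp add: list_exp_append list_exp_replicate mult_2 single_add add_ac)
  then have v: "v = w + Poly_Mapping.single a e + list_exp js" by simp
  obtain n1 where n1: "n1 > 0" "app (?N ^ e) (mon ?s) = poly_scale (of_nat n1) (mon (v + Poly_Mapping.single a e))"
    using lowering_mon[of k "replicate e a" v, where 'k = 'k]
    by (auto simp: lowering_replicate list_exp_replicate s)
  obtain n2 where n2: "n2 > 0" "app (raising k ?js) (mon (v + Poly_Mapping.single a e)) =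
      poly_scale (of_nat n2 :: 'k) (mon (w + Poly_Mapping.single k (2 * e + length js)))"
    using raising_mon[of k ?js w, where 'k = 'k] by (auto simp: w)
  obtain n3 where n3: "n3 > 0" "app (lowering k js) (mon (w + Poly_Mapping.single k (2 * e + length js))) =
      poly_scale (of_nat n3 :: 'k) (mon (w + Poly_Mapping.single k (2 * e) + list_exp js))"
    using lowering_mon[of k js "w + Poly_Mapping.single k (2 * e)", where 'k = 'k] by (auto simp: add.assoc single_add)
  obtain n4 where n4: "n4 > 0" "app (?N ^ e) (mon (w + Poly_Mapping.single k (2 * e) + list_exp js)) =
      poly_scale (of_nat n4) (mon ?s)"
  proof -
    have "w + Poly_Mapping.single k (2 * e) + list_exp js =
        w + Poly_Mapping.single k e + list_exp js + Poly_Mapping.single k e"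
      by (simp add: mult_2 single_add add_ac)
    moreover have "?s = w + Poly_Mapping.single k e + list_exp js + Poly_Mapping.single a e"
      unfolding s by (subst v) (simp add: add_ac)
    ultimately show ?thesis
      using lowering_mon[of k "replicate e a" "w + Poly_Mapping.single k e + list_exp js", where 'k = 'k] that
      by (auto simp: lowering_replicate list_exp_replicate)
  qed
  have "mon_degree (v + Poly_Mapping.single a e) = ?d"
    using arg_cong[OF s, of mon_degree] by (simp add: mon_degree_add)
  moreover have "Poly_Mapping.lookup (v + Poly_Mapping.single a e) k = 0"
    using ka by (simp add: v_def lookup_add lookup_minus lookup_single)
  ultimately have "app Z (mon (v + Poly_Mapping.single a e)) =
      poly_scale (of_nat n2 * of_nat n3) (mon (w + Poly_Mapping.single k (2 * e) + list_exp js))"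
    by (simp add: Z(2) proj_mon n2(2) n3(2) app_scale)
  then have "app (?N ^ e * Z * ?N ^ e) (mon ?s) =
      poly_scale (of_nat n1 * (of_nat n2 * of_nat n3 * of_nat n4)) (mon ?s)"
    by (simp add: n1(2) app_scale n4(2))
  then have "entry (?N ^ e * Z * ?N ^ e) ?s ?s = of_nat n1 * (of_nat n2 * of_nat n3 * of_nat n4)"
    by (simp add: entry_def lookup_poly_scale)
  with zero n1(1) n2(1) n3(1) n4(1) show False
    by simp
qed

text \<open>Trinomial revision merges the binomials of the two lowering stages, and the factorials
  are absorbed by one factor \<open>k choose i\<close>.\<close>

lemma binomial_fact_collect:
  assumes "i \<le> k" "i \<le> e"
  shows "(k choose i) * (fact i * (e choose i) * (fact (k - i) * ((e + k - i) choose (k - i)))) =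
    fact k * ((k choose i) * ((e + k - i) choose k))"
proof -
  have "((e + k - i) choose k) * (k choose (k - i)) = ((e + k - i) choose (k - i)) * (e choose i)"
    using choose_mult[of "k - i" k "e + k - i"] assms by simp
  moreover have "k choose (k - i) = k choose i"
    using binomial_symmetric[OF assms(1)] by simp
  moreover have "(k choose i) * (fact i * fact (k - i)) = fact k"
    using binomial_fact_lemma[OF assms(1)] by (simp add: mult_ac)
  ultimately show ?thesis
    by (metis (no_types, lifting) mult.assoc mult.commute)
qed

context
  fixes k a b :: "'n::finite" and v :: "'n \<Rightarrow>\<^sub>0 nat"
  assumes kab: "k \<noteq> a" "k \<noteq> b" "a \<noteq> b"
    and v: "Poly_Mapping.lookup v k = 0" "Poly_Mapping.lookup v a = 0" "Poly_Mapping.lookup v b = 0"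
begin

text \<open>Only the exponents of k, a, b vary; \<open>v\<close> holds the other variables, and
  \<open>st e e e\<close> will be the central exponent.\<close>

abbreviation (input) st :: "nat \<Rightarrow> nat \<Rightarrow> nat \<Rightarrow> 'n \<Rightarrow>\<^sub>0 nat" where
  "st x y z \<equiv> v + Poly_Mapping.single k x + Poly_Mapping.single a y + Poly_Mapping.single b z"

lemma lookup_st: "Poly_Mapping.lookup (st x y z) k = x" "Poly_Mapping.lookup (st x y z) a = y"
  "Poly_Mapping.lookup (st x y z) b = z"
  using kab v by (simp_all add: lookup_add lookup_single)

lemma E_st:
  "app (E a k) (mon (st x y z)) = poly_scale (of_nat x :: 'k::field) (mon (st (x - 1) (y + 1) z))"
  "app (E b k) (mon (st x y z)) = poly_scale (of_nat x :: 'k::field) (mon (st (x - 1) y (z + 1)))"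
  "app (E k a) (mon (st x y z)) = poly_scale (of_nat y :: 'k::field) (mon (st (x + 1) (y - 1) z))"
  "app (E k b) (mon (st x y z)) = poly_scale (of_nat z :: 'k::field) (mon (st (x + 1) y (z - 1)))"
proof -
  have step: "app (E i j) (mon (u + Poly_Mapping.single j n)) =
      poly_scale (of_nat n :: 'k) (mon (u + Poly_Mapping.single j (n - 1) + unit_exp i))"
    if "Poly_Mapping.lookup u j = 0" for i j n and u :: "'n \<Rightarrow>\<^sub>0 nat"
  proof (cases n)
    case 0
    then show ?thesis using that by (simp add: E_mon_zero)
  next
    case (Suc m)
    have eq: "u + Poly_Mapping.single j (Suc m) = u + Poly_Mapping.single j m + unit_exp j"
      by (metis Suc_eq_plus1 add.assoc single_add)
    show ?thesis
      unfolding Suc eq E_mon_add using that by (simp add: lookup_add)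
  qed
  have swap: "st x y z = v + Poly_Mapping.single a y + Poly_Mapping.single b z + Poly_Mapping.single k x"
    "st x y z = v + Poly_Mapping.single k x + Poly_Mapping.single b z + Poly_Mapping.single a y" for x y z
    by (simp_all add: add_ac)
  show "app (E a k) (mon (st x y z)) = poly_scale (of_nat x :: 'k) (mon (st (x - 1) (y + 1) z))"
    "app (E b k) (mon (st x y z)) = poly_scale (of_nat x :: 'k) (mon (st (x - 1) y (z + 1)))"
    unfolding swap(1)
    by (subst step; use kab v in \<open>simp add: lookup_add lookup_single add_ac single_add\<close>)+
  show "app (E k a) (mon (st x y z)) = poly_scale (of_nat y :: 'k) (mon (st (x + 1) (y - 1) z))"
    unfolding swap(2)
    by (subst step; use kab v in \<open>simp add: lookup_add lookup_single add_ac single_add\<close>)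
  show "app (E k b) (mon (st x y z)) = poly_scale (of_nat z :: 'k) (mon (st (x + 1) y (z - 1)))"
    by (subst step; use kab v in \<open>simp add: lookup_add lookup_single add_ac single_add\<close>)
qed

lemma E_power_st:
  "app (E a k ^ i) (mon (st x y z)) = poly_scale (of_nat (fact i * (x choose i)) :: 'k::field) (mon (st (x - i) (y + i) z))"
  "app (E k a ^ i) (mon (st x y z)) = poly_scale (of_nat (fact i * (y choose i)) :: 'k::field) (mon (st (x + i) (y - i) z))"
proof -
  have c: "fact i * (n choose i) * (n - i) = fact (Suc i) * (n choose Suc i)" for n i :: nat
  proof -
    have "fact i * (n choose i) * (n - i) = fact i * ((n - i) * (n choose i))" by simp
    also have "(n - i) * (n choose i) = Suc i * (n choose Suc i)"
      by (simp only: binomial_absorption binomial_absorb_comp)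
    finally show ?thesis by (simp only: fact_Suc mult_ac of_nat_id)
  qed
  show "app (E a k ^ i) (mon (st x y z)) = poly_scale (of_nat (fact i * (x choose i)) :: 'k) (mon (st (x - i) (y + i) z))"
  proof (induction i)
    case (Suc i)
    have "app (E a k ^ Suc i) (mon (st x y z)) =
        poly_scale (of_nat (fact i * (x choose i) * (x - i)) :: 'k) (mon (st (x - i - 1) (y + i + 1) z))"
      by (simp only: power_Suc app_lin_op_simps Suc app_scale E_st poly.scale_scale of_nat_mult)
    then show ?case unfolding c by (simp add: diff_diff_left flip: Suc_eq_plus1)
  qed simp
  show "app (E k a ^ i) (mon (st x y z)) = poly_scale (of_nat (fact i * (y choose i)) :: 'k) (mon (st (x + i) (y - i) z))"
  proof (induction i)
    case (Suc i)
    have "app (E k a ^ Suc i) (mon (st x y z)) =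
        poly_scale (of_nat (fact i * (y choose i) * (y - i)) :: 'k) (mon (st (x + i + 1) (y - i - 1) z))"
      by (simp only: power_Suc app_lin_op_simps Suc app_scale E_st poly.scale_scale of_nat_mult)
    then show ?case unfolding c by (simp add: diff_diff_left flip: Suc_eq_plus1)
  qed simp
qed

text \<open>The central monomial passes through \<open>st (e - i) (e + i) e\<close> and returns.
  Each stage contributes a falling factorial, written as a factorial times a binomial that vanishes
  when the stage runs out of its variable.\<close>

lemma entry_lowering_raising_even:
  assumes s: "st e e e = const_exp e" and "i \<le> n" and d: "d = e * CARD('n)"
  shows "entry (E a k ^ (n - i) * (E k a ^ n * proj d) * E a k ^ i) (const_exp e) (const_exp e) =
    (of_nat (fact i * (e choose i) * (fact (n - i) * ((e + n - i) choose (n - i))) * (fact n * ((e + i) choose n))) :: 'k::field)"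
proof (cases "i \<le> e \<and> n \<le> e + i")
  case False
  then have z: "e choose i = 0 \<or> (e + i) choose n = 0"
    by (auto simp: binomial_eq_0)
  have "app (E k a ^ n * proj d * E a k ^ i) (mon (st e e e)) = (0 :: ('n, 'k) mpoly)"
    using z by (auto simp: E_power_st proj_mon app_scale simp del: binomial_eq_0_iff)
  with z show ?thesis
    unfolding s[symmetric] by (auto simp: entry_def mult.assoc simp del: binomial_eq_0_iff)
next
  case True
  have deg: "mon_degree (st (e - i) (e + i) e) = d"
    using arg_cong[OF s, of mon_degree] True d by (simp add: mon_degree_add)
  have "e - i + n - (n - i) = e" "e + i - n + (n - i) = e" "e - i + n = e + n - i"
    using True assms(2) by auto
  then have "app (E a k ^ (n - i) * (E k a ^ n * proj d) * E a k ^ i) (mon (st e e e)) =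
      poly_scale (of_nat (fact i * (e choose i) * (fact (n - i) * ((e + n - i) choose (n - i))) * (fact n * ((e + i) choose n))) :: 'k)
        (mon (st e e e))"
    by (simp add: E_power_st proj_mon deg app_scale mult_ac)
  then show ?thesis
    unfolding s[symmetric] by (simp add: entry_def lookup_poly_scale)
qed

text \<open>The extra factor is e (e + n - i + 1) - (e - i) (e + 1) = en + i. With
  \<open>E b k\<close> on the left, x_b is used at exponent e and x_k at e + n - i + 1; with it on
  the right, x_k is used at e - i and x_b at e + 1.\<close>

lemma entry_lowering_raising_odd:
  assumes s: "st e e e = const_exp e" and "i \<le> n" and d: "d = e * CARD('n)" and e: "e > 0"
  shows "entry (E a k ^ (n - i) * (E b k * (E k a ^ n * E k b * proj d) - (E k a ^ n * E k b * proj d) * E b k) * E a k ^ i)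
      (const_exp e) (const_exp e) =
    (of_nat (fact i * (e choose i) * (fact (n - i) * ((e + n - i) choose (n - i))) * (fact n * ((e + i) choose n)) *
      (e * n + i)) :: 'k::field)"
proof (cases "i \<le> e \<and> n \<le> e + i")
  case False
  then have z: "e choose i = 0 \<or> (e + i) choose n = 0"
    by (auto simp: binomial_eq_0)
  have "app (E k a ^ n * E k b * proj d * E a k ^ i) (mon (st e e e)) = (0 :: ('n, 'k) mpoly)"
    using z by (auto simp: E_power_st E_st proj_mon app_scale simp del: binomial_eq_0_iff)
  moreover have "app (E k a ^ n * E k b * proj d * E b k * E a k ^ i) (mon (st e e e)) = (0 :: ('n, 'k) mpoly)"
    using z by (auto simp: E_power_st E_st proj_mon app_scale simp del: binomial_eq_0_iff)
  ultimately show ?thesis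
    using z unfolding s[symmetric] by (auto simp: entry_def mult.assoc left_diff_distrib right_diff_distrib app_diff simp del: binomial_eq_0_iff)
next
  case True
  let ?C = "of_nat (fact i * (e choose i) * (fact (n - i) * ((e + n - i) choose (n - i))) * (fact n * ((e + i) choose n))) :: 'k"
  have deg: "mon_degree (st (e - i) (e + i) e) = d"
    using arg_cong[OF s, of mon_degree] True d by (simp add: mon_degree_add)
  have ar: "e - i + n - (n - i) = e" "e + i - n + (n - i) = e" "e - i + n = e + n - i"
    using True assms(2) by auto
  have "app (E a k ^ (n - i) * (E b k * (E k a ^ n * E k b * proj d)) * E a k ^ i) (mon (st e e e)) =
      poly_scale (?C * (of_nat e * of_nat (e + n - i + 1))) (mon (st e e e))"
  proof -
    have "e - i + 1 + n = e + n - i + 1" using True by simp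
    then show ?thesis
      using ar e by (simp add: E_power_st E_st proj_mon deg app_scale mult_ac)
  qed
  moreover have "app (E a k ^ (n - i) * (E k a ^ n * E k b * proj d * E b k) * E a k ^ i) (mon (st e e e)) =
      poly_scale (?C * (of_nat (e - i) * of_nat (e + 1))) (mon (st e e e))"
  \<comment> \<open>If e = i then \<open>E b k\<close> meets no x_k. The truncated exponent would
    give a monomial of the wrong degree, so this case is separate.\<close>
  proof (cases "e - i")
    case 0
    moreover have "app (E b k) (mon (v + Poly_Mapping.single a (e + i) + Poly_Mapping.single b e)) = (0 :: ('n, 'k) mpoly)"
      using E_st(2)[of 0 "e + i" e, where 'k = 'k] by simp
    ultimately show ?thesis by (simp add: E_power_st app_scale)
  next
    case (Suc m)
    then have "mon_degree (st (e - i - 1) (e + i) (e + 1)) = d"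
      using deg by (simp add: mon_degree_add)
    moreover have "e - i - 1 + 1 = e - i" using Suc by simp
    ultimately show ?thesis
      using ar by (simp add: E_power_st E_st proj_mon app_scale mult_ac)
  qed
  ultimately have "app (E a k ^ (n - i) * (E b k * (E k a ^ n * E k b * proj d) - (E k a ^ n * E k b * proj d) * E b k) * E a k ^ i)
     (mon (st e e e)) = poly_scale (?C * (of_nat e * of_nat (e + n - i + 1) - of_nat (e - i) * of_nat (e + 1))) (mon (st e e e))"
    by (simp only: left_diff_distrib right_diff_distrib app_lin_op_simps app_diff poly.scale_left_diff_distrib)
  moreover have "of_nat e * of_nat (e + n - i + 1) - of_nat (e - i) * of_nat (e + 1) = (of_nat (e * n + i) :: 'k)"
    using True assms(2) by (simp add: of_nat_diff algebra_simps)
  ultimately show ?thesis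
    unfolding s[symmetric] by (simp add: entry_def lookup_poly_scale)
qed

text \<open>The n-fold commutator with \<open>E a k\<close> has central entry (n!)^2 times
  \<open>dixon e n\<close>, and the bounds on n are those of \<open>dixon_nonzero\<close>.\<close>

lemma raising_even_notin_ortho_ops:
  assumes s: "st e e e = const_exp e" and n: "even n" "n \<le> 2 * e"
  shows "raising k (replicate n a) * proj (e * CARD('n)) \<notin> (ortho_ops (e * CARD('n)) e :: ('n, 'k::field_char_0) lin_op set)"
proof
  let ?d = "e * CARD('n)" and ?s = "const_exp e :: 'n \<Rightarrow>\<^sub>0 nat"
  let ?R = "E k a ^ n * proj ?d :: ('n, 'k) lin_op"
  assume "raising k (replicate n a) * proj ?d \<in> (ortho_ops ?d e :: ('n, 'k) lin_op set)"
  then have "?R \<in> ortho_ops ?d e"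
    by (simp add: raising_replicate)
  then have "0 = entry (ad_pow (E a k) n ?R) ?s ?s"
    using ortho_ops_entry[OF ad_pow_ortho_ops[of ?R ?d e a k n]] kab by simp
  also have "\<dots> = (\<Sum>i\<le>n. of_int ((fact n) ^ 2 * ((-1) ^ i * int (n choose i) * int ((e + n - i) choose n) * int ((e + i) choose n))))"
    unfolding entry_ad_pow
  proof (rule sum.cong[OF refl])
    fix i assume "i \<in> {..n}"
    then have i: "i \<le> n" by simp
    have "(n choose i) * (fact i * (e choose i) * (fact (n - i) * ((e + n - i) choose (n - i))) * (fact n * ((e + i) choose n))) =
       fact n ^ 2 * ((n choose i) * ((e + n - i) choose n) * ((e + i) choose n))"
    proof (cases "i \<le> e")
      case True
      have "(n choose i) * (fact i * (e choose i) * (fact (n - i) * ((e + n - i) choose (n - i))) * (fact n * ((e + i) choose n))) =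
          (n choose i) * (fact i * (e choose i) * (fact (n - i) * ((e + n - i) choose (n - i)))) * (fact n * ((e + i) choose n))"
        by (simp only: mult.assoc)
      then show ?thesis
        unfolding binomial_fact_collect[OF i True] by (simp only: power2_eq_square mult_ac)
    next
      case False
      then have "e + n - i < n" using i by simp
      with False show ?thesis by (simp add: binomial_eq_0)
    qed
    then have "of_nat (n choose i) * (of_nat (fact i * (e choose i) * (fact (n - i) * ((e + n - i) choose (n - i))) * (fact n * ((e + i) choose n))) :: 'k) =
       of_nat (fact n ^ 2 * ((n choose i) * ((e + n - i) choose n) * ((e + i) choose n)))"
      by (metis of_nat_mult)
    then show "(- 1) ^ i * of_nat (n choose i) * entry (E a k ^ (n - i) * ?R * E a k ^ i) ?s ?s =
       of_int ((fact n) ^ 2 * ((-1) ^ i * int (n choose i) * int ((e + n - i) choose n) * int ((e + i) choose n)))"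
      unfolding entry_lowering_raising_even[OF s i refl] by (simp add: mult_ac)
  qed
  also have "\<dots> = of_int ((fact n) ^ 2 * dixon e n)"
    unfolding alternating_sum_eq_dixon[symmetric] sum_distrib_left of_int_sum ..
  finally have "dixon e n = 0" by simp
  moreover obtain j where "n = 2 * j" using n(1) by (rule evenE)
  ultimately show False using dixon_nonzero[of j e] n(2) by simp
qed

text \<open>The commutator with \<open>E b k\<close> undoes the factor \<open>E k b\<close> at the
  price of the weight en + i; twice the weighted sum is n (2e + 1) times the unweighted one.\<close>

lemma raising_odd_notin_ortho_ops:
  assumes s: "st e e e = const_exp e" and n: "even n" "n \<le> 2 * e" "n > 0"
  shows "raising k (replicate n a @ [b]) * proj (e * CARD('n)) \<notin> (ortho_ops (e * CARD('n)) e :: ('n, 'k::field_char_0) lin_op set)"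
proof
  let ?d = "e * CARD('n)" and ?s = "const_exp e :: 'n \<Rightarrow>\<^sub>0 nat"
  let ?R = "E k a ^ n * E k b * proj ?d :: ('n, 'k) lin_op"
  let ?X = "E b k * ?R - ?R * E b k"
  define S where "S = (\<Sum>i\<le>n. (-1) ^ i * int (n choose i) * int ((e + n - i) choose n) * int ((e + i) choose n)
      * (int (e * n) + int i))"
  have e: "e > 0" using n by simp
  assume "raising k (replicate n a @ [b]) * proj ?d \<in> (ortho_ops ?d e :: ('n, 'k) lin_op set)"
  then have "?R \<in> ortho_ops ?d e"
    by (simp add: raising_append raising_replicate)
  then have "?X \<in> ortho_ops ?d e"
    using kab by (intro ortho_ops_E_commutator) auto
  then have "0 = entry (ad_pow (E a k) n ?X) ?s ?s"
    using ortho_ops_entry[OF ad_pow_ortho_ops[of ?X ?d e a k n]] kab by simp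
  also have "\<dots> = (\<Sum>i\<le>n. of_int ((fact n) ^ 2 * ((-1) ^ i * int (n choose i) * int ((e + n - i) choose n) * int ((e + i) choose n)
      * (int (e * n) + int i))))"
    unfolding entry_ad_pow
  proof (rule sum.cong[OF refl])
    fix i assume "i \<in> {..n}"
    then have i: "i \<le> n" by simp
    have "(n choose i) * (fact i * (e choose i) * (fact (n - i) * ((e + n - i) choose (n - i))) * (fact n * ((e + i) choose n)) * (e * n + i)) =
       fact n ^ 2 * ((n choose i) * ((e + n - i) choose n) * ((e + i) choose n) * (e * n + i))"
    proof (cases "i \<le> e")
      case True
      have "(n choose i) * (fact i * (e choose i) * (fact (n - i) * ((e + n - i) choose (n - i))) * (fact n * ((e + i) choose n)) * (e * n + i)) =
          (n choose i) * (fact i * (e choose i) * (fact (n - i) * ((e + n - i) choose (n - i)))) * (fact n * ((e + i) choose n) * (e * n + i))"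
        by (simp only: mult.assoc)
      then show ?thesis
        unfolding binomial_fact_collect[OF i True] by (simp only: power2_eq_square mult_ac)
    next
      case False
      then have "e + n - i < n" using i by simp
      with False show ?thesis by (simp add: binomial_eq_0)
    qed
    then have "of_nat (n choose i) * (of_nat (fact i * (e choose i) * (fact (n - i) * ((e + n - i) choose (n - i))) * (fact n * ((e + i) choose n)) * (e * n + i)) :: 'k) =
       of_nat (fact n ^ 2 * ((n choose i) * ((e + n - i) choose n) * ((e + i) choose n) * (e * n + i)))"
      by (metis of_nat_mult)
    then show "(- 1) ^ i * of_nat (n choose i) * entry (E a k ^ (n - i) * ?X * E a k ^ i) ?s ?s =
       of_int ((fact n) ^ 2 * ((-1) ^ i * int (n choose i) * int ((e + n - i) choose n) * int ((e + i) choose n) * (int (e * n) + int i)))"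
      unfolding entry_lowering_raising_odd[OF s i refl e] by (simp add: mult_ac)
  qed
  also have "\<dots> = of_int ((fact n) ^ 2 * S)"
    unfolding S_def sum_distrib_left of_int_sum ..
  finally have "S = 0" by simp
  then have "int n * (2 * int e + 1) * dixon e n = 0"
    using weighted_alternating_sum[OF n(1), of e] by (simp add: S_def)
  then have "dixon e n = 0" using n(3) by auto
  moreover obtain j where "n = 2 * j" using n(1) by (rule evenE)
  ultimately show False using dixon_nonzero[of j e] n(2) by simp
qed

end

text \<open>Pairing with \<open>E a k\<close> gives a trace whose terms are the natural numbers t_k
  (t_a + 1); the monomial x_k^d contributes d.\<close>

lemma raising_one_notin_ortho_ops:
  assumes "k \<noteq> (a :: 'n::finite)" "d > 0"
  shows "E k a * proj d \<notin> (ortho_ops d e :: ('n, 'k::field_char_0) lin_op set)"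
proof
  assume "E k a * proj d \<in> (ortho_ops d e :: ('n, 'k) lin_op set)"
  then have "op_trace d (E k a * proj d * (E a k * proj d)) = (0 :: 'k)"
    using sl_ops_E[of a k d] assms(1) by (auto simp: ortho_ops_def)
  moreover have "entry (E k a * proj d * (E a k * proj d)) t t =
      (of_nat (Poly_Mapping.lookup t k * (Poly_Mapping.lookup t a + 1)) :: 'k)" if t: "t \<in> exps d" for t
  proof (rule exp_cases[of t k])
    fix u assume u: "t = u + unit_exp k"
    then have "mon_degree (u + unit_exp a) = d"
      using t by (simp add: exps_def mon_degree_add)
    then show ?thesis
      using t assms(1)
      by (simp add: entry_def proj_mon exps_def u E_mon_add app_scale lookup_poly_scale lookup_add lookup_single
          del: of_nat_add of_nat_Suc)
  qed (use t in \<open>simp add: entry_def proj_mon exps_def E_mon_zero\<close>)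
  ultimately have "of_nat (\<Sum>t\<in>exps d. Poly_Mapping.lookup t k * (Poly_Mapping.lookup t a + 1)) = (0 :: 'k)"
    by (simp add: op_trace_def)
  then have "(\<Sum>t\<in>exps d. Poly_Mapping.lookup t k * (Poly_Mapping.lookup t a + 1)) = 0"
    by (simp only: of_nat_eq_0_iff)
  then have zero: "\<forall>t\<in>exps d. Poly_Mapping.lookup t k * (Poly_Mapping.lookup t a + 1) = 0"
    by (simp only: sum_eq_0_iff[OF finite_exps])
  have "Poly_Mapping.single k d \<in> exps d" by (simp add: exps_def)
  from bspec[OF zero this] assms(2) show False by simp
qed

lemma ortho_ops_trivial:
  fixes Y :: "('n::finite, 'k::field_char_0) lin_op"
  assumes m: "CARD('n) \<ge> 3" and e: "e > 0" and Y: "Y \<in> ortho_ops (e * CARD('n)) e"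
  shows "Y = 0"
proof (rule ccontr)
  let ?d = "e * CARD('n)"
  assume "Y \<noteq> 0"
  obtain k a b :: 'n where kab: "k \<noteq> a" "k \<noteq> b" "a \<noteq> b"
  proof -
    obtain S :: "'n set" where "card S = 3" using m by (metis obtain_subset_with_card_n)
    then show ?thesis using that by (auto simp: card_3_iff)
  qed
  obtain t0 and P :: "('n, 'k) lin_op" where P: "extremal k ?d e t0 P"
    using extremal_exists[OF Y \<open>Y \<noteq> 0\<close>] by blast
  then have "mon_degree t0 = ?d"
    using end_ops_entry[OF ortho_ops_end_ops[of P ?d e], of "Poly_Mapping.single k ?d" t0] by (auto simp: extremal_def)
  then have le: "Poly_Mapping.lookup t0 k \<le> ?d" using lookup_le_degree[of t0 k] by simp
  \<comment> \<open>The number of raising operators in the product proportional to P.\<close>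
  define n where "n = ?d - Poly_Mapping.lookup t0 k"
  have R: "raising k js * proj ?d \<in> (ortho_ops ?d e :: ('n, 'k) lin_op set)" if "k \<notin> set js" "length js = n" for js
    using raising_in_ortho_ops[OF P that(1)] that(2) le by (simp add: n_def)
  define v where "v = const_exp e - (Poly_Mapping.single k e + Poly_Mapping.single a e + Poly_Mapping.single b e)"
  have v0: "Poly_Mapping.lookup v k = 0" "Poly_Mapping.lookup v a = 0" "Poly_Mapping.lookup v b = 0"
    by (simp_all add: v_def lookup_add lookup_minus)
  have st: "v + Poly_Mapping.single k e + Poly_Mapping.single a e + Poly_Mapping.single b e = const_exp e"
    by (rule poly_mapping_eqI) (use kab in \<open>auto simp: v_def lookup_add lookup_minus lookup_single when_def\<close>)
  note even = raising_even_notin_ortho_ops[OF kab v0 st] and odd = raising_odd_notin_ortho_ops[OF kab v0 st]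
  consider "2 * e \<le> n" | "n < 2 * e" "even n" | "n = 1" | "n < 2 * e" "odd n" "n \<noteq> 1" by linarith
  then show False
  proof cases
    case 1
    \<comment> \<open>As n is at most em, at most (m - 2) e factors remain besides the 2e copies of
      a, and they fit into the other m - 2 variables with multiplicity at most e.\<close>
    let ?S = "UNIV - {k, a}"
    have "card ?S = CARD('n) - 2" using kab by (simp add: card_Diff_subset)
    moreover have "n - 2 * e \<le> ?d - 2 * e" by (simp add: n_def)
    moreover have "?d - 2 * e = (CARD('n) - 2) * e"
      by (simp only: diff_mult_distrib mult.commute[of e])
    ultimately obtain js where js: "set js \<subseteq> ?S" "length js = n - 2 * e" "\<forall>i. count_list js i \<le> e"
      using bounded_count_list[of ?S "n - 2 * e" e] by auto
    have "raising k (replicate (2 * e) a @ js) * proj ?d \<in> (ortho_ops ?d e :: ('n, 'k) lin_op set)"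
      using js kab 1 by (intro R) auto
    moreover have "raising k (replicate (2 * e) a @ js) * proj ?d \<notin> (ortho_ops ?d e :: ('n, 'k) lin_op set)"
      using js kab by (intro raising_large_notin_ortho_ops) auto
    ultimately show False by simp
  next
    case 2
    with even[of n] R[of "replicate n a"] kab show False by (auto split: if_splits)
  next
    case 3
    then have "E k a * proj ?d \<in> (ortho_ops ?d e :: ('n, 'k) lin_op set)"
      using R[of "[a]"] kab by simp
    moreover have "E k a * proj ?d \<notin> (ortho_ops ?d e :: ('n, 'k) lin_op set)"
      using kab e by (intro raising_one_notin_ortho_ops) auto
    ultimately show False by simp
  next
    case 4
    then have "n \<noteq> 0" by (intro notI) simp
    with 4 have n: "Suc (n - 1) = n" "even (n - 1)" "n - 1 \<le> 2 * e" "n - 1 > 0" by auto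
    then have "raising k (replicate (n - 1) a @ [b]) * proj ?d \<in> (ortho_ops ?d e :: ('n, 'k) lin_op set)"
      using kab by (intro R) (auto split: if_splits)
    moreover have "raising k (replicate (n - 1) a @ [b]) * proj ?d \<notin> (ortho_ops ?d e :: ('n, 'k) lin_op set)"
      by (rule odd[OF n(2-4)])
    ultimately show False by simp
  qed
qed

section \<open>Passage between operators and endomorphisms of V\<close>

lemma End_lin_op:
  fixes F :: "('n::finite, 'k::field) mpoly \<Rightarrow> ('n, 'k) mpoly"
  assumes F: "F \<in> End (hom_polys d)"
  obtains X where "X \<in> end_ops d" "\<And>p. p \<in> hom_polys d \<Longrightarrow> F p = app X p"
proof -
  define X where "X = Lop (\<lambda>p. F (app (proj d) p))"
  have X: "app X p = F (app (proj d) p)" for p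
    unfolding X_def
    by (subst Lop_inverse) (use F in \<open>auto simp: End_def proj_in_hom app_add app_scale\<close>)
  have "X \<in> end_ops d"
  proof -
    have "F p \<in> hom_polys d" if "p \<in> hom_polys d" for p
      using F that by (auto simp: End_def)
    then show ?thesis
      unfolding end_ops_def by (auto intro!: lin_op_eqI simp: X proj_hom proj_in_hom)
  qed
  then show ?thesis by (rule that) (simp add: X proj_hom)
qed

lemma singular_op_not_invertible:
  assumes "F \<in> End (hom_polys d)" "\<And>p. p \<in> hom_polys d \<Longrightarrow> F p = app X p" "singular_op d X"
  shows "\<not> invertible_on (hom_polys d) F"
proof
  assume "invertible_on (hom_polys d) F"
  then obtain g where g: "g \<in> End (hom_polys d)" "\<And>p. p \<in> hom_polys d \<Longrightarrow> g (F p) = p"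
    by (auto simp: invertible_on_def)
  obtain v where v: "v \<in> hom_polys d" "v \<noteq> 0" "app X v = 0"
    using assms(3) by (auto simp: singular_op_def)
  have "g (0 + 0) = g 0 + g 0"
    using g(1) hom_0 by (auto simp: End_def simp del: add_0_left add_0_right)
  then have "g 0 = 0" by simp
  with g(2)[OF v(1)] v assms(2)[OF v(1)] show False by simp
qed

text \<open>Injectivity gives surjectivity by \<open>nonsingular_surj\<close>. The inverse is chosen
  pointwise and set to 0 outside V, as membership in \<open>End\<close> demands; its linearity
  follows from injectivity.\<close>

lemma singular_op_if_not_invertible:
  fixes F :: "('n::finite, 'k::field) mpoly \<Rightarrow> ('n, 'k) mpoly"
  assumes F: "F \<in> End (hom_polys d)" and X: "\<And>p. p \<in> hom_polys d \<Longrightarrow> F p = app X p"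
    and ninv: "\<not> invertible_on (hom_polys d) F"
  shows "singular_op d X"
proof (rule ccontr)
  let ?V = "hom_polys d :: ('n, 'k) mpoly set"
  assume ns: "\<not> singular_op d X"
  have FV: "F p \<in> ?V" if "p \<in> ?V" for p using F that by (auto simp: End_def)
  have surj: "\<exists>v\<in>?V. F v = w" if "w \<in> ?V" for w
    using nonsingular_surj[OF ns _ that] FV X by auto
  have inj: "u = v" if "u \<in> ?V" "v \<in> ?V" "F u = F v" for u v
  proof -
    have "u - v \<in> ?V" using that by (intro poly.subspace_diff[OF subspace_hom_polys])
    moreover have "app X (u - v) = 0" using that X by (simp add: app_diff)
    ultimately show ?thesis using ns by (auto simp: singular_op_def)
  qed
  define g where "g w = (if w \<in> ?V then SOME v. v \<in> ?V \<and> F v = w else 0)" for w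
  have g: "g w \<in> ?V" "F (g w) = w" if "w \<in> ?V" for w
  proof -
    have "g w \<in> ?V \<and> F (g w) = w"
      using someI_ex[of "\<lambda>v. v \<in> ?V \<and> F v = w"] surj[OF that] that by (auto simp: g_def)
    then show "g w \<in> ?V" "F (g w) = w" by auto
  qed
  have gF: "g (F p) = p" if "p \<in> ?V" for p
    using inj[OF _ that] g[OF FV[OF that]] by auto
  have "g \<in> End ?V"
    unfolding End_def
  proof (intro CollectI conjI ballI allI impI)
    fix p q assume pq: "p \<in> ?V" "q \<in> ?V"
    then have "F (g p + g q) = p + q" using F g by (auto simp: End_def)
    then show "g (p + q) = g p + g q"
      using gF[of "g p + g q"] g pq poly.subspace_add[OF subspace_hom_polys] by metis
  next
    fix c p assume p: "p \<in> ?V"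
    then have "F (poly_scale c (g p)) = poly_scale c p" using F g by (auto simp: End_def)
    then show "g (poly_scale c p) = poly_scale c (g p)"
      using gF[of "poly_scale c (g p)"] g p hom_scale by metis
  qed (auto simp: g, simp add: g_def)
  with g gF ninv show False
    by (auto simp: invertible_on_def)
qed

lemma nat_rep_eq_lin_field:
  "p \<in> hom_polys d \<Longrightarrow> nat_rep d A p = app (- lin_field (\<lambda>i j. A $ i $ j)) p"
  by (simp add: nat_rep_def restr_def lin_field_app sum_distrib_right poly_scale_mult)

theorem theorem1:
  fixes e :: nat
  assumes "CARD('n::finite) \<ge> 3" and "e > 0"
  shows "maximal_singular_subspace
    (hom_polys (e * CARD('n)) :: ('n, 'k::field_char_0) mpoly set)
    (nat_rep (e * CARD('n)) ` sl)"
proof -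
  let ?d = "e * CARD('n)"
  let ?V = "hom_polys ?d :: ('n, 'k) mpoly set"
  let ?A = "nat_rep ?d ` (sl :: ('k ^ 'n ^ 'n) set)"
  have "\<not> invertible_on ?V (nat_rep ?d A)" if A: "A \<in> sl" for A :: "'k ^ 'n ^ 'n"
  proof (rule singular_op_not_invertible[OF nat_rep_in_End nat_rep_eq_lin_field])
    have "singular_op ?d (lin_field (\<lambda>i j. A $ i $ j))"
      using A by (intro singular_lin_field) (simp add: sl_def trace_def)
    then show "singular_op ?d (- lin_field (\<lambda>i j. A $ i $ j))" by (simp add: singular_op_def)
  qed
  then have "singular_subspace ?V ?A"
    using subspace_nat_rep_image nat_rep_in_End by (auto simp: singular_subspace_def)
  moreover have False if B: "endo.subspace B" "B \<subseteq> End ?V" "?A \<subset> B" "singular_subspace ?V B" for B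
  proof -
    obtain F where F: "F \<in> B" "F \<notin> ?A" using B(3) by blast
    then have FE: "F \<in> End ?V" using B(2) by blast
    obtain X where X: "X \<in> end_ops ?d" "\<And>p. p \<in> ?V \<Longrightarrow> F p = app X p"
      using End_lin_op[OF FE] by blast
    \<comment> \<open>The sign compensates for \<open>nat_rep\<close> being minus the linear
      field.\<close>
    have rep: "(\<chi> i j. - M i j) \<in> sl"
      "p \<in> ?V \<Longrightarrow> nat_rep ?d (\<chi> i j. - M i j) p = app (lin_field M * proj ?d) p"
      if "(\<Sum>i\<in>UNIV. M i i) = 0" for M :: "'n \<Rightarrow> 'n \<Rightarrow> 'k" and p
    proof -
      show "(\<chi> i j. - M i j) \<in> sl" using that by (simp add: sl_def trace_def sum_negf)
      have "lin_field (\<lambda>i j. - M i j) = - lin_field M"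
        using lin_field_scale[of "- 1" M] by (simp add: scal_uminus)
      then show "p \<in> ?V \<Longrightarrow> nat_rep ?d (\<chi> i j. - M i j) p = app (lin_field M * proj ?d) p"
        by (simp add: nat_rep_eq_lin_field proj_hom)
    qed
    have "X \<in> neutral_ops ?d e"
    proof (rule neutral_ops_I[OF X(1)])
      fix a :: "('n, 'k) lin_op" and t
      assume "a \<in> sl_ops ?d"
      then obtain M where M: "a = lin_field M * proj ?d" "(\<Sum>i\<in>UNIV. M i i) = 0"
        by (auto simp: sl_ops_def)
      \<comment> \<open>This combination lies in the larger subspace \<open>B\<close>, hence is not
        invertible, which is the hypothesis of \<open>neutral_ops_I\<close> for arbitrary a and
        t.\<close>
      let ?G = "nat_rep ?d (\<chi> i j. - M i j) + endo_scale t F"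
      have "nat_rep ?d (\<chi> i j. - M i j) \<in> B" using rep(1)[where M = M, OF M(2)] B(3) by blast
      then have G: "?G \<in> B" using B(1) F(1) by (auto simp: endo.subspace_def)
      show "singular_op ?d (a + scal t * X)"
      proof (rule singular_op_if_not_invertible)
        show "?G \<in> End ?V" using G B(2) by blast
        show "\<not> invertible_on ?V ?G" using G B(4) by (simp add: singular_subspace_def)
        show "?G p = app (a + scal t * X) p" if "p \<in> ?V" for p
          using rep(2)[where M = M, OF M(2) that] X(2)[OF that] by (simp add: M(1) endo_scale_def)
      qed
    qed
    moreover have "X \<notin> sl_ops ?d"
    proof
      assume "X \<in> sl_ops ?d"
      then obtain M where M: "X = lin_field M * proj ?d" "(\<Sum>i\<in>UNIV. M i i) = 0"
        by (auto simp: sl_ops_def)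
      \<comment> \<open>Equality as functions is required, so arguments outside V count too; there
        both sides are 0 by the encoding of \<open>End\<close>.\<close>
      have "F p = nat_rep ?d (\<chi> i j. - M i j) p" for p
      proof (cases "p \<in> ?V")
        case True
        then show ?thesis using rep(2)[where M = M, OF M(2)] X(2) M(1) by simp
      next
        case False
        then show ?thesis using FE by (simp add: End_def nat_rep_def restr_def)
      qed
      then have "F = nat_rep ?d (\<chi> i j. - M i j)" by blast
      with rep(1)[where M = M, OF M(2)] F(2) show False by blast
    qed
    ultimately obtain Y :: "('n, 'k) lin_op" where "Y \<in> ortho_ops ?d e" "Y \<noteq> 0"
      using ortho_ops_nontrivial assms(2) by blast
    with ortho_ops_trivial[OF assms] show False by blast
  qed
  ultimately show ?thesis
    unfolding maximal_singular_subspace_def by blast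
qed

end
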